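(* Let $f\in\mathcal{A}$. Then $f$ admits an invariant probability measure $\mu$ that is absolutely continuous with respect to Lebesgue measure. Moreover, let $l_{\max}=\max\{l(c\pm):c\in C\}$. If $l_{\max}>1$, then the density $d\mu/dx$ lies in $L^p(M)$ for every $1\le p<l_{\max}/(l_{\max}-1)$.
   Context: Let $M=[0,1]$. The class $\mathcal{A}$ consists of maps $f:M\to M$ with the following properties. (1) Piecewise structure. There is a finite set $C\subset M$ such that $f$ restricted to each connected component of $M\setminus C$ is a $C^1$ diffeomorphism onto its image, and the one-sided limits $f(c\pm)$ exist for every $c\in C$. Each $c\in C$ is regarded as two points $c\pm$. We write $f^n(c)=f^{n-1}(f(c\pm))$. (2) Orders. For each $c\in C$ and each side there is $l(c\pm)\in[1,\infty)$ such that, on the corresponding one-sided neighbourhood of $c$, $$|Df(x)|\approx|x-c|^{l(c\pm)-1},\qquad |f(x)-f(c\pm)|\approx|x-c|^{l(c\pm)}.$$ Here $\approx$ means the ratio is bounded above and below by positive constants. (3) Negative Schwarzian derivative. The function $|f'|^{-1/2}$ is convex on each component of $M\setminus C$. (4) First summability condition. For every $c\in C$ (each side), $$\sum_{n\ge1}\Big(\frac{|f^n(c)-\tilde c|^{l(\tilde c)}}{|f^n(c)-\tilde c|^{l(c)}|Df^n(f(c))|}\Big)^{1/l(c)}<\infty,$$ where $\tilde c\in C$ is the point of $C$ closest to $f^n(c)$, with orders taken on the relevant sides. In particular, critical orbits never hit $C$. (5) Second summability condition. For every $c\in C$ (each side), $$\sum_{n\ge1}|Df^n(f(c))|^{-1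/l(c)}<\infty.$$
   Formalization: The set C is additionally assumed nonempty: for empty C the map f(x)=x/2 satisfies (1)–(5) vacuously but has no absolutely continuous invariant probability measure, and l_max is undefined. *)

theory Defs
  imports "HOL-Probability.Probability"
begin

definition MM :: "real set" where "MM = {0..1}"

text \<open>Sides of a point c: True = right side (c+), False = left side (c-).
  A side is relevant only if the corresponding one-sided neighbourhood meets M.\<close>
definition side_filter :: "real \<Rightarrow> bool \<Rightarrow> real filter" where
  "side_filter c s = (if s then at_right c else at_left c)"

definition side_ok :: "real \<Rightarrow> bool \<Rightarrow> bool" where
  "side_ok c s = (if s then c < 1 else 0 < c)"

definition side_nbhd :: "real \<Rightarrow> bool \<Rightarrow> real \<Rightarrow> real set" where
  "side_nbhd c s d = (if s then {c<..<c+d} else {c-d<..<c})"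

definition fval :: "(real \<Rightarrow> real) \<Rightarrow> real \<Rightarrow> bool \<Rightarrow> real" where
  "fval f c s = Lim (side_filter c s) f"

text \<open>Derivative of the n-th iterate along the orbit: Df^n(y) = prod_{k<n} Df(f^k y).\<close>
definition Dn :: "(real \<Rightarrow> real) \<Rightarrow> (real \<Rightarrow> real) \<Rightarrow> nat \<Rightarrow> real \<Rightarrow> real" where
  "Dn f D n y = (\<Prod>k<n. D ((f ^^ k) y))"

definition closest :: "real set \<Rightarrow> real \<Rightarrow> real" where
  "closest C y = Min {c \<in> C. \<forall>c'\<in>C. \<bar>y - c\<bar> \<le> \<bar>y - c'\<bar>}"

text \<open>The class A, for a map f with singular set C, orders l (l c True = l(c+),
  l c False = l(c-)) and derivative D (defined on M - C).\<close>
definition classA :: "(real \<Rightarrow> real) \<Rightarrow> real set \<Rightarrow> (real \<Rightarrow> bool \<Rightarrow> real) \<Rightarrow> (real \<Rightarrow> real) \<Rightarrow> bool" where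
  "classA f C l D \<longleftrightarrow>
     (\<forall>x\<in>MM. f x \<in> MM) \<and>
     finite C \<and> C \<noteq> {} \<and> C \<subseteq> MM \<and>
     \<comment> \<open>(1) piecewise C^1 diffeomorphism on the components of M - C\<close>
     (\<forall>x\<in>MM - C. let I = connected_component_set (MM - C) x in
         inj_on f I \<and> continuous_on I D \<and>
         (\<forall>y\<in>I. (f has_real_derivative D y) (at y within I) \<and> D y \<noteq> 0)) \<and>
     (\<forall>c\<in>C. \<forall>s. side_ok c s \<longrightarrow> (\<exists>v. (f \<longlongrightarrow> v) (side_filter c s))) \<and>
     \<comment> \<open>(2) orders\<close>
     (\<forall>c\<in>C. \<forall>s. side_ok c s \<longrightarrow> 1 \<le> l c s \<and>
        (\<exists>d>0. \<exists>K>0. side_nbhd c s d \<subseteq> MM - C \<and>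
           (\<forall>x\<in>side_nbhd c s d.
              1 / K \<le> \<bar>D x\<bar> / \<bar>x - c\<bar> powr (l c s - 1) \<and>
              \<bar>D x\<bar> / \<bar>x - c\<bar> powr (l c s - 1) \<le> K \<and>
              1 / K \<le> \<bar>f x - fval f c s\<bar> / \<bar>x - c\<bar> powr (l c s) \<and>
              \<bar>f x - fval f c s\<bar> / \<bar>x - c\<bar> powr (l c s) \<le> K))) \<and>
     \<comment> \<open>(3) negative Schwarzian: |f'|^(-1/2) convex on each component\<close>
     (\<forall>x\<in>MM - C. convex_on (connected_component_set (MM - C) x)
                          (\<lambda>y. \<bar>D y\<bar> powr (-1/2))) \<and>
     \<comment> \<open>critical orbits never hit C: f^n(c) = f^(n-1)(f(c+-)) \<notin> C for n \<ge> 1\<close>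
     (\<forall>c\<in>C. \<forall>s. side_ok c s \<longrightarrow> (\<forall>k. (f ^^ k) (fval f c s) \<notin> C)) \<and>
     \<comment> \<open>(4) first summability condition (sum over n = Suc k \<ge> 1)\<close>
     (\<forall>c\<in>C. \<forall>s. side_ok c s \<longrightarrow>
        summable (\<lambda>k. let y = (f ^^ k) (fval f c s); ct = closest C y in
          (\<bar>y - ct\<bar> powr (l ct (ct < y)) /
            (\<bar>y - ct\<bar> powr (l c s) * \<bar>Dn f D (Suc k) (fval f c s)\<bar>)) powr (1 / l c s))) \<and>
     \<comment> \<open>(5) second summability condition\<close>
     (\<forall>c\<in>C. \<forall>s. side_ok c s \<longrightarrow>
        summable (\<lambda>k. \<bar>Dn f D (Suc k) (fval f c s)\<bar> powr (- 1 / l c s)))"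

definition lmax :: "real set \<Rightarrow> (real \<Rightarrow> bool \<Rightarrow> real) \<Rightarrow> real" where
  "lmax C l = Max {l c s | c s. c \<in> C \<and> side_ok c s}"

definition LebM :: "real measure" where "LebM = restrict_space lborel MM"

end

theory Submission
  imports Defs
begin

text \<open>
  Convexity of \<open>|f'|\<close> to the power \<open>-1/2\<close> means that \<open>f\<close> expands the cross ratio of any four points of a branch,
  a property that is stable under composition. On the half of a branch of \<open>f\<^sup>n\<close> whose image is closer to
  the image \<open>a\<close> of one endpoint \<open>e\<close>, it bounds the preimage of a set by the preimage of a neighbourhood
  of \<open>a\<close>, hence, since \<open>e\<close> is mapped to some \<open>c\<close> in \<open>C\<close> after \<open>k < n\<close> steps, by the preimage under \<open>f\<^sup>k\<close> of a
  neighbourhood of \<open>c\<close> whose size is governed by the derivative along the critical orbit.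

  Push forward Lebesgue measure from an interval between a point of \<open>C\<close> and a critical value. The first
  summability condition makes an induction on \<open>n\<close> close, which shows that the mass of a ball of radius \<open>\<delta>\<close>
  around a point of \<open>C\<close> is at most \<open>K \<delta>\<close>, uniformly in \<open>n\<close>. The second one then bounds the mass of every
  Borel set \<open>A\<close> by a constant times the measure of \<open>A\<close> to the power \<open>1 / l\<^sub>m\<^sub>a\<^sub>x\<close>. By this bound a cluster point of the
  Cesaro averages, a priori only an invariant content, is an absolutely continuous measure with density in
  weak \<open>L\<^sup>q\<close>, \<open>q = l\<^sub>m\<^sub>a\<^sub>x / (l\<^sub>m\<^sub>a\<^sub>x - 1)\<close>.
\<close>

section \<open>Cross ratios\<close>

text \<open>The cross ratio compares slopes only outwards from an endpoint, and only while a
  definite part of the image remains beyond; this forces the cut at the preimage of the midpoint of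
  the image. The recursion closes because every half branch, except one ending at the critical value
  \<open>v\<close> that bounds the start interval, ends at a point whose orbit passes through
  \<open>C\<close>. The sets that appear at an earlier time \<open>k\<close> are therefore again
  balls around \<open>C\<close>, and a linear bound on their mass can be proved by induction. For a
  ball of radius \<delta> around c' and a critical value whose m-th image has distance r from c',
  the scale \<epsilon> is comparable to max \<delta> r and the weight \<kappa> to min 1 (\<delta> /
  r). The ball at the critical point has radius about (\<epsilon> / |Df^m|)^(1/l), so \<kappa> times
  this radius is at most a constant times \<delta> r^(1/l - 1) |Df^m|^(-1/l). The first summability
  condition makes this series converge once Df at the m-th image is estimated by the order of the
  closest point of \<open>C\<close>.\<close>

definition cross_ratio_expanding :: "real set \<Rightarrow> (real \<Rightarrow> real) \<Rightarrow> bool" where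
  "cross_ratio_expanding I h \<longleftrightarrow>
     (\<forall>x0\<in>I. \<forall>x1\<in>I. \<forall>x2\<in>I. \<forall>x3\<in>I. x0 < x1 \<longrightarrow> x1 < x2 \<longrightarrow> x2 < x3 \<longrightarrow>
        (h x1 - h x0) * (h x3 - h x2) * ((x3 - x0) * (x2 - x1))
        \<le> (h x3 - h x0) * (h x2 - h x1) * ((x1 - x0) * (x3 - x2)))"

lemma cross_ratio_expandingD:
  assumes "cross_ratio_expanding I h" "x0 \<in> I" "x1 \<in> I" "x2 \<in> I" "x3 \<in> I"
    "x0 < x1" "x1 < x2" "x2 < x3"
  shows "(h x1 - h x0) * (h x3 - h x2) * ((x3 - x0) * (x2 - x1))
        \<le> (h x3 - h x0) * (h x2 - h x1) * ((x1 - x0) * (x3 - x2))"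
  using assms unfolding cross_ratio_expanding_def by blast

lemma cross_ratio_expanding_uminus:
  "cross_ratio_expanding I (\<lambda>x. - h x) \<longleftrightarrow> cross_ratio_expanding I h"
proof -
  have "(- a - - b) * (- c - - d) = (a - b) * (c - d)" for a b c d :: real
    by (simp add: algebra_simps)
  then show ?thesis unfolding cross_ratio_expanding_def by simp
qed

lemma cross_ratio_expanding_reflect:
  assumes "cross_ratio_expanding I h"
  shows "cross_ratio_expanding (uminus ` I) (\<lambda>x. h (- x))"
  unfolding cross_ratio_expanding_def
proof (intro ballI impI)
  fix x0 x1 x2 x3 assume "x0 \<in> uminus ` I" "x1 \<in> uminus ` I" "x2 \<in> uminus ` I" "x3 \<in> uminus ` I"
    and o: "x0 < x1" "x1 < x2" "x2 < x3"
  then have "- x0 \<in> I" "- x1 \<in> I" "- x2 \<in> I" "- x3 \<in> I" by auto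
  from cross_ratio_expandingD[OF assms this(4,3,2,1)] o
  show "(h (- x1) - h (- x0)) * (h (- x3) - h (- x2)) * ((x3 - x0) * (x2 - x1))
        \<le> (h (- x3) - h (- x0)) * (h (- x2) - h (- x1)) * ((x1 - x0) * (x3 - x2))"
    by (simp add: algebra_simps)
qed

definition strictly_monotonic_on :: "real set \<Rightarrow> (real \<Rightarrow> real) \<Rightarrow> bool" where
  "strictly_monotonic_on I h \<longleftrightarrow> strict_mono_on I h \<or> strict_antimono_on I h"

lemma strictly_monotonic_on_subset:
  "strictly_monotonic_on I h \<Longrightarrow> J \<subseteq> I \<Longrightarrow> strictly_monotonic_on J h"
  unfolding strictly_monotonic_on_def by (blast intro: monotone_on_subset)

lemma strictly_monotonic_on_inj_on:
  "strictly_monotonic_on I h \<Longrightarrow> inj_on h I"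
  by (rule linorder_inj_onI') (fastforce simp: strictly_monotonic_on_def monotone_on_def)

lemma strictly_monotonic_on_compose:
  assumes "strictly_monotonic_on I h" "strictly_monotonic_on (h ` I) k"
  shows "strictly_monotonic_on I (\<lambda>x. k (h x))"
  using assms unfolding strictly_monotonic_on_def
  by (elim disjE) (simp_all add: monotone_on_def)

text \<open>The expanded quantity is total times middle over left times right, written without
  quotients. The factors at least 1 contributed by \<open>h\<close> and \<open>k\<close> multiply;
  in cleared form the inequalities are multiplied and \<open>A * B\<close> is cancelled, which is
  positive since \<open>h\<close> increases.\<close>

lemma cross_ratio_compose_increasing:
  assumes "strict_mono_on I h" and h: "cross_ratio_expanding I h"
    and k: "cross_ratio_expanding (h ` I) k" and km: "strictly_monotonic_on (h ` I) k"
  shows "cross_ratio_expanding I (\<lambda>x. k (h x))"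
  unfolding cross_ratio_expanding_def
proof (intro ballI impI)
  fix x0 x1 x2 x3 assume I: "x0 \<in> I" "x1 \<in> I" "x2 \<in> I" "x3 \<in> I" and o: "x0 < x1" "x1 < x2" "x2 < x3"
  have lt: "h x0 < h x1" "h x1 < h x2" "h x2 < h x3"
    using assms(1) I o unfolding monotone_on_def by auto
  let ?B = "(h x1 - h x0) * (h x3 - h x2)" and ?A = "(h x3 - h x0) * (h x2 - h x1)"
  let ?B' = "(k (h x1) - k (h x0)) * (k (h x3) - k (h x2))"
  let ?A' = "(k (h x3) - k (h x0)) * (k (h x2) - k (h x1))"
  let ?b = "(x1 - x0) * (x3 - x2)" and ?a = "(x3 - x0) * (x2 - x1)"
  have 1: "?B * ?a \<le> ?A * ?b" using cross_ratio_expandingD[OF h I o] .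
  have 2: "?B' * ?A \<le> ?A' * ?B" using cross_ratio_expandingD[OF k _ _ _ _ lt] I by auto
  have k3: "h x0 \<in> h ` I" "h x1 \<in> h ` I" "h x2 \<in> h ` I" "h x3 \<in> h ` I" using I by auto
  have "0 \<le> ?B'" "0 \<le> ?A'"
    using km k3 lt unfolding strictly_monotonic_on_def monotone_on_def
    by (smt (verit, best) mult_nonneg_nonneg mult_nonpos_nonpos)+
  have pos: "0 < ?A" "0 < ?B" "0 \<le> ?a" "0 \<le> ?b" using lt o by auto
  have combine: "B' * a \<le> A' * b"
    if "B * a \<le> A * b" "B' * A \<le> A' * B" "0 < A" "0 < B" "0 \<le> a" "0 \<le> b" "0 \<le> A'" "0 \<le> B'"
    for A B a b A' B' :: real
  proof -
    have "(B' * a) * (A * B) = (B' * A) * (B * a)" by (simp add: ac_simps)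
    also have "\<dots> \<le> (A' * B) * (A * b)" using that by (rule_tac mult_mono) auto
    also have "\<dots> = (A' * b) * (A * B)" by (simp add: ac_simps)
    finally show ?thesis using that by (simp add: mult_le_cancel_right)
  qed
  show "?B' * ?a \<le> ?A' * ?b"
    using combine[OF 1 2 pos \<open>0 \<le> ?A'\<close> \<open>0 \<le> ?B'\<close>] .
qed

text \<open>A decreasing \<open>h\<close> is replaced by the increasing \<open>- h\<close>, followed
  by \<open>k\<close> composed with negation.\<close>

lemma cross_ratio_expanding_compose:
  assumes hm: "strictly_monotonic_on I h" and h: "cross_ratio_expanding I h"
    and k: "cross_ratio_expanding (h ` I) k" and km: "strictly_monotonic_on (h ` I) k"
  shows "cross_ratio_expanding I (\<lambda>x. k (h x))"
proof (cases "strict_mono_on I h")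
  case True
  then show ?thesis using cross_ratio_compose_increasing h k km by blast
next
  case False
  then have "strict_mono_on I (\<lambda>x. - h x)"
    using hm unfolding strictly_monotonic_on_def monotone_on_def by auto
  moreover have "cross_ratio_expanding ((\<lambda>x. - h x) ` I) (\<lambda>y. k (- y))"
    using cross_ratio_expanding_reflect[OF k] by (simp add: image_image)
  moreover have "strictly_monotonic_on ((\<lambda>x. - h x) ` I) (\<lambda>y. k (- y))"
    using km unfolding strictly_monotonic_on_def monotone_on_def by auto
  ultimately show ?thesis
    using cross_ratio_compose_increasing[of I "\<lambda>x. - h x" "\<lambda>y. k (- y)"] h
    by (simp add: cross_ratio_expanding_uminus)
qed

section \<open>Convexity of |h'|^(-1/2) forces expansion of cross ratios\<close>

context
  fixes I :: "real set" and h D :: "real \<Rightarrow> real"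
  assumes I: "is_interval I"
    and der: "\<And>x. x \<in> I \<Longrightarrow> (h has_real_derivative D x) (at x within I)"
    and pos: "\<And>x. x \<in> I \<Longrightarrow> 0 < D x"
    and cvx: "convex_on I (\<lambda>x. \<bar>D x\<bar> powr (-1/2))"
begin

private lemma Icc_subset: "x \<in> I \<Longrightarrow> y \<in> I \<Longrightarrow> {x..y} \<subseteq> I"
  by (meson I atLeastAtMost_iff mem_is_interval_1_I subsetI)

private lemma interior_DERIV:
  assumes "x \<in> I" "y \<in> I" "x < t" "t < y"
  shows "(h has_real_derivative D t) (at t)"
proof -
  have "{x<..<y} \<subseteq> I" using Icc_subset[OF assms(1,2)] by auto
  then have "(h has_real_derivative D t) (at t within {x<..<y})"
    using der assms by (meson DERIV_subset greaterThanLessThan_iff subsetD)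
  then show ?thesis
    using assms by (metis at_within_open greaterThanLessThan_iff open_greaterThanLessThan)
qed

private lemma cont_on: "continuous_on I h"
  by (rule DERIV_continuous_on[OF der])

lemma increasing_of_pos_derivative:
  assumes "x \<in> I" "y \<in> I" "x < y" shows "h x < h y"
proof (rule DERIV_pos_imp_increasing_open[OF \<open>x < y\<close>])
  show "continuous_on {x..y} h" using cont_on Icc_subset assms continuous_on_subset by blast
  fix t assume t: "x < t" "t < y"
  then have "t \<in> I" using Icc_subset[OF assms(1,2)] by auto
  then show "\<exists>d. DERIV h t :> d \<and> 0 < d"
    using interior_DERIV[OF assms(1,2) t] pos by blast
qed

text \<open>The chord \<open>L\<close> of the convex function D^(-1/2) lies above it, so D is at
  least 1 / L^2 between x and y; since \<open>L\<close> is affine, the integral of 1 / L^2 is (y -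
  x) / (\<phi> x * \<phi> y).\<close>

lemma slope_ge_geometric_mean:
  assumes xy: "x \<in> I" "y \<in> I" "x < y"
  shows "D x * D y * (y - x)\<^sup>2 \<le> (h y - h x)\<^sup>2"
proof -
  define \<phi> where "\<phi> = (\<lambda>x. \<bar>D x\<bar> powr (-1/2))"
  have \<phi>pos: "0 < \<phi> t" if "t \<in> I" for t using pos[OF that] by (simp add: \<phi>_def)
  have D\<phi>: "D t = 1 / (\<phi> t)\<^sup>2" if "t \<in> I" for t
  proof -
    have "(\<phi> t)\<^sup>2 = \<phi> t powr 2" using \<phi>pos[OF that] by (simp add: powr_numeral)
    also have "\<dots> = D t powr (-1)" using pos[OF that] by (simp add: \<phi>_def powr_powr)
    finally show ?thesis using pos[OF that] by (simp add: powr_minus_divide)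
  qed
  define s where "s = (\<phi> y - \<phi> x) / (y - x)"
  define L where "L = (\<lambda>t. \<phi> x + s * (t - x))"
  have Lle: "\<phi> t \<le> L t" if "t \<in> {x..y}" for t
  proof -
    define u where "u = (t - x) / (y - x)"
    have u: "0 \<le> u" "u \<le> 1" using that xy by (auto simp: u_def divide_simps)
    have "u * (y - x) = t - x" using xy by (simp add: u_def)
    then have "t = (1 - u) * x + u * y" by (simp add: algebra_simps)
    then have "\<phi> t \<le> (1 - u) * \<phi> x + u * \<phi> y"
      using convex_onD[OF cvx u xy(1,2)] by (simp add: \<phi>_def)
    also have "\<dots> = \<phi> x + u * (\<phi> y - \<phi> x)" by (simp add: algebra_simps)
    also have "u * (\<phi> y - \<phi> x) = s * (t - x)" by (simp add: s_def u_def)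
    finally show ?thesis by (simp add: L_def)
  qed
  have Lpos: "0 < L t" if "t \<in> {x..y}" for t
    using Lle[OF that] \<phi>pos[of t] that Icc_subset[OF xy(1,2)] by force
  \<comment> \<open>The subtracted term is the primitive of 1 / L^2 that vanishes at x; monotonicity
    of \<open>G\<close> stands in for integration.\<close>
  define G where "G = (\<lambda>t. h t - (t - x) / (\<phi> x * L t))"
  have "G x \<le> G y"
  proof (rule DERIV_nonneg_imp_increasing_open[of x y G])
    show "x \<le> y" using xy by simp
    have "continuous_on {x..y} h" using cont_on Icc_subset xy continuous_on_subset by blast
    moreover have "continuous_on {x..y} L" unfolding L_def by (intro continuous_intros)
    moreover have nz: "\<phi> x * L t \<noteq> 0" if "t \<in> {x..y}" for t
      using Lpos[OF that] \<phi>pos[OF xy(1)] by simp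
    ultimately show "continuous_on {x..y} G"
      unfolding G_def using nz by (intro continuous_intros) auto
    fix t assume t: "x < t" "t < y"
    then have tI: "t \<in> {x..y}" "t \<in> I" using Icc_subset[OF xy(1,2)] by auto
    have dL: "(L has_real_derivative s) (at t)"
      unfolding L_def by (auto intro!: derivative_eq_intros)
    have "(G has_real_derivative (D t - ((\<phi> x * L t) - (t - x) * (\<phi> x * s)) / (\<phi> x * L t)\<^sup>2)) (at t)"
      unfolding G_def using Lpos[OF tI(1)] \<phi>pos[OF xy(1)]
      by (auto intro!: derivative_eq_intros interior_DERIV[OF xy(1,2) t] dL simp: power2_eq_square)
    moreover have "((\<phi> x * L t) - (t - x) * (\<phi> x * s)) / (\<phi> x * L t)\<^sup>2 = 1 / (L t)\<^sup>2"
    proof -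
      have "(\<phi> x * L t) - (t - x) * (\<phi> x * s) = (\<phi> x)\<^sup>2"
        by (simp add: L_def algebra_simps power2_eq_square)
      then show ?thesis using \<phi>pos[OF xy(1)] by (simp add: power_mult_distrib)
    qed
    moreover have "1 / (L t)\<^sup>2 \<le> D t"
      unfolding D\<phi>[OF tI(2)] using Lle[OF tI(1)] \<phi>pos[OF tI(2)]
      by (intro divide_left_mono power_mono) auto
    ultimately show "\<exists>d. (G has_real_derivative d) (at t) \<and> 0 \<le> d"
      by (metis diff_ge_0_iff_ge)
  qed
  moreover have "L y = \<phi> y" using xy by (simp add: L_def s_def)
  ultimately have 1: "(y - x) / (\<phi> x * \<phi> y) \<le> h y - h x" by (simp add: G_def)
  have "D x * D y * (y - x)\<^sup>2 = ((y - x) / (\<phi> x * \<phi> y))\<^sup>2"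
    by (simp add: D\<phi> xy power_divide power_mult_distrib)
  also have "\<dots> \<le> (h y - h x)\<^sup>2"
    using 1 xy \<phi>pos[OF xy(1)] \<phi>pos[OF xy(2)] by (intro power_mono) auto
  finally show ?thesis .
qed

text \<open>This is the limit of the cross ratio inequality as x0 and x1 merge at t. The derivative
  of \<open>M\<close> at u is nonnegative by the geometric mean bound on the slope from t to
  u.\<close>

lemma infinitesimal_cross_ratio:
  assumes x: "t \<in> I" "x2 \<in> I" "x3 \<in> I" "t < x2" "x2 < x3"
  shows "D t * (h x3 - h x2) * ((x2 - t) * (x3 - t)) \<le> (x3 - x2) * ((h x2 - h t) * (h x3 - h t))"
proof -
  have hpos: "0 < h u - h t" if "u \<in> {x2..x3}" for u
  proof -
    have "u \<in> I" "t < u" using that Icc_subset[OF x(2,3)] x by auto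
    then show ?thesis using increasing_of_pos_derivative[OF x(1)] by simp
  qed
  have Dt: "0 < D t" using pos x by simp
  define M where "M = (\<lambda>u. 1 / (h u - h t) - 1 / (D t * (u - t)))"
  have "M x2 \<le> M x3"
  proof (rule DERIV_nonneg_imp_increasing_open[of x2 x3 M])
    show "x2 \<le> x3" using x by simp
    have c: "continuous_on {x2..x3} h" using cont_on Icc_subset x continuous_on_subset by blast
    have "h u - h t \<noteq> 0" "D t * (u - t) \<noteq> 0" if "u \<in> {x2..x3}" for u
      using hpos[OF that] Dt that x by auto
    then show "continuous_on {x2..x3} M"
      unfolding M_def using c by (intro continuous_intros) auto
    fix u assume u: "x2 < u" "u < x3"
    then have uI: "u \<in> I" "u \<in> {x2..x3}" "t < u" using Icc_subset[OF x(2,3)] x by auto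
    note hu = hpos[OF uI(2)]
    have "(M has_real_derivative (- D u / (h u - h t)\<^sup>2 + 1 / (D t * (u - t)\<^sup>2))) (at u)"
      unfolding M_def using hu Dt uI
      by (auto intro!: derivative_eq_intros interior_DERIV[OF x(2,3) u] simp: power2_eq_square)
    moreover have "D u / (h u - h t)\<^sup>2 \<le> 1 / (D t * (u - t)\<^sup>2)"
      using slope_ge_geometric_mean[OF x(1) uI(1,3)] hu Dt uI
      by (simp add: divide_simps mult_ac)
    ultimately show "\<exists>d. (M has_real_derivative d) (at u) \<and> 0 \<le> d"
      by (intro exI conjI) auto
  qed
  then have "1 / (h x2 - h t) - 1 / (h x3 - h t) \<le> 1 / (D t * (x2 - t)) - 1 / (D t * (x3 - t))"
    by (simp add: M_def)
  moreover have "1 / (h x2 - h t) - 1 / (h x3 - h t) = (h x3 - h x2) / ((h x2 - h t) * (h x3 - h t))"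
    using hpos[of x2] hpos[of x3] x by (simp add: field_simps)
  moreover have "1 / (D t * (x2 - t)) - 1 / (D t * (x3 - t)) = (x3 - x2) / (D t * ((x2 - t) * (x3 - t)))"
    using Dt x by (simp add: divide_simps)
  ultimately have "(h x3 - h x2) / ((h x2 - h t) * (h x3 - h t)) \<le> (x3 - x2) / (D t * ((x2 - t) * (x3 - t)))"
    by simp
  then show ?thesis
    using hpos[of x2] hpos[of x3] x Dt by (simp add: pos_divide_le_eq pos_le_divide_eq) (simp add: mult_ac)
qed

text \<open>Integrating the infinitesimal inequality over t in [x0, x1] shows that \<open>R\<close>
  increases, the logarithm of (h x2 - h t)(x3 - t) / ((h x3 - h t)(x2 - t)).\<close>

lemma cross_ratio_expanding_increasing: "cross_ratio_expanding I h"
  unfolding cross_ratio_expanding_def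
proof (intro ballI impI)
  fix x0 x1 x2 x3 assume x: "x0 \<in> I" "x1 \<in> I" "x2 \<in> I" "x3 \<in> I" "x0 < x1" "x1 < x2" "x2 < x3"
  have hpos: "0 < h x2 - h u" "0 < h x3 - h u" if "u \<in> {x0..x1}" for u
  proof -
    have "u \<in> I" "u < x2" "u < x3" using that Icc_subset[OF x(1,2)] x by auto
    then show "0 < h x2 - h u" "0 < h x3 - h u" using increasing_of_pos_derivative x(3,4) by simp_all
  qed
  define R where "R = (\<lambda>t. ln (h x2 - h t) - ln (h x3 - h t) - ln (x2 - t) + ln (x3 - t))"
  have "R x0 \<le> R x1"
  proof (rule DERIV_nonneg_imp_increasing_open[of x0 x1 R])
    show "x0 \<le> x1" using x by simp
    have c: "continuous_on {x0..x1} h" using cont_on Icc_subset x continuous_on_subset by blast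
    have nz: "h x2 - h u \<noteq> 0" "h x3 - h u \<noteq> 0" "x2 - u \<noteq> 0" "x3 - u \<noteq> 0" if "u \<in> {x0..x1}" for u
      using hpos[OF that] that x by auto
    show "continuous_on {x0..x1} R"
      unfolding R_def using c nz by (intro continuous_intros) auto
    fix t assume t: "x0 < t" "t < x1"
    then have tI: "t \<in> I" "t \<in> {x0..x1}" "t < x2" "t < x3" using Icc_subset[OF x(1,2)] x by auto
    note hp = hpos[OF tI(2)]
    have "(R has_real_derivative (- D t / (h x2 - h t) + D t / (h x3 - h t) + 1 / (x2 - t) - 1 / (x3 - t))) (at t)"
      unfolding R_def using hp tI
      by (auto intro!: derivative_eq_intros interior_DERIV[OF x(1,2) t])
    moreover have "D t / (h x2 - h t) - D t / (h x3 - h t) \<le> 1 / (x2 - t) - 1 / (x3 - t)"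
    proof -
      have "D t / (h x2 - h t) - D t / (h x3 - h t) = D t * (h x3 - h x2) / ((h x2 - h t) * (h x3 - h t))"
        using hp by (simp add: divide_simps) (simp add: algebra_simps)
      also have "\<dots> \<le> (x3 - x2) / ((x2 - t) * (x3 - t))"
        using infinitesimal_cross_ratio[OF tI(1) x(3,4) tI(3) x(7)] hp tI
        by (simp add: pos_divide_le_eq pos_le_divide_eq)
      also have "\<dots> = 1 / (x2 - t) - 1 / (x3 - t)"
        using tI by (simp add: divide_simps)
      finally show ?thesis .
    qed
    ultimately show "\<exists>d. (R has_real_derivative d) (at t) \<and> 0 \<le> d"
      by (intro exI conjI) auto
  qed
  then have "ln (h x2 - h x0) + ln (x3 - x0) + ln (h x3 - h x1) + ln (x2 - x1)
      \<le> ln (h x2 - h x1) + ln (x3 - x1) + ln (h x3 - h x0) + ln (x2 - x0)"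
    by (simp add: R_def)
  then have "ln ((h x2 - h x0) * (x3 - x0) * (h x3 - h x1) * (x2 - x1))
      \<le> ln ((h x2 - h x1) * (x3 - x1) * (h x3 - h x0) * (x2 - x0))"
    using hpos[of x0] hpos[of x1] x by (simp add: ln_mult)
  then have "(h x2 - h x0) * (x3 - x0) * (h x3 - h x1) * (x2 - x1)
      \<le> (h x2 - h x1) * (x3 - x1) * (h x3 - h x0) * (x2 - x0)"
    using hpos[of x0] hpos[of x1] x by (subst (asm) ln_le_cancel_iff) auto
  then have "((h x2 - h x0) * (h x3 - h x1)) * ((x3 - x0) * (x2 - x1))
      \<le> ((h x3 - h x0) * (h x2 - h x1)) * ((x2 - x0) * (x3 - x1))"
    by (simp only: mult_ac)
  \<comment> \<open>So far the differences are paired as (02)(13) against (03)(12). Since (02)(13) =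
    (03)(12) + (01)(23), a common term cancels and (01)(23) against (03)(12) remains.\<close>
  moreover have pluecker: "(b - c) * (d - e) = (d - c) * (b - e) + (e - c) * (d - b)" for b c d e :: real
    by (simp add: algebra_simps)
  have "(A + B) * a \<le> A * (a + b) \<Longrightarrow> B * a \<le> A * b" for A B a b :: real
    by (simp add: algebra_simps)
  ultimately show "(h x1 - h x0) * (h x3 - h x2) * ((x3 - x0) * (x2 - x1))
        \<le> (h x3 - h x0) * (h x2 - h x1) * ((x1 - x0) * (x3 - x2))"
    unfolding pluecker[of "h x2" "h x0" "h x3" "h x1"] pluecker[of x2 x0 x3 x1] by blast
qed

end

lemma cross_ratio_expanding_of_convex:
  fixes h D :: "real \<Rightarrow> real"
  assumes I: "is_interval I"
    and der: "\<And>x. x \<in> I \<Longrightarrow> (h has_real_derivative D x) (at x within I)"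
    and nz: "\<And>x. x \<in> I \<Longrightarrow> D x \<noteq> 0" and cont: "continuous_on I D"
    and cvx: "convex_on I (\<lambda>x. \<bar>D x\<bar> powr (-1/2))"
  shows "cross_ratio_expanding I h" "strictly_monotonic_on I h"
proof -
  have conn: "is_interval (D ` I)"
    using I cont by (metis connected_continuous_image is_interval_connected_1)
  have "(\<forall>x\<in>I. 0 < D x) \<or> (\<forall>x\<in>I. D x < 0)"
  proof (rule ccontr)
    assume "\<not> ?thesis"
    then obtain x y where "x \<in> I" "y \<in> I" "D x \<le> 0" "0 \<le> D y" by (meson not_less)
    then have "0 \<in> D ` I" using conn unfolding is_interval_1 by blast
    then show False using nz by auto
  qed
  then have "cross_ratio_expanding I h \<and> strictly_monotonic_on I h"
  proof
    assume p: "\<forall>x\<in>I. 0 < D x"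
    have "strict_mono_on I h"
      using increasing_of_pos_derivative[OF I der _ cvx] p by (auto simp: monotone_on_def)
    then show ?thesis
      using cross_ratio_expanding_increasing[OF I der _ cvx] p by (auto simp: strictly_monotonic_on_def)
  next
    assume p: "\<forall>x\<in>I. D x < 0"
    have der': "((\<lambda>x. - h x) has_real_derivative - D x) (at x within I)" if "x \<in> I" for x
      using der[OF that] by (rule DERIV_minus)
    have cvx': "convex_on I (\<lambda>x. \<bar>- D x\<bar> powr (-1/2))" using cvx by simp
    have "strict_mono_on I (\<lambda>x. - h x)"
      using increasing_of_pos_derivative[OF I der' _ cvx'] p by (auto simp: monotone_on_def)
    then show ?thesis
      using cross_ratio_expanding_increasing[OF I der' _ cvx'] p
      by (auto simp: strictly_monotonic_on_def cross_ratio_expanding_uminus monotone_on_def)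
  qed
  then show "cross_ratio_expanding I h" "strictly_monotonic_on I h" by auto
qed

section \<open>Distortion on half branches\<close>

lemma emeasure_le_diameter:
  fixes T :: "real set"
  assumes "\<And>x y. x \<in> T \<Longrightarrow> y \<in> T \<Longrightarrow> \<bar>x - y\<bar> \<le> d" "0 \<le> d" "T \<in> sets borel"
  shows "emeasure lborel T \<le> ennreal d"
proof (cases "T = {}")
  case False
  then obtain t where t: "t \<in> T" by blast
  have bdd: "bdd_below T"
    using assms(1)[OF t] by (intro bdd_belowI[of _ "t - d"]) (force simp: abs_le_iff)
  have "x \<le> Inf T + d" if "x \<in> T" for x
  proof -
    have "x - d \<le> Inf T"
    proof (rule cInf_greatest[OF False])
      fix y assume "y \<in> T"
      then show "x - d \<le> y" using assms(1)[OF that, of y] by linarith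
    qed
    then show ?thesis by simp
  qed
  then have "T \<subseteq> {Inf T..Inf T + d}" using bdd by (auto intro: cInf_lower)
  then have "emeasure lborel T \<le> emeasure lborel {Inf T..Inf T + d}" by (intro emeasure_mono) auto
  then show ?thesis using assms(2) by simp
qed simp

text \<open>The inverse of \<open>h\<close> on \<open>S\<close> is M-Lipschitz. Cover
  \<open>A\<close> by countably many intervals of total length at most |A| + e; the preimage of each
  has diameter at most M times its length.\<close>

lemma emeasure_vimage_le_of_inverse_Lipschitz:
  fixes h :: "real \<Rightarrow> real"
  assumes meas: "\<And>B. B \<in> sets borel \<Longrightarrow> {x\<in>S. h x \<in> B} \<in> sets borel"
    and M: "0 \<le> M" and lip: "\<And>x y. x \<in> S \<Longrightarrow> y \<in> S \<Longrightarrow> \<bar>x - y\<bar> \<le> M * \<bar>h x - h y\<bar>"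
    and A: "A \<in> sets borel" "A \<subseteq> {a..b}"
  shows "emeasure lborel {x\<in>S. h x \<in> A} \<le> ennreal (M * measure lborel A)"
proof -
  have le: "emeasure lborel {x\<in>S. h x \<in> A} \<le> ennreal (M * (measure lborel A + e))" if "0 < e" for e
  proof -
    have "A \<in> lmeasurable"
      using A bounded_subset[OF bounded_closed_interval[of a b]]
      by (intro bounded_set_imp_lmeasurable) auto
    then obtain \<D> where \<D>: "countable \<D>"
        "\<And>K. K \<in> \<D> \<Longrightarrow> K \<subseteq> cbox a b \<and> K \<noteq> {} \<and> (\<exists>c d. K = cbox c d)"
        "pairwise (\<lambda>A B. interior A \<inter> interior B = {}) \<D>"
        "A \<subseteq> \<Union>\<D>" "\<Union>\<D> \<in> lmeasurable" "measure lebesgue (\<Union>\<D>) \<le> measure lebesgue A + e"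
      using measurable_outer_intervals_bounded[of A a b e] A(2) \<open>0 < e\<close>
      by (metis cbox_interval)
    define K where "K i = (if i \<in> to_nat_on \<D> ` \<D> then from_nat_into \<D> i else {})" for i
    have Kor: "K i = {} \<or> K i \<in> \<D>" for i
      using \<D>(1) by (auto simp: K_def)
    have UK: "(\<Union>i. K i) = \<Union>\<D>"
    proof
      show "(\<Union>i. K i) \<subseteq> \<Union>\<D>" using Kor by fastforce
      show "\<Union>\<D> \<subseteq> (\<Union>i. K i)"
      proof
        fix x assume "x \<in> \<Union>\<D>"
        then obtain X where X: "X \<in> \<D>" "x \<in> X" by blast
        then have "K (to_nat_on \<D> X) = X" using \<D>(1) by (simp add: K_def)
        then show "x \<in> (\<Union>i. K i)" using X by blast
      qed
    qed
    have Kcb: "\<exists>c d. K i = {c..d} \<and> K i \<subseteq> {a..b}" for i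
    proof (cases "K i = {}")
      case True
      then have "K i = {1..0}" by simp
      then show ?thesis using True by blast
    next
      case False
      then show ?thesis using Kor[of i] \<D>(2)[of "K i"] by auto
    qed
    have Kb: "K i \<in> sets borel" for i using Kcb[of i] by auto
    \<comment> \<open>The intervals may share endpoints, so only their interiors are disjoint and
      have measures that add up.\<close>
    have disj: "disjoint_family (\<lambda>i. interior (K i))"
      unfolding disjoint_family_on_def
    proof (intro ballI impI)
      fix i j :: nat assume "i \<noteq> j"
      show "interior (K i) \<inter> interior (K j) = {}"
      proof (cases "K i = {} \<or> K j = {}")
        case False
        then have "i \<in> to_nat_on \<D> ` \<D>" "j \<in> to_nat_on \<D> ` \<D>" by (auto simp: K_def split: if_splits)
        then have "K i \<in> \<D>" "K j \<in> \<D>" "K i \<noteq> K j"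
          using \<D>(1) \<open>i \<noteq> j\<close> by (auto simp: K_def)
        then show ?thesis using \<D>(3) by (auto simp: pairwise_def)
      qed auto
    qed
    have emK: "emeasure lborel (interior (K i)) = ennreal (measure lborel (K i))" for i
    proof -
      obtain c d where "K i = {c..d}" using Kcb by blast
      then show ?thesis by (cases "c \<le> d") auto
    qed
    have UDb: "\<Union>\<D> \<in> sets borel" unfolding UK[symmetric] using Kb by auto
    have UDf: "emeasure lborel (\<Union>\<D>) = ennreal (measure lebesgue (\<Union>\<D>))"
      using emeasure_eq_measure2[OF \<D>(5)] UDb by simp
    have "emeasure lborel {x\<in>S. h x \<in> A} \<le> emeasure lborel (\<Union>i. {x\<in>S. h x \<in> K i})"
      using \<D>(4) meas[OF Kb] UK by (intro emeasure_mono) auto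
    also have "\<dots> \<le> (\<Sum>i. emeasure lborel {x\<in>S. h x \<in> K i})"
      using meas[OF Kb] by (intro emeasure_subadditive_countably) auto
    also have "\<dots> \<le> (\<Sum>i. ennreal M * emeasure lborel (interior (K i)))"
    proof (intro suminf_le summableI)
      fix i
      obtain c d where cd: "K i = {c..d}" using Kcb by blast
      have "emeasure lborel {x\<in>S. h x \<in> K i} \<le> ennreal (M * measure lborel (K i))"
      proof (rule emeasure_le_diameter)
        show "{x\<in>S. h x \<in> K i} \<in> sets borel" using meas[OF Kb] .
        fix x y assume xy: "x \<in> {x\<in>S. h x \<in> K i}" "y \<in> {x\<in>S. h x \<in> K i}"
        then have "\<bar>x - y\<bar> \<le> M * \<bar>h x - h y\<bar>" using lip by auto
        also have "\<dots> \<le> M * measure lborel (K i)"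
          using xy cd M by (intro mult_left_mono) auto
        finally show "\<bar>x - y\<bar> \<le> M * measure lborel (K i)" .
      qed (use M in auto)
      then show "emeasure lborel {x\<in>S. h x \<in> K i} \<le> ennreal M * emeasure lborel (interior (K i))"
        using M by (simp add: emK ennreal_mult)
    qed
    also have "\<dots> = ennreal M * emeasure lborel (\<Union>i. interior (K i))"
      using disj by (subst suminf_emeasure[symmetric]) auto
    also have "\<dots> \<le> ennreal M * emeasure lborel (\<Union>\<D>)"
      using UDb UK interior_subset by (intro mult_left_mono emeasure_mono) fastforce+
    also have "\<dots> \<le> ennreal M * ennreal (measure lborel A + e)"
      unfolding UDf using \<D>(6) A(1) by (intro mult_left_mono ennreal_leI) (simp_all add: measure_completion)
    also have "\<dots> = ennreal (M * (measure lborel A + e))"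
      using M that by (simp add: ennreal_mult)
    finally show ?thesis .
  qed
  show ?thesis
  proof (rule ennreal_le_epsilon)
    fix e :: real assume "0 < e"
    \<comment> \<open>Dividing by \<open>M + 1\<close> covers the case M = 0.\<close>
    have "M * (e / (M + 1)) \<le> e" using \<open>0 < e\<close> M by (simp add: field_simps)
    then have "M * (measure lborel A + e / (M + 1)) \<le> M * measure lborel A + e"
      by (simp add: distrib_left)
    then have "ennreal (M * (measure lborel A + e / (M + 1))) \<le> ennreal (M * measure lborel A + e)"
      by (rule ennreal_leI)
    also have "\<dots> = ennreal (M * measure lborel A) + ennreal e"
      using M \<open>0 < e\<close> by (intro ennreal_plus) auto
    finally show "emeasure lborel {x\<in>S. h x \<in> A} \<le> ennreal (M * measure lborel A) + ennreal e"
      using le[of "e / (M + 1)"] \<open>0 < e\<close> M by (meson add_nonneg_pos divide_pos_pos order_trans zero_less_one)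
  qed
qed


section \<open>Measurable preimages and passage to closed intervals\<close>

lemma continuous_on_vimage_borel:
  fixes h :: "real \<Rightarrow> real"
  assumes "continuous_on U h" "U \<in> sets borel" "B \<in> sets borel"
  shows "{x\<in>U. h x \<in> B} \<in> sets borel"
proof -
  have "h \<in> borel_measurable (restrict_space borel U)"
    using assms(1) by (rule borel_measurable_continuous_on_restrict)
  from measurable_sets[OF this assms(3)] show ?thesis
    using assms(2) by (simp add: sets_restrict_space_iff space_restrict_space vimage_def Int_def conj_commute)
qed

text \<open>Contracting the closed interval towards an interior point \<open>m\<close> preserves the
  order and lands in the open interval, so inequalities known inside reach the endpoints as t tends
  to 0.\<close>

lemma shrink_tendsto:
  fixes x m :: real
  assumes "continuous_on {p..q} h" "m \<in> {p<..<q}" "x \<in> {p..q}"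
  shows "((\<lambda>t. h (x + t * (m - x))) \<longlongrightarrow> h x) (at_right 0)"
    and "t \<in> {0<..<1} \<Longrightarrow> x + t * (m - x) \<in> {p<..<q}"
proof -
  have in_box: "x + t * (m - x) \<in> {p<..<q}" if "t \<in> {0<..<1}" for t
  proof -
    have "p = (1 - t) * p + t * p" "q = (1 - t) * q + t * q" by (simp_all add: algebra_simps)
    moreover have "(1 - t) * p \<le> (1 - t) * x" "(1 - t) * x \<le> (1 - t) * q" "t * p < t * m" "t * m < t * q"
      using that assms by auto
    moreover have "x + t * (m - x) = (1 - t) * x + t * m" by (simp add: algebra_simps)
    ultimately show ?thesis by auto
  qed
  then show "t \<in> {0<..<1} \<Longrightarrow> x + t * (m - x) \<in> {p<..<q}" .
  have "((\<lambda>t. x + t * (m - x)) \<longlongrightarrow> x + 0 * (m - x)) (at_right 0)"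
    by (intro tendsto_intros)
  moreover have "\<forall>\<^sub>F t in at_right 0. x + t * (m - x) \<in> {p..q}"
    using eventually_at_right_real[of 0 "1::real"]
  proof (rule eventually_mono)
    fix t :: real assume "t \<in> {0<..<1}"
    then show "x + t * (m - x) \<in> {p..q}" using in_box[of t] by auto
  qed simp
  ultimately show "((\<lambda>t. h (x + t * (m - x))) \<longlongrightarrow> h x) (at_right 0)"
    using assms(1,3) by (intro continuous_on_tendsto_compose[OF assms(1)]) auto
qed

lemma cross_ratio_expanding_closure:
  assumes cont: "continuous_on {p..q} h" and cr: "cross_ratio_expanding {p<..<q} h"
  shows "cross_ratio_expanding {p..q} h"
  unfolding cross_ratio_expanding_def
proof (intro ballI impI)
  fix x0 x1 x2 x3 assume x: "x0 \<in> {p..q}" "x1 \<in> {p..q}" "x2 \<in> {p..q}" "x3 \<in> {p..q}"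
    and o: "x0 < x1" "x1 < x2" "x2 < x3"
  \<comment> \<open>x1 lies strictly between x0 and x2 and can therefore be the centre of the
    contraction.\<close>
  have m: "x1 \<in> {p<..<q}" using x o by auto
  define s where "s t x = x + t * (x1 - x)" for t x
  have lim: "((\<lambda>t. h (s t x)) \<longlongrightarrow> h x) (at_right 0)" "((\<lambda>t. s t x) \<longlongrightarrow> x) (at_right 0)" if "x \<in> {p..q}" for x
    unfolding s_def using shrink_tendsto(1)[OF cont m that] shrink_tendsto(1)[OF continuous_on_id m that] by auto
  show "(h x1 - h x0) * (h x3 - h x2) * ((x3 - x0) * (x2 - x1))
        \<le> (h x3 - h x0) * (h x2 - h x1) * ((x1 - x0) * (x3 - x2))"
  proof (rule tendsto_le)
    show "((\<lambda>t. (h (s t x1) - h (s t x0)) * (h (s t x3) - h (s t x2)) * ((s t x3 - s t x0) * (s t x2 - s t x1)))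
      \<longlongrightarrow> (h x1 - h x0) * (h x3 - h x2) * ((x3 - x0) * (x2 - x1))) (at_right 0)"
      by (intro tendsto_intros lim x)
    show "((\<lambda>t. (h (s t x3) - h (s t x0)) * (h (s t x2) - h (s t x1)) * ((s t x1 - s t x0) * (s t x3 - s t x2)))
      \<longlongrightarrow> (h x3 - h x0) * (h x2 - h x1) * ((x1 - x0) * (x3 - x2))) (at_right 0)"
      by (intro tendsto_intros lim x)
    show "\<forall>\<^sub>F t in at_right 0.
      (h (s t x1) - h (s t x0)) * (h (s t x3) - h (s t x2)) * ((s t x3 - s t x0) * (s t x2 - s t x1))
      \<le> (h (s t x3) - h (s t x0)) * (h (s t x2) - h (s t x1)) * ((s t x1 - s t x0) * (s t x3 - s t x2))"
      using eventually_at_right_real[of 0 "1::real"]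
    proof (rule eventually_mono)
      fix t :: real assume t: "t \<in> {0<..<1}"
      have mono: "s t x < s t y" if "x < y" for x y
      proof -
        have "(1 - t) * x < (1 - t) * y" using t that by simp
        then show ?thesis by (simp add: s_def algebra_simps)
      qed
      show "(h (s t x1) - h (s t x0)) * (h (s t x3) - h (s t x2)) * ((s t x3 - s t x0) * (s t x2 - s t x1))
        \<le> (h (s t x3) - h (s t x0)) * (h (s t x2) - h (s t x1)) * ((s t x1 - s t x0) * (s t x3 - s t x2))"
        using shrink_tendsto(2)[OF cont m _ t] x mono o unfolding s_def[symmetric]
        by (intro cross_ratio_expandingD[OF cr]) auto
    qed simp
  qed simp
qed

lemma strictly_monotonic_on_closure:
  assumes cont: "continuous_on {p..q} h" and sm: "strictly_monotonic_on {p<..<q} h"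
  shows "strictly_monotonic_on {p..q} h"
proof -
  have main: "strict_mono_on {p..q} k" if c: "continuous_on {p..q} k" and s: "strict_mono_on {p<..<q} k" for k :: "real \<Rightarrow> real"
  proof (rule strict_mono_onI)
    have weak: "k x \<le> k y" if xy: "x \<in> {p..q}" "y \<in> {p..q}" "x < y" for x y
    proof -
      define m where "m = (x + y) / 2"
      have m: "m \<in> {p<..<q}" using xy by (auto simp: m_def)
      show ?thesis
      proof (rule tendsto_le[OF _ shrink_tendsto(1)[OF c m xy(2)] shrink_tendsto(1)[OF c m xy(1)]])
        show "\<forall>\<^sub>F t in at_right 0. k (x + t * (m - x)) \<le> k (y + t * (m - y))"
          using eventually_at_right_real[of 0 "1::real"]
        proof (rule eventually_mono)
          fix t :: real assume t: "t \<in> {0<..<1}"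
          have "(1 - t) * x < (1 - t) * y" using t xy by simp
          then have "x + t * (m - x) < y + t * (m - y)" by (simp add: algebra_simps)
          then show "k (x + t * (m - x)) \<le> k (y + t * (m - y))"
            using s shrink_tendsto(2)[OF c m xy(1) t] shrink_tendsto(2)[OF c m xy(2) t]
            by (simp add: strict_mono_on_def less_imp_le)
        qed simp
      qed simp
    qed
    fix x y assume xy: "x \<in> {p..q}" "y \<in> {p..q}" "x < y"
    \<comment> \<open>The limit gives only weak inequalities; strictness comes from two interior
      points in between.\<close>
    define u v where "u = x + (y - x) / 3" and "v = x + 2 * (y - x) / 3"
    have "x < u" "u < v" "v < y" using xy by (auto simp: u_def v_def field_simps)
    then have "k x \<le> k u" "k u < k v" "k v \<le> k y"
      using weak[of x u] weak[of v y] s xy by (auto simp: strict_mono_on_def)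
    then show "k x < k y" by linarith
  qed
  from sm show ?thesis
    unfolding strictly_monotonic_on_def
  proof
    assume "strict_mono_on {p<..<q} h"
    then show "strict_mono_on {p..q} h \<or> strict_antimono_on {p..q} h" using main[OF cont] by blast
  next
    assume "strict_antimono_on {p<..<q} h"
    then have "strict_mono_on {p<..<q} (\<lambda>x. - h x)" by (auto simp: monotone_on_def)
    then have "strict_mono_on {p..q} (\<lambda>x. - h x)"
      using cont by (intro main continuous_intros) auto
    then show "strict_mono_on {p..q} h \<or> strict_antimono_on {p..q} h" by (auto simp: monotone_on_def)
  qed
qed

text \<open>The cross ratio of \<open>e, x1, x2, e'\<close> controls the distortion on the half of the branch
  whose image is close to \<open>h e\<close>; everything is symmetric under reflecting domain and range.\<close>

lemma half_branch_distortion: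
  fixes h :: "real \<Rightarrow> real"
  assumes sm: "strictly_monotonic_on (closed_segment e e') h"
    and cr: "cross_ratio_expanding (closed_segment e e') h"
    and x: "x1 \<in> open_segment e x2" "x2 \<in> open_segment e e'"
    and near: "\<bar>h x2 - h e\<bar> \<le> \<kappa> * \<bar>h e' - h x2\<bar>"
  shows "\<bar>x2 - x1\<bar> * \<bar>h x1 - h e\<bar> \<le> (1 + \<kappa>) * \<bar>h x2 - h x1\<bar> * \<bar>x1 - e\<bar>"
proof -
  have main: "(x2 - x1) * (h x1 - h e) \<le> (1 + \<kappa>) * (h x2 - h x1) * (x1 - e)"
    if "strict_mono_on {e..e'} h" "cross_ratio_expanding {e..e'} h"
      "e < x1" "x1 < x2" "x2 < e'" "h x2 - h e \<le> \<kappa> * (h e' - h x2)" for e x1 x2 e' and h :: "real \<Rightarrow> real"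
  proof -
    have lt: "h e < h x1" "h x1 < h x2" "h x2 < h e'"
      using that by (auto simp: strict_mono_on_def)
    have "((h x1 - h e) * (x2 - x1)) * ((h e' - h x2) * (e' - e))
        = (h x1 - h e) * (h e' - h x2) * ((e' - e) * (x2 - x1))" by (simp only: mult_ac)
    also have "\<dots> \<le> (h e' - h e) * (h x2 - h x1) * ((x1 - e) * (e' - x2))"
      using that by (intro cross_ratio_expandingD[OF that(2)]) auto
    also have "\<dots> \<le> ((1 + \<kappa>) * (h e' - h x2)) * (h x2 - h x1) * ((x1 - e) * (e' - e))"
    proof -
      \<comment> \<open>These are the only losses: the whole image is at most 1 + \<kappa> times its
        part beyond x2, and e' - x2 is enlarged to e' - e, which then cancels.\<close>
      have a1: "h e' - h e \<le> (1 + \<kappa>) * (h e' - h x2)" using that by (simp add: algebra_simps)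
      have a2: "e' - x2 \<le> e' - e" using that by simp
      have a3: "0 \<le> (1 + \<kappa>) * (h e' - h x2) * (h x2 - h x1)" using a1 lt by (intro mult_nonneg_nonneg[of "(1 + \<kappa>) * (h e' - h x2)"]) linarith+
      show ?thesis
        using that lt a3 by (intro mult_mono[OF mult_right_mono[OF a1] mult_left_mono[OF a2]]) auto
    qed
    also have "\<dots> = ((1 + \<kappa>) * (h x2 - h x1) * (x1 - e)) * ((h e' - h x2) * (e' - e))"
      by (simp only: mult_ac)
    finally show ?thesis using lt that by (simp add: mult_le_cancel_right mult_ac)
  qed
  have le: "\<bar>x2 - x1\<bar> * \<bar>h x1 - h e\<bar> \<le> (1 + \<kappa>) * \<bar>h x2 - h x1\<bar> * \<bar>x1 - e\<bar>"
    if sm: "strictly_monotonic_on {e..e'} h" and cr: "cross_ratio_expanding {e..e'} h"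
      and o: "e < x1" "x1 < x2" "x2 < e'" and near: "\<bar>h x2 - h e\<bar> \<le> \<kappa> * \<bar>h e' - h x2\<bar>"
    for e x1 x2 e' and h :: "real \<Rightarrow> real"
    using sm unfolding strictly_monotonic_on_def
  proof
    assume s: "strict_mono_on {e..e'} h"
    then have "h e < h x1" "h x1 < h x2" "h x2 < h e'" using o by (auto simp: strict_mono_on_def)
    then show ?thesis using main[OF s cr o] near o by simp
  next
    assume s: "strict_antimono_on {e..e'} h"
    then have "h e > h x1" "h x1 > h x2" "h x2 > h e'" using o by (auto simp: monotone_on_def)
    moreover have "strict_mono_on {e..e'} (\<lambda>x. - h x)" using s by (auto simp: monotone_on_def)
    ultimately show ?thesis
      using main[of e e' "\<lambda>x. - h x"] cr near o by (simp add: cross_ratio_expanding_uminus)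
  qed
  have "e \<noteq> e'" using x by auto
  show ?thesis
  proof (cases "e < e'")
    case True
    then show ?thesis
      using le[of e e' h x1 x2] assms by (auto simp: closed_segment_eq_real_ivl open_segment_eq_real_ivl split: if_splits)
  next
    case False
    then have "e' < e" using \<open>e \<noteq> e'\<close> by simp
    have eq: "uminus ` {e'..e} = {-e..-e'}" by auto
    have "strictly_monotonic_on {e'..e} h" "cross_ratio_expanding {e'..e} h"
      using assms \<open>e' < e\<close> by (simp_all add: closed_segment_eq_real_ivl)
    then have "strictly_monotonic_on {-e..-e'} (\<lambda>x. h (- x))" "cross_ratio_expanding {-e..-e'} (\<lambda>x. h (- x))"
      using cross_ratio_expanding_reflect[of "{e'..e}" h] unfolding eq
      by (auto simp: strictly_monotonic_on_def monotone_on_def)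
    moreover have "- e < - x1" "- x1 < - x2" "- x2 < - e'"
      using x \<open>e' < e\<close> by (auto simp: open_segment_eq_real_ivl split: if_splits)
    ultimately show ?thesis
      using le[of "-e" "-e'" "\<lambda>x. h (- x)" "-x1" "-x2"] near by simp
  qed
qed

lemma strictly_monotonic_between:
  fixes h :: "real \<Rightarrow> real"
  assumes sm: "strictly_monotonic_on (closed_segment e e') h"
    and x: "x1 \<in> open_segment e x2" "x2 \<in> closed_segment e e'"
  shows "\<bar>h x1 - h e\<bar> < \<bar>h x2 - h e\<bar>" "\<bar>h x2 - h e\<bar> = \<bar>h x1 - h e\<bar> + \<bar>h x2 - h x1\<bar>"
    "\<bar>h e' - h x2\<bar> < \<bar>h e' - h x1\<bar>"
proof -
  let ?S = "closed_segment e e'"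
  have S: "e \<in> ?S" "x1 \<in> ?S" "x2 \<in> ?S" "e' \<in> ?S"
    using x by (auto simp: closed_segment_eq_real_ivl open_segment_eq_real_ivl split: if_splits)
  have o: "(e < x1 \<and> x1 < x2 \<and> x2 \<le> e') \<or> (e > x1 \<and> x1 > x2 \<and> x2 \<ge> e')"
    using x by (auto simp: closed_segment_eq_real_ivl open_segment_eq_real_ivl split: if_splits)
  have "(h e < h x1 \<and> h x1 < h x2 \<and> h x2 \<le> h e') \<or> (h e > h x1 \<and> h x1 > h x2 \<and> h x2 \<ge> h e')"
    using sm unfolding strictly_monotonic_on_def
  proof
    assume s: "strict_mono_on ?S h"
    have lt: "h a < h b" if "a \<in> ?S" "b \<in> ?S" "a < b" for a b
      using s that by (auto simp: monotone_on_def)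
    have le: "h a \<le> h b" if "a \<in> ?S" "b \<in> ?S" "a \<le> b" for a b
      using lt[of a b] that by (cases "a = b") auto
    show ?thesis using o S by (elim disjE) (simp_all add: lt le)
  next
    assume s: "strict_antimono_on ?S h"
    have lt: "h a > h b" if "a \<in> ?S" "b \<in> ?S" "a < b" for a b
      using s that by (auto simp: monotone_on_def)
    have le: "h a \<ge> h b" if "a \<in> ?S" "b \<in> ?S" "a \<le> b" for a b
      using lt[of a b] that by (cases "a = b") auto
    show ?thesis using o S by (elim disjE) (simp_all add: lt le)
  qed
  then show "\<bar>h x1 - h e\<bar> < \<bar>h x2 - h e\<bar>" "\<bar>h x2 - h e\<bar> = \<bar>h x1 - h e\<bar> + \<bar>h x2 - h x1\<bar>"
    "\<bar>h e' - h x2\<bar> < \<bar>h e' - h x1\<bar>" by auto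
qed

text \<open>Let the inner point tend to the endpoint in the half branch inequality: its difference
  quotient becomes \<Lambda>. Up to the factor 1 + \<kappa> the image is not shorter than its linear
  prediction.\<close>

lemma distance_le_of_derivative:
  fixes h :: "real \<Rightarrow> real"
  assumes sm: "strictly_monotonic_on (closed_segment w t') h"
    and cr: "cross_ratio_expanding (closed_segment w t') h"
    and der: "(h has_real_derivative \<Lambda>) (at w within closed_segment w t')"
    and t: "t \<in> open_segment w t'" and near: "\<bar>h t - h w\<bar> \<le> \<kappa> * \<bar>h t' - h t\<bar>"
  shows "\<bar>t - w\<bar> * \<bar>\<Lambda>\<bar> \<le> (1 + \<kappa>) * \<bar>h t - h w\<bar>"
proof -
  let ?F = "at w within open_segment w t"
  have "w \<noteq> t" using t by (auto simp: open_segment_def)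
  moreover have "open_segment w t - {w} = open_segment w t" by (auto simp: open_segment_def)
  ultimately have F: "?F \<noteq> bot"
    by (simp add: trivial_limit_within islimpt_in_closure closure_open_segment)
  have sub: "open_segment w t \<subseteq> closed_segment w t'"
    using t by (auto simp: closed_segment_eq_real_ivl open_segment_eq_real_ivl split: if_splits)
  have der': "(h has_real_derivative \<Lambda>) ?F" using der sub by (rule DERIV_subset)
  then have q: "((\<lambda>x. (h x - h w) / (x - w)) \<longlongrightarrow> \<Lambda>) ?F" by (simp add: has_field_derivative_iff)
  have h: "(h \<longlongrightarrow> h w) ?F" using DERIV_continuous[OF der'] by (simp add: continuous_within)
  show ?thesis
  proof (rule tendsto_le[OF F])
    show "((\<lambda>x. (1 + \<kappa>) * \<bar>h t - h x\<bar>) \<longlongrightarrow> (1 + \<kappa>) * \<bar>h t - h w\<bar>) ?F"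
      by (intro tendsto_intros h)
    show "((\<lambda>x. \<bar>t - x\<bar> * \<bar>(h x - h w) / (x - w)\<bar>) \<longlongrightarrow> \<bar>t - w\<bar> * \<bar>\<Lambda>\<bar>) ?F"
      by (intro tendsto_intros q)
    have "\<forall>\<^sub>F x in ?F. x \<in> open_segment w t" by (simp add: eventually_at_filter)
    then show "\<forall>\<^sub>F x in ?F. \<bar>t - x\<bar> * \<bar>(h x - h w) / (x - w)\<bar> \<le> (1 + \<kappa>) * \<bar>h t - h x\<bar>"
    proof (rule eventually_mono)
      fix x assume x: "x \<in> open_segment w t"
      then have "x \<noteq> w" by (auto simp: open_segment_def)
      then show "\<bar>t - x\<bar> * \<bar>(h x - h w) / (x - w)\<bar> \<le> (1 + \<kappa>) * \<bar>h t - h x\<bar>"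
        using half_branch_distortion[OF sm cr x t near] by (simp add: abs_divide field_simps)
    qed
  qed
qed

section \<open>Near and far parts of a half branch\<close>

definition near_part :: "(real \<Rightarrow> real) \<Rightarrow> real \<Rightarrow> real \<Rightarrow> real \<Rightarrow> real set" where
  "near_part h e e' \<epsilon> = {x \<in> open_segment e e'. \<bar>h x - h e\<bar> \<le> \<bar>h e' - h x\<bar> \<and> \<bar>h x - h e\<bar> < \<epsilon>}"

lemma near_part_borel:
  assumes "continuous_on (closed_segment e e') h"
  shows "near_part h e e' \<epsilon> \<in> sets borel"
proof -
  have "continuous_on (open_segment e e') h"
    using assms segment_open_subset_closed continuous_on_subset by blast
  then have "{x \<in> open_segment e e'. h x \<in> {y. \<bar>y - h e\<bar> \<le> \<bar>h e' - y\<bar> \<and> \<bar>y - h e\<bar> < \<epsilon>}} \<in> sets borel"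
    by (rule continuous_on_vimage_borel) (auto simp: open_segment_eq_real_ivl)
  then show ?thesis by (simp add: near_part_def)
qed

text \<open>Let \<open>z\<close> be the point whose image has distance \<epsilon> from
  \<open>h e\<close>. Two uses of half branch distortion, each with \<kappa> = 1, compare the slope
  between x1 and x2 with the mean slope over [e, x1], and the latter with the mean slope over
  [e, z]. So the inverse is Lipschitz on the far part with constant 4 |z - e| / \<epsilon>. The
  segment from e to z lies in the near part, whose measure therefore bounds |z - e|.\<close>

lemma measure_far_part_le:
  fixes h :: "real \<Rightarrow> real"
  assumes cont: "continuous_on (closed_segment e e') h"
    and sm: "strictly_monotonic_on (closed_segment e e') h"
    and cr: "cross_ratio_expanding (closed_segment e e') h"
    and \<epsilon>: "0 < \<epsilon>" and A: "A \<in> sets borel" "A \<subseteq> {a..b}"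
  shows "measure lborel {x \<in> open_segment e e'. \<bar>h x - h e\<bar> \<le> \<bar>h e' - h x\<bar> \<and> \<epsilon> \<le> \<bar>h x - h e\<bar> \<and> h x \<in> A}
    \<le> 4 * measure lborel A / \<epsilon> * measure lborel (near_part h e e' \<epsilon>)"
proof -
  let ?U = "open_segment e e'"
  define S where "S = {x \<in> ?U. \<bar>h x - h e\<bar> \<le> \<bar>h e' - h x\<bar> \<and> \<epsilon> \<le> \<bar>h x - h e\<bar>}"
  have contU: "continuous_on ?U h"
    using cont segment_open_subset_closed continuous_on_subset by blast
  have Smeas: "{x \<in> S. h x \<in> B} \<in> sets borel" if B: "B \<in> sets borel" for B
  proof -
    have "{x \<in> ?U. h x \<in> B \<inter> {y. \<bar>y - h e\<bar> \<le> \<bar>h e' - y\<bar> \<and> \<epsilon> \<le> \<bar>y - h e\<bar>}} \<in> sets borel"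
      using contU B by (intro continuous_on_vimage_borel) (auto simp: open_segment_eq_real_ivl)
    moreover have "{x \<in> ?U. h x \<in> B \<inter> {y. \<bar>y - h e\<bar> \<le> \<bar>h e' - y\<bar> \<and> \<epsilon> \<le> \<bar>y - h e\<bar>}} = {x \<in> S. h x \<in> B}"
      by (auto simp: S_def)
    ultimately show ?thesis by simp
  qed
  have eq: "{x \<in> ?U. \<bar>h x - h e\<bar> \<le> \<bar>h e' - h x\<bar> \<and> \<epsilon> \<le> \<bar>h x - h e\<bar> \<and> h x \<in> A} = {x \<in> S. h x \<in> A}"
    by (auto simp: S_def)
  show ?thesis
  proof (cases "S = {}")
    case True
    then show ?thesis unfolding eq using \<epsilon> by simp
  next
    case False
    then obtain x0 where x0: "x0 \<in> S" by blast
    have in_seg: "u \<in> open_segment e e'" if "u \<in> open_segment e x" "x \<in> ?U" for u x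
      using that by (auto simp: open_segment_eq_real_ivl split: if_splits)
    have x0U: "x0 \<in> ?U" "\<epsilon> \<le> \<bar>h x0 - h e\<bar>" using x0 by (auto simp: S_def)
    have seg0: "closed_segment e x0 \<subseteq> closed_segment e e'"
      using x0U by (auto simp: closed_segment_eq_real_ivl open_segment_eq_real_ivl split: if_splits)
    have "connected ((\<lambda>x. \<bar>h x - h e\<bar>) ` closed_segment e x0)"
      using cont seg0 by (intro connected_continuous_image continuous_intros connected_segment) (auto intro: continuous_on_subset)
    then have "is_interval ((\<lambda>x. \<bar>h x - h e\<bar>) ` closed_segment e x0)"
      by (simp add: is_interval_connected_1)
    moreover have "0 \<in> (\<lambda>x. \<bar>h x - h e\<bar>) ` closed_segment e x0"
      by (rule image_eqI[of _ _ e]) auto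
    moreover have "\<bar>h x0 - h e\<bar> \<in> (\<lambda>x. \<bar>h x - h e\<bar>) ` closed_segment e x0" by auto
    ultimately have "\<epsilon> \<in> (\<lambda>x. \<bar>h x - h e\<bar>) ` closed_segment e x0"
      using \<epsilon> x0U(2) by (meson mem_is_interval_1_I less_imp_le)
    then obtain z where z: "z \<in> closed_segment e x0" "\<bar>h z - h e\<bar> = \<epsilon>" by auto
    have "z \<noteq> e" using z \<epsilon> by auto
    then have zU: "z \<in> ?U"
      using z(1) x0U(1) by (auto simp: closed_segment_eq_real_ivl open_segment_eq_real_ivl split: if_splits)
    have z_or: "z = x \<or> z \<in> open_segment e x" if "x \<in> S" for x
    proof (rule ccontr)
      assume "\<not> ?thesis"
      moreover have "x \<in> ?U" using that by (simp add: S_def)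
      ultimately have "x \<in> open_segment e z"
        using zU by (auto simp: open_segment_eq_real_ivl split: if_splits)
      then have "\<bar>h x - h e\<bar> < \<epsilon>"
        using strictly_monotonic_between(1)[OF sm _ segment_open_subset_closed[THEN subsetD, OF zU]] z(2) by auto
      then show False using that by (simp add: S_def)
    qed
    have "open_segment e z \<subseteq> near_part h e e' \<epsilon>"
    proof
      fix u assume u: "u \<in> open_segment e z"
      have uU: "u \<in> ?U" using in_seg[OF u zU] .
      have lt: "\<bar>h u - h e\<bar> < \<epsilon>"
        using strictly_monotonic_between(1)[OF sm u] zU z(2) by (simp add: open_segment_def)
      have "u \<in> open_segment e x0"
        using u z_or[OF x0] by (auto simp: open_segment_eq_real_ivl split: if_splits)
      from strictly_monotonic_between(1,3)[OF sm this] x0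
      have "\<bar>h u - h e\<bar> \<le> \<bar>h e' - h u\<bar>" by (auto simp: S_def open_segment_def)
      then show "u \<in> near_part h e e' \<epsilon>" using uU lt by (simp add: near_part_def)
    qed
    moreover have "near_part h e e' \<epsilon> \<in> lmeasurable"
      using near_part_borel[OF cont] by (intro bounded_set_imp_lmeasurable bounded_subset[OF bounded_open_segment[of e e']])
        (auto simp: near_part_def)
    ultimately have "measure lebesgue (open_segment e z) \<le> measure lebesgue (near_part h e e' \<epsilon>)"
      by (intro measure_mono_fmeasurable) (auto simp: open_segment_eq_real_ivl)
    then have ze: "\<bar>z - e\<bar> \<le> measure lborel (near_part h e e' \<epsilon>)"
      using near_part_borel[OF cont] by (auto simp: open_segment_eq_real_ivl measure_completion split: if_splits)
    define M where "M = 4 * \<bar>z - e\<bar> / \<epsilon>"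
    have lip0: "\<bar>x1 - x2\<bar> \<le> M * \<bar>h x1 - h x2\<bar>"
      if x: "x1 \<in> S" "x2 \<in> S" "x1 \<in> open_segment e x2" for x1 x2
    proof -
      have nr: "\<bar>h x1 - h e\<bar> \<le> 1 * \<bar>h e' - h x1\<bar>" "\<bar>h x2 - h e\<bar> \<le> 1 * \<bar>h e' - h x2\<bar>"
        and U: "x1 \<in> ?U" "x2 \<in> ?U" and ge: "\<epsilon> \<le> \<bar>h x1 - h e\<bar>" using x by (auto simp: S_def)
      have 1: "\<bar>x2 - x1\<bar> * \<bar>h x1 - h e\<bar> \<le> 2 * \<bar>h x2 - h x1\<bar> * \<bar>x1 - e\<bar>"
        using half_branch_distortion[OF sm cr x(3) U(2) nr(2)] by simp
      have 2: "\<bar>x1 - e\<bar> * \<epsilon> \<le> 2 * \<bar>h x1 - h e\<bar> * \<bar>z - e\<bar>"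
        using z_or[OF x(1)]
      proof
        assume "z = x1"
        then show ?thesis using z(2) \<epsilon> by (simp add: mult_ac)
      next
        assume zx: "z \<in> open_segment e x1"
        have "\<bar>x1 - z\<bar> * \<epsilon> \<le> 2 * \<bar>h x1 - h z\<bar> * \<bar>z - e\<bar>"
          using half_branch_distortion[OF sm cr zx U(1) nr(1)] z(2) by simp
        moreover have "\<bar>x1 - e\<bar> = \<bar>x1 - z\<bar> + \<bar>z - e\<bar>"
          using zx by (auto simp: open_segment_eq_real_ivl split: if_splits)
        moreover have "\<bar>h x1 - h e\<bar> = \<epsilon> + \<bar>h x1 - h z\<bar>"
          using strictly_monotonic_between(2)[OF sm zx] U(1) z(2) by (simp add: open_segment_def)
        moreover have "0 \<le> \<epsilon> * \<bar>z - e\<bar>" using \<epsilon> by simp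
        ultimately show ?thesis by (simp add: algebra_simps)
      qed
      have "(\<bar>x2 - x1\<bar> * \<epsilon>) * \<bar>h x1 - h e\<bar> = (\<bar>x2 - x1\<bar> * \<bar>h x1 - h e\<bar>) * \<epsilon>" by (simp add: mult_ac)
      also have "\<dots> \<le> (2 * \<bar>h x2 - h x1\<bar> * \<bar>x1 - e\<bar>) * \<epsilon>"
        using 1 \<epsilon> by (intro mult_right_mono) auto
      also have "\<dots> = 2 * \<bar>h x2 - h x1\<bar> * (\<bar>x1 - e\<bar> * \<epsilon>)" by (simp add: mult_ac)
      also have "\<dots> \<le> 2 * \<bar>h x2 - h x1\<bar> * (2 * \<bar>h x1 - h e\<bar> * \<bar>z - e\<bar>)"
        using 2 by (intro mult_left_mono) auto
      also have "\<dots> = (4 * \<bar>z - e\<bar> * \<bar>h x2 - h x1\<bar>) * \<bar>h x1 - h e\<bar>" by (simp add: mult_ac)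
      finally have "\<bar>x2 - x1\<bar> * \<epsilon> \<le> 4 * \<bar>z - e\<bar> * \<bar>h x2 - h x1\<bar>"
        using ge \<epsilon> by (simp add: mult_le_cancel_right)
      then show ?thesis using \<epsilon> by (simp add: M_def field_simps abs_minus_commute)
    qed
    have "emeasure lborel {x \<in> S. h x \<in> A} \<le> ennreal (M * measure lborel A)"
    proof (rule emeasure_vimage_le_of_inverse_Lipschitz[OF Smeas _ _ A])
      show "0 \<le> M" using \<epsilon> by (simp add: M_def)
      fix x y assume xy: "x \<in> S" "y \<in> S"
      then have "x = y \<or> x \<in> open_segment e y \<or> y \<in> open_segment e x"
        by (auto simp: S_def open_segment_eq_real_ivl split: if_splits)
      then show "\<bar>x - y\<bar> \<le> M * \<bar>h x - h y\<bar>"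
        using lip0[OF xy] lip0[OF xy(2,1)] by (auto simp: abs_minus_commute)
    qed
    then have "measure lborel {x \<in> S. h x \<in> A} \<le> M * measure lborel A"
      using \<epsilon> by (simp add: measure_def enn2real_leI M_def)
    also have "\<dots> \<le> (4 * measure lborel (near_part h e e' \<epsilon>) / \<epsilon>) * measure lborel A"
      unfolding M_def using ze \<epsilon> by (intro mult_right_mono divide_right_mono) auto
    finally show ?thesis unfolding eq by (simp add: mult_ac)
  qed
qed

section \<open>From weak to strong integrability\<close>

text \<open>With q = L / (L - 1), the weak bound shows that the level set at t has measure at most
  (K / t)^q. Summation over dyadic levels gives a geometric series with ratio 2^(p - q).\<close>

lemma integrable_powr_of_weak_bound:
  fixes h :: "'a \<Rightarrow> real"
  assumes fin: "finite_measure M" and h: "h \<in> borel_measurable M" "\<And>x. 0 \<le> h x"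
    and L: "1 < L" and K: "0 < K"
    and weak: "\<And>t. 0 < t \<Longrightarrow> t * measure M {x\<in>space M. t \<le> h x} \<le> K * measure M {x\<in>space M. t \<le> h x} powr (1 / L)"
    and p: "1 \<le> p" "p < L / (L - 1)"
  shows "integrable M (\<lambda>x. \<bar>h x\<bar> powr p)"
proof -
  interpret finite_measure M by fact
  define q where "q = L / (L - 1)"
  define A where "A t = {x\<in>space M. t \<le> h x}" for t
  have A: "A t \<in> sets M" for t unfolding A_def using h(1) by measurable
  have bound: "measure M (A t) \<le> (K / t) powr q" if t: "0 < t" for t
  proof (cases "measure M (A t) = 0")
    case False
    define m where "m = measure M (A t)"
    have m: "0 < m" using False by (simp add: m_def zero_less_measure_iff)
    have "m = m powr (1 / L) * m powr (1 - 1 / L)" using m by (simp flip: powr_add)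
    then have "t * (m powr (1 / L) * m powr (1 - 1 / L)) \<le> K * m powr (1 / L)"
      using weak[OF t] by (simp add: m_def A_def)
    then have "m powr (1 / L) * (t * m powr (1 - 1 / L)) \<le> m powr (1 / L) * K" by (simp add: mult_ac)
    then have "m powr (1 - 1 / L) \<le> K / t" using m t by (simp add: field_simps)
    then have "(m powr (1 - 1 / L)) powr q \<le> (K / t) powr q" using L by (intro powr_mono2) (auto simp: q_def)
    moreover have "(1 - 1 / L) * q = 1" using L by (simp add: q_def field_simps)
    ultimately show ?thesis using m by (simp add: powr_powr m_def)
  qed simp
  define F where "F i x = ennreal (2 powr (real (Suc i) * p)) * indicator (A (2 ^ i)) x" for i x
  \<comment> \<open>If 2^i \<le> h x < 2^(i + 1), the single term \<open>F i x\<close> suffices: it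
    takes the level set at the lower end and the value at the upper end.\<close>
  have pt: "ennreal (h x powr p) \<le> 1 + (\<Sum>i. F i x)" if x: "x \<in> space M" for x
  proof (cases "h x < 1")
    case True
    then have "h x powr p \<le> 1 powr p" using h(2) p by (intro powr_mono2) auto
    then have "ennreal (h x powr p) \<le> 1" by simp
    then show ?thesis by (rule order_trans) simp
  next
    case False
    obtain n0 where "h x < 2 ^ n0" using real_arch_pow[of 2 "h x"] by auto
    define n where "n = (LEAST n. h x < 2 ^ n)"
    have n: "h x < 2 ^ n" unfolding n_def by (rule LeastI) fact
    have "n \<noteq> 0" using n False by (metis power_0)
    then obtain i where i: "n = Suc i" by (cases n) auto
    then have "\<not> h x < 2 ^ i" using not_less_Least[of i "\<lambda>n. h x < 2 ^ n"] by (simp add: n_def)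
    then have xA: "x \<in> A (2 ^ i)" using x by (simp add: A_def)
    have "h x powr p \<le> (2 ^ Suc i) powr p" using n i h(2) p by (intro powr_mono2) auto
    also have "\<dots> = 2 powr (real (Suc i) * p)"
      by (simp only: powr_realpow[symmetric] powr_powr)
    finally have "ennreal (h x powr p) \<le> F i x" using xA by (simp add: F_def ennreal_leI)
    also have "F i x \<le> (\<Sum>i. F i x)"
      using sum_le_suminf[of "\<lambda>i. F i x" "{i}"] by simp
    also have "\<dots> \<le> 1 + (\<Sum>i. F i x)" by simp
    finally show ?thesis .
  qed
  have Fm: "F i \<in> borel_measurable M" for i unfolding F_def using A by measurable
  define \<rho> where "\<rho> = 2 powr (p - q)"
  have \<rho>: "0 \<le> \<rho>" "\<rho> < 1" using p by (auto simp: \<rho>_def q_def powr_less_one)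
  have "(\<integral>\<^sup>+ x. ennreal (h x powr p) \<partial>M) \<le> (\<integral>\<^sup>+ x. 1 + (\<Sum>i. F i x) \<partial>M)"
    using pt by (rule nn_integral_mono)
  also have "\<dots> = emeasure M (space M) + (\<Sum>i. \<integral>\<^sup>+ x. F i x \<partial>M)"
    using Fm by (subst nn_integral_add) (auto simp: nn_integral_suminf)
  also have "\<dots> \<le> emeasure M (space M) + (\<Sum>i. ennreal (2 powr p * K powr q * \<rho> ^ i))"
  proof (intro add_left_mono suminf_le summableI)
    fix i
    have "(\<integral>\<^sup>+ x. F i x \<partial>M) = ennreal (2 powr (real (Suc i) * p)) * emeasure M (A (2 ^ i))"
      unfolding F_def using A by (intro nn_integral_cmult_indicator) auto
    also have "\<dots> = ennreal (2 powr (real (Suc i) * p) * measure M (A (2 ^ i)))"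
      by (simp add: emeasure_eq_measure ennreal_mult)
    also have "\<dots> \<le> ennreal (2 powr (real (Suc i) * p) * (K / 2 ^ i) powr q)"
      by (intro ennreal_leI mult_left_mono bound) auto
    also have "2 powr (real (Suc i) * p) * (K / 2 ^ i) powr q = 2 powr p * K powr q * \<rho> ^ i"
    proof -
      have "(K / 2 ^ i) powr q = K powr q / (2 powr (real i * q))"
        by (simp add: powr_divide powr_powr flip: powr_realpow)
      moreover have "2 powr (real (Suc i) * p) = 2 powr p * 2 powr (real i * p)"
        by (simp add: distrib_right powr_add)
      moreover have "\<rho> ^ i = 2 powr (real i * p) / 2 powr (real i * q)"
        by (simp add: \<rho>_def powr_power powr_diff[symmetric] algebra_simps)
      ultimately show ?thesis by simp
    qed
    finally show "(\<integral>\<^sup>+ x. F i x \<partial>M) \<le> ennreal (2 powr p * K powr q * \<rho> ^ i)" .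
  qed
  also have "\<dots> < \<infinity>"
  proof -
    have "summable (\<lambda>i. 2 powr p * K powr q * \<rho> ^ i)"
      using \<rho> by (intro summable_mult summable_geometric) auto
    then have "(\<Sum>i. ennreal (2 powr p * K powr q * \<rho> ^ i)) = ennreal (\<Sum>i. 2 powr p * K powr q * \<rho> ^ i)"
      using \<rho> by (intro suminf_ennreal2) auto
    then show ?thesis by (simp add: emeasure_eq_measure)
  qed
  finally have "(\<integral>\<^sup>+ x. ennreal (norm (\<bar>h x\<bar> powr p)) \<partial>M) < \<infinity>" using h(2) by simp
  moreover have "(\<lambda>x. \<bar>h x\<bar> powr p) \<in> borel_measurable M" using h(1) by measurable
  ultimately show ?thesis by (simp add: integrable_iff_bounded)
qed

section \<open>Maps of class A\<close>

locale class_A =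
  fixes f :: "real \<Rightarrow> real" and C :: "real set" and l :: "real \<Rightarrow> bool \<Rightarrow> real" and D :: "real \<Rightarrow> real"
  assumes classA: "classA f C l D"
begin

lemma f_MM: "x \<in> MM \<Longrightarrow> f x \<in> MM"
  and finite_C: "finite C" and C_nonempty: "C \<noteq> {}" and C_subset: "C \<subseteq> MM"
  using classA unfolding classA_def by auto

lemma iterate_MM: "x \<in> MM \<Longrightarrow> (f ^^ k) x \<in> MM"
  by (induction k) (auto intro: f_MM)

lemma component_props:
  assumes "x \<in> MM - C"
  defines "U \<equiv> connected_component_set (MM - C) x"
  shows "continuous_on U D" "\<And>y. y \<in> U \<Longrightarrow> (f has_real_derivative D y) (at y within U)"
    "\<And>y. y \<in> U \<Longrightarrow> D y \<noteq> 0" "convex_on U (\<lambda>y. \<bar>D y\<bar> powr (-1/2))"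
  using assms(1) classA unfolding classA_def U_def Let_def by blast+

lemma l_ge_1: "c \<in> C \<Longrightarrow> side_ok c s \<Longrightarrow> 1 \<le> l c s"
  using classA unfolding classA_def by blast

lemma local_order:
  assumes "c \<in> C" "side_ok c s"
  obtains d K where "d > 0" "K > 0" "side_nbhd c s d \<subseteq> MM - C"
    "\<And>x. x \<in> side_nbhd c s d \<Longrightarrow> \<bar>D x\<bar> / \<bar>x - c\<bar> powr (l c s - 1) \<le> K"
    "\<And>x. x \<in> side_nbhd c s d \<Longrightarrow> 1 / K \<le> \<bar>f x - fval f c s\<bar> / \<bar>x - c\<bar> powr (l c s)"
proof -
  have "\<exists>d>0. \<exists>K>0. side_nbhd c s d \<subseteq> MM - C \<and>
           (\<forall>x\<in>side_nbhd c s d.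
              1 / K \<le> \<bar>D x\<bar> / \<bar>x - c\<bar> powr (l c s - 1) \<and>
              \<bar>D x\<bar> / \<bar>x - c\<bar> powr (l c s - 1) \<le> K \<and>
              1 / K \<le> \<bar>f x - fval f c s\<bar> / \<bar>x - c\<bar> powr (l c s) \<and>
              \<bar>f x - fval f c s\<bar> / \<bar>x - c\<bar> powr (l c s) \<le> K)"
    using classA assms unfolding classA_def by blast
  then show thesis using that by blast
qed

lemma side_filter_nontrivial: "side_filter c s \<noteq> bot"
  by (simp add: side_filter_def)

lemma tendsto_fval:
  assumes "c \<in> C" "side_ok c s"
  shows "(f \<longlongrightarrow> fval f c s) (side_filter c s)"
proof -
  obtain v where v: "(f \<longlongrightarrow> v) (side_filter c s)"
    using classA assms unfolding classA_def by blast
  then show ?thesis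
    unfolding fval_def using tendsto_Lim[OF side_filter_nontrivial v] by simp
qed

lemma eventually_side_nbhd: "d > 0 \<Longrightarrow> \<forall>\<^sub>F x in side_filter c s. x \<in> side_nbhd c s d"
  using eventually_at_right_real[of c "c + d"] eventually_at_left_real[of "c - d" c]
  by (auto simp: side_filter_def side_nbhd_def)

lemma fval_MM:
  assumes "c \<in> C" "side_ok c s"
  shows "fval f c s \<in> MM"
proof (rule Lim_in_closed_set[OF _ _ side_filter_nontrivial tendsto_fval[OF assms]])
  show "closed MM" by (simp add: MM_def)
  obtain d where d: "d > 0" "side_nbhd c s d \<subseteq> MM - C" using local_order[OF assms] by metis
  show "\<forall>\<^sub>F x in side_filter c s. f x \<in> MM"
    using eventually_side_nbhd[OF d(1)] by (rule eventually_mono) (use d f_MM in auto)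
qed

lemma critical_orbit_not_C: "c \<in> C \<Longrightarrow> side_ok c s \<Longrightarrow> (f ^^ k) (fval f c s) \<notin> C"
  using classA unfolding classA_def by blast

text \<open>An interval avoiding \<open>C\<close> lies in one component. Arbitrary intervals are
  allowed so that this applies to images of intervals under iterates.\<close>

lemma interval_branch:
  assumes I: "is_interval I" "I \<subseteq> MM - C"
  shows "continuous_on I f" "strictly_monotonic_on I f" "cross_ratio_expanding I f"
    "\<And>y. y \<in> I \<Longrightarrow> (f has_real_derivative D y) (at y within I)" "continuous_on I D"
    "\<And>y. y \<in> I \<Longrightarrow> D y \<noteq> 0"
proof -
  have "continuous_on I f \<and> strictly_monotonic_on I f \<and> cross_ratio_expanding I f \<and>
    (\<forall>y\<in>I. (f has_real_derivative D y) (at y within I)) \<and> continuous_on I D \<and> (\<forall>y\<in>I. D y \<noteq> 0)"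
  proof (cases "I = {}")
    case True
    then show ?thesis
      by (simp add: strictly_monotonic_on_def monotone_on_def cross_ratio_expanding_def)
  next
    case False
    then obtain x where x: "x \<in> I" by blast
    let ?U = "connected_component_set (MM - C) x"
    have sub: "I \<subseteq> ?U"
      using x I by (intro connected_component_maximal) (auto simp: is_interval_connected_1)
    have xM: "x \<in> MM - C" using x I by auto
    have 1: "continuous_on I D" using component_props(1)[OF xM] sub continuous_on_subset by blast
    have 2: "(f has_real_derivative D y) (at y within I)" if "y \<in> I" for y
      using component_props(2)[OF xM] sub that by (blast intro: DERIV_subset)
    have 3: "D y \<noteq> 0" if "y \<in> I" for y using component_props(3)[OF xM] sub that by blast
    have 4: "convex_on I (\<lambda>y. \<bar>D y\<bar> powr (-1/2))"
      using component_props(4)[OF xM] sub I(1) by (blast intro: convex_on_subset is_interval_convex)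
    show ?thesis
      using cross_ratio_expanding_of_convex[OF I(1) 2 3 1 4] DERIV_continuous_on[OF 2] 1 2 3 by blast
  qed
  then show "continuous_on I f" "strictly_monotonic_on I f" "cross_ratio_expanding I f"
    "\<And>y. y \<in> I \<Longrightarrow> (f has_real_derivative D y) (at y within I)" "continuous_on I D"
    "\<And>y. y \<in> I \<Longrightarrow> D y \<noteq> 0" by auto
qed

text \<open>The image of \<open>I\<close> under \<open>f ^^ n\<close> is again an interval avoiding
  \<open>C\<close>, so the next step composes with a monotone, cross ratio expanding branch of
  \<open>f\<close>.\<close>

lemma iterate_branch:
  assumes I: "is_interval I" "I \<subseteq> MM" "\<And>k x. k < n \<Longrightarrow> x \<in> I \<Longrightarrow> (f ^^ k) x \<notin> C"
  shows "continuous_on I (f ^^ n) \<and> strictly_monotonic_on I (f ^^ n) \<and> cross_ratio_expanding I (f ^^ n) \<and>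
    (\<forall>x\<in>I. ((f ^^ n) has_real_derivative Dn f D n x) (at x within I) \<and> Dn f D n x \<noteq> 0)"
  using I(3)
proof (induction n)
  case 0
  have "cross_ratio_expanding I (\<lambda>x. x)" by (simp add: cross_ratio_expanding_def mult_ac)
  then show ?case
    by (auto simp: strictly_monotonic_on_def monotone_on_def Dn_def id_def)
next
  case (Suc n)
  have IH: "continuous_on I (f ^^ n)" "strictly_monotonic_on I (f ^^ n)" "cross_ratio_expanding I (f ^^ n)"
    "\<And>x. x \<in> I \<Longrightarrow> ((f ^^ n) has_real_derivative Dn f D n x) (at x within I)"
    "\<And>x. x \<in> I \<Longrightarrow> Dn f D n x \<noteq> 0"
    using Suc by auto
  have J: "is_interval ((f ^^ n) ` I)" "(f ^^ n) ` I \<subseteq> MM - C"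
    using IH(1) I Suc.prems iterate_MM
    by (auto simp: is_interval_connected_1 intro: connected_continuous_image)
  note br = interval_branch[OF J]
  have eq: "f ^^ Suc n = (\<lambda>x. f ((f ^^ n) x))" by auto
  have "continuous_on I (f ^^ Suc n)"
    unfolding eq by (rule continuous_on_compose2[OF br(1) IH(1)]) simp
  moreover have "strictly_monotonic_on I (f ^^ Suc n)"
    unfolding eq by (rule strictly_monotonic_on_compose[OF IH(2) br(2)])
  moreover have "cross_ratio_expanding I (f ^^ Suc n)"
    unfolding eq by (rule cross_ratio_expanding_compose[OF IH(2,3) br(3,2)])
  moreover have "((f ^^ Suc n) has_real_derivative Dn f D (Suc n) x) (at x within I)" "Dn f D (Suc n) x \<noteq> 0"
    if "x \<in> I" for x
    using DERIV_image_chain[OF br(4) IH(4)[OF that]] br(6) IH(5)[OF that] that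
    by (simp_all add: Dn_def mult.commute comp_def)
  ultimately show ?case by blast
qed

section \<open>Continuity and measurability of iterates, finiteness of the cut points\<close>

lemma isolated_from_C:
  assumes "x \<in> MM - C"
  obtains r where "r > 0" "is_interval (MM \<inter> {x - r<..<x + r})" "MM \<inter> {x - r<..<x + r} \<subseteq> MM - C"
proof -
  obtain r where r: "r > 0" "\<And>c. c \<in> C \<Longrightarrow> c \<noteq> x \<Longrightarrow> r \<le> dist x c"
    using finite_set_avoid[OF finite_C, of x] by blast
  have "is_interval (MM \<inter> {x - r<..<x + r})"
    unfolding MM_def by (intro is_interval_Int is_interval_cc is_interval_oo)
  moreover have "MM \<inter> {x - r<..<x + r} \<subseteq> MM - C"
    using r(2) assms by (force simp: dist_real_def)
  ultimately show thesis using that r(1) by blast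
qed

lemma at_within_MM: "r > 0 \<Longrightarrow> at x within MM = at x within (MM \<inter> {x - r<..<x + r})"
  by (rule at_within_nhd[of x "{x - r<..<x + r}"]) auto

lemma continuous_within_MM:
  assumes "x \<in> MM - C"
  shows "continuous (at x within MM) f" "continuous (at x within MM) D"
proof -
  obtain r where r: "r > 0" "is_interval (MM \<inter> {x - r<..<x + r})" "MM \<inter> {x - r<..<x + r} \<subseteq> MM - C"
    using isolated_from_C[OF assms] .
  have "x \<in> MM \<inter> {x - r<..<x + r}" using assms r(1) by auto
  then show "continuous (at x within MM) f" "continuous (at x within MM) D"
    using interval_branch(1,5)[OF r(2,3)]
    by (auto simp: continuous_within at_within_MM[OF r(1)] continuous_on)
qed

lemma continuous_on_MM_minus_C: "continuous_on (MM - C) f" "continuous_on (MM - C) D"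
  using continuous_within_MM by (auto simp: continuous_on_eq_continuous_within intro: continuous_within_subset)

lemma iterate_continuous_within:
  assumes "x \<in> MM" "\<And>i. i < n \<Longrightarrow> (f ^^ i) x \<notin> C"
  shows "continuous (at x within MM) (f ^^ n)"
  using assms(2)
proof (induction n)
  case (Suc n)
  have "continuous (at ((f ^^ n) x) within (f ^^ n) ` MM) f"
    using Suc.prems iterate_MM assms(1)
    by (intro continuous_within_subset[OF continuous_within_MM(1)]) auto
  then show ?case
    using Suc continuous_within_compose[of x MM "f ^^ n" f] by (simp add: comp_def)
qed simp

text \<open>Between two points with the same image \<open>f\<close> is not injective, so a point of
  \<open>C\<close> separates them. Hence a point of the fibre outside \<open>C\<close> is determined
  by the set of points of \<open>C\<close> to its left.\<close>

lemma finite_preimage: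
  assumes "finite F"
  shows "finite {x\<in>MM. f x \<in> F}"
proof -
  have "finite {x\<in>MM - C. f x = y}" for y
  proof -
    let ?X = "{x\<in>MM - C. f x = y}"
    have "inj_on (\<lambda>x. {c\<in>C. c < x}) ?X"
    proof (rule linorder_inj_onI')
      fix i j assume ij: "i \<in> ?X" "j \<in> ?X" "i < j"
      have "\<not> {i..j} \<subseteq> MM - C"
      proof
        assume "{i..j} \<subseteq> MM - C"
        then have "inj_on f {i..j}"
          using interval_branch(2) is_interval_cc strictly_monotonic_on_inj_on by blast
        then show False using ij inj_onD[of f "{i..j}" i j] by auto
      qed
      moreover have "{i..j} \<subseteq> MM" using ij by (auto simp: MM_def)
      ultimately obtain c where "c \<in> C" "i \<le> c" "c \<le> j" by auto
      moreover from this have "c \<noteq> i" "c \<noteq> j" using ij by auto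
      ultimately have "c \<in> {c\<in>C. c < j}" "c \<notin> {c\<in>C. c < i}" by auto
      then show "{c\<in>C. c < i} \<noteq> {c\<in>C. c < j}" by metis
    qed
    moreover have "finite ((\<lambda>x. {c\<in>C. c < x}) ` ?X)"
      by (rule finite_subset[of _ "Pow C"]) (auto simp: finite_C)
    ultimately show ?thesis by (rule finite_imageD[rotated])
  qed
  then have "finite (C \<union> (\<Union>y\<in>F. {x\<in>MM - C. f x = y}))" using finite_C assms by auto
  then show ?thesis by (rule rev_finite_subset) auto
qed

text \<open>The branches of \<open>f ^^ n\<close> are cut at these points.\<close>

lemma finite_hits: "finite {x\<in>MM. \<exists>k<n. (f ^^ k) x \<in> C}"
proof -
  have "finite {x\<in>MM. (f ^^ k) x \<in> F}" if "finite F" for F k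
    using that
  proof (induction k arbitrary: F)
    case (Suc k)
    have "{x\<in>MM. (f ^^ Suc k) x \<in> F} = {x\<in>MM. (f ^^ k) x \<in> {x\<in>MM. f x \<in> F}}"
      using iterate_MM by auto
    then show ?case using Suc.IH[OF finite_preimage[OF Suc.prems]] by (simp only:)
  qed simp
  then have "finite (\<Union>k<n. {x\<in>MM. (f ^^ k) x \<in> C})" using finite_C by auto
  moreover have "{x\<in>MM. \<exists>k<n. (f ^^ k) x \<in> C} = (\<Union>k<n. {x\<in>MM. (f ^^ k) x \<in> C})" by auto
  ultimately show ?thesis by simp
qed

lemma f_measurable: "f \<in> measurable (restrict_space borel MM) (restrict_space borel MM)"
proof (rule measurable_restrict_space2)
  show "f \<in> space (restrict_space borel MM) \<rightarrow> MM" using f_MM by (auto simp: space_restrict_space)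
  show "f \<in> borel_measurable (restrict_space borel MM)"
  proof (rule measurableI)
    fix B :: "real set" assume B: "B \<in> sets borel"
    have "{x \<in> MM - C. f x \<in> B} \<in> sets borel"
      using finite_C by (intro continuous_on_vimage_borel continuous_on_MM_minus_C B)
        (auto simp: MM_def finite_imp_closed)
    moreover have "{x \<in> C. f x \<in> B} \<in> sets borel"
      using finite_C by (intro borel_closed finite_imp_closed) auto
    moreover have "f -` B \<inter> space (restrict_space borel MM) = {x \<in> MM - C. f x \<in> B} \<union> {x \<in> C. f x \<in> B}"
      using C_subset by (auto simp: space_restrict_space)
    moreover have "\<dots> \<subseteq> MM" using C_subset by auto
    ultimately show "f -` B \<inter> space (restrict_space borel MM) \<in> sets (restrict_space borel MM)"
      by (simp add: sets_restrict_space_iff MM_def)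
  qed simp
qed

lemma iterate_vimage_borel:
  assumes "B \<in> sets borel"
  shows "{x\<in>MM. (f ^^ n) x \<in> B} \<in> sets borel"
proof -
  have "f ^^ n \<in> measurable (restrict_space borel MM) (restrict_space borel MM)"
  proof (induction n)
    case (Suc n)
    show ?case using measurable_comp[OF Suc f_measurable] by (simp only: funpow.simps)
  qed (simp add: id_def)
  then have "f ^^ n \<in> borel_measurable (restrict_space borel MM)"
    by (simp add: measurable_restrict_space2_iff)
  from measurable_sets[OF this assms] show ?thesis
    by (simp add: sets_restrict_space_iff space_restrict_space vimage_def Int_def conj_commute MM_def)
qed

text \<open>\<open>f c\<close> may differ from both one-sided limits; replacing it by the limit from
  the side of \<open>z\<close> makes \<open>f\<close> continuous and strictly monotone up to and
  including \<open>c\<close>.\<close>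

lemma one_sided_extension:
  assumes c: "c \<in> C" and z: "z \<in> MM" "z \<noteq> c" "closed_segment c z \<inter> C = {c}"
  defines "g \<equiv> f(c := fval f c (c < z))"
  shows "continuous_on (closed_segment c z) g" "strictly_monotonic_on (closed_segment c z) g"
    "side_ok c (c < z)"
proof -
  have cM: "c \<in> MM" using c C_subset by auto
  show ok: "side_ok c (c < z)" using z cM by (auto simp: side_ok_def MM_def)
  let ?S = "closed_segment c z" and ?w = "fval f c (c < z)"
  have S_MM: "?S \<subseteq> MM" using cM z by (auto simp: MM_def closed_segment_eq_real_ivl split: if_splits)
  have I: "is_interval (?S - {c})"
    using z(2) by (auto simp: closed_segment_eq_real_ivl is_interval_1)
  have I2: "?S - {c} \<subseteq> MM - C" using z(3) S_MM by auto
  note br = interval_branch[OF I I2]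
  have gf: "g x = f x" if "x \<noteq> c" for x using that by (simp add: g_def)
  show cont: "continuous_on ?S g"
    unfolding continuous_on
  proof
    fix x assume x: "x \<in> ?S"
    show "(g \<longlongrightarrow> g x) (at x within ?S)"
    proof (cases "x = c")
      case True
      have "at c within ?S = side_filter c (c < z)"
        using z(2) by (auto simp: closed_segment_eq_real_ivl side_filter_def at_within_Icc_at_right at_within_Icc_at_left)
      moreover have "(g \<longlongrightarrow> ?w) (side_filter c (c < z))"
      proof (rule Lim_transform_eventually[OF tendsto_fval[OF c ok]])
        show "\<forall>\<^sub>F x in side_filter c (c < z). f x = g x"
          by (simp add: side_filter_def eventually_at_filter gf)
      qed
      ultimately show ?thesis using True by (simp add: g_def)
    next
      case False
      then have "(f \<longlongrightarrow> f x) (at x within (?S - {c}))" using br(1) x by (simp add: continuous_on)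
      moreover have "at x within ?S = at x within (?S - {c})"
        using False by (intro at_within_nhd[of x "- {c}"]) auto
      moreover have "\<forall>\<^sub>F y in at x within (?S - {c}). f y = g y"
        by (simp add: eventually_at_filter gf)
      ultimately show ?thesis
        using False gf by (metis Lim_transform_eventually)
    qed
  qed
  have "strictly_monotonic_on (open_segment c z) g"
  proof -
    have "strictly_monotonic_on (open_segment c z) f"
      using br(2) by (rule strictly_monotonic_on_subset) (auto simp: open_segment_def)
    moreover have "g x = f x" if "x \<in> open_segment c z" for x
      using that by (intro gf) (auto simp: open_segment_def)
    ultimately show ?thesis by (simp add: strictly_monotonic_on_def monotone_on_def)
  qed
  then show "strictly_monotonic_on ?S g"
    using strictly_monotonic_on_closure[of "min c z" "max c z" g] cont
    by (auto simp: closed_segment_eq_real_ivl open_segment_eq_real_ivl min_def max_def split: if_splits)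
qed

text \<open>The lower order estimate at \<open>c\<close> solved for the distance, with one constant
  that is valid up to the next point of \<open>C\<close> and not only close to
  \<open>c\<close>.\<close>

definition order_constant :: "real \<Rightarrow> bool" where
  "order_constant K \<longleftrightarrow> K > 0 \<and> (\<forall>c\<in>C. \<forall>z\<in>MM. z \<noteq> c \<longrightarrow> closed_segment c z \<inter> C = {c} \<longrightarrow>
     \<bar>z - c\<bar> \<le> K * \<bar>f z - fval f c (c < z)\<bar> powr (1 / l c (c < z)))"

text \<open>Close to \<open>c\<close> this is the order condition. Farther away monotonicity keeps
  the image at least as far from the critical value as the image of a fixed point \<open>x0\<close>,
  while distances in \<open>MM\<close> are at most 1.\<close>

lemma order_bound: "\<exists>K. order_constant K"
proof -
  have one: "\<exists>K>0. \<forall>z\<in>MM. z \<noteq> c \<longrightarrow> s = (c < z) \<longrightarrow> closed_segment c z \<inter> C = {c} \<longrightarrow>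
     \<bar>z - c\<bar> \<le> K * \<bar>f z - fval f c s\<bar> powr (1 / l c s)" if c: "c \<in> C" for c s
  proof (cases "side_ok c s")
    case False
    then show ?thesis using one_sided_extension(3)[OF c] by (intro exI[of _ 1]) auto
  next
    case ok: True
    define L where "L = l c s"
    have L: "1 \<le> L" using l_ge_1[OF c ok] by (simp add: L_def)
    define w where "w = fval f c s"
    obtain d K where dK: "d > 0" "K > 0" "side_nbhd c s d \<subseteq> MM - C"
      "\<And>x. x \<in> side_nbhd c s d \<Longrightarrow> 1 / K \<le> \<bar>f x - w\<bar> / \<bar>x - c\<bar> powr L"
      using local_order[OF c ok] unfolding L_def w_def by metis
    have near: "\<bar>x - c\<bar> \<le> K powr (1 / L) * \<bar>f x - w\<bar> powr (1 / L)" if "x \<in> side_nbhd c s d" for x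
    proof -
      have "x \<noteq> c" using that by (auto simp: side_nbhd_def split: if_splits)
      then have "\<bar>x - c\<bar> powr L \<le> K * \<bar>f x - w\<bar>" using dK(2) dK(4)[OF that] by (simp add: field_simps)
      then have "(\<bar>x - c\<bar> powr L) powr (1 / L) \<le> (K * \<bar>f x - w\<bar>) powr (1 / L)"
        using L by (intro powr_mono2) auto
      then show ?thesis using L dK(2) \<open>x \<noteq> c\<close> by (simp add: powr_powr powr_mult)
    qed
    define x0 where "x0 = (if s then c + d / 2 else c - d / 2)"
    have x0: "x0 \<in> side_nbhd c s d" "\<bar>x0 - c\<bar> = d / 2" using dK(1) by (auto simp: x0_def side_nbhd_def)
    define m where "m = \<bar>f x0 - w\<bar> powr (1 / L)"
    have m: "m > 0"
    proof -
      have "0 < K powr (1 / L) * m" using near[OF x0(1)] x0(2) dK(1) by (simp add: m_def)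
      then show ?thesis by (simp add: zero_less_mult_iff m_def)
    qed
    show ?thesis
    proof (intro exI[of _ "K powr (1 / L) + 1 / m"] conjI ballI impI)
      show "0 < K powr (1 / L) + 1 / m" using m by (simp add: add_nonneg_pos)
      fix z assume z: "z \<in> MM" "z \<noteq> c" "s = (c < z)" "closed_segment c z \<inter> C = {c}"
      show "\<bar>z - c\<bar> \<le> (K powr (1 / L) + 1 / m) * \<bar>f z - fval f c s\<bar> powr (1 / l c s)"
      proof (cases "z \<in> side_nbhd c s d")
        case True
        have "K powr (1 / L) * \<bar>f z - w\<bar> powr (1 / L) \<le> (K powr (1 / L) + 1 / m) * \<bar>f z - w\<bar> powr (1 / L)"
          using m by (intro mult_right_mono) auto
        then show ?thesis using near[OF True] unfolding w_def L_def by linarith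
      next
        case False
        then have "x0 \<in> open_segment c z"
          using z dK(1) by (auto simp: x0_def side_nbhd_def open_segment_eq_real_ivl split: if_splits)
        then have "\<bar>f x0 - w\<bar> < \<bar>f z - w\<bar>"
          using strictly_monotonic_between(1)[OF one_sided_extension(2)[OF c z(1,2,4)], of x0 z] z(2,3)
          by (auto simp: w_def open_segment_def)
        then have "m \<le> \<bar>f z - w\<bar> powr (1 / L)" unfolding m_def using L by (intro powr_mono2) auto
        then have "1 \<le> 1 / m * \<bar>f z - w\<bar> powr (1 / L)" using m by (simp add: field_simps)
        also have "\<dots> \<le> (K powr (1 / L) + 1 / m) * \<bar>f z - w\<bar> powr (1 / L)"
          by (intro mult_right_mono) auto
        finally have "1 \<le> (K powr (1 / L) + 1 / m) * \<bar>f z - w\<bar> powr (1 / L)" .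
        moreover have "c \<in> MM" using c C_subset by blast
        then have "\<bar>z - c\<bar> \<le> 1" using z(1) by (auto simp: MM_def)
        ultimately show ?thesis unfolding w_def L_def by linarith
      qed
    qed
  qed
  then obtain K where K: "\<And>c s. c \<in> C \<Longrightarrow> K c s > 0"
    "\<And>c s z. c \<in> C \<Longrightarrow> z \<in> MM \<Longrightarrow> z \<noteq> c \<Longrightarrow> s = (c < z) \<Longrightarrow> closed_segment c z \<inter> C = {c} \<Longrightarrow>
     \<bar>z - c\<bar> \<le> K c s * \<bar>f z - fval f c s\<bar> powr (1 / l c s)" by metis
  define T where "T = (\<Sum>(c, s)\<in>C \<times> UNIV. K c s)"
  have T: "K c s \<le> T" if "c \<in> C" for c s
    unfolding T_def using that finite_C less_imp_le[OF K(1)]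
    by (intro member_le_sum[of "(c, s)" _ "\<lambda>(c, s). K c s", simplified]) auto
  obtain c0 where "c0 \<in> C" using C_nonempty by blast
  then have "T > 0" using T K(1) less_le_trans by blast
  show ?thesis
    unfolding order_constant_def
  proof (intro exI[of _ T] conjI ballI impI)
    show "T > 0" by fact
    fix c z assume a: "c \<in> C" "z \<in> MM" "z \<noteq> c" "closed_segment c z \<inter> C = {c}"
    have "\<bar>z - c\<bar> \<le> K c (c < z) * \<bar>f z - fval f c (c < z)\<bar> powr (1 / l c (c < z))"
      using K(2)[OF a(1-3) refl a(4)] .
    also have "\<dots> \<le> T * \<bar>f z - fval f c (c < z)\<bar> powr (1 / l c (c < z))"
      using T[OF a(1)] by (intro mult_right_mono) auto
    finally show "\<bar>z - c\<bar> \<le> T * \<bar>f z - fval f c (c < z)\<bar> powr (1 / l c (c < z))" .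
  qed
qed

section \<open>Endpoints of branches\<close>

text \<open>\<open>branch_end n e e' a E\<close>: near the endpoint \<open>e\<close> of a monotonicity interval of \<open>f\<^sup>n\<close> the map tends
  to \<open>a\<close>, and the points of the half of the branch adjacent to \<open>e\<close> whose image is
  \<open>\<epsilon>\<close>-close to \<open>a\<close> lie in \<open>E \<epsilon>\<close>.\<close>

definition branch_end :: "nat \<Rightarrow> real \<Rightarrow> real \<Rightarrow> real \<Rightarrow> (real \<Rightarrow> real set) \<Rightarrow> bool" where
  "branch_end n e e' a E \<longleftrightarrow>
     ((f ^^ n) \<longlongrightarrow> a) (at e within open_segment e e') \<and>
     (\<forall>x x' \<epsilon>. x' \<in> open_segment e e' \<longrightarrow> x \<in> open_segment e x' \<longrightarrow>
        \<bar>(f ^^ n) x - a\<bar> \<le> 2 * \<bar>(f ^^ n) x' - (f ^^ n) x\<bar> \<longrightarrow> \<bar>(f ^^ n) x - a\<bar> < \<epsilon> \<longrightarrow> x \<in> E \<epsilon>)"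

lemma segment_subset_MM: "e \<in> MM \<Longrightarrow> e' \<in> MM \<Longrightarrow> closed_segment e e' \<subseteq> MM"
  by (auto simp: MM_def closed_segment_eq_real_ivl split: if_splits)

text \<open>The iterate is differentiable up to \<open>e\<close>, so the endpoint form of the
  distortion estimate applies. The factor 2 in \<open>branch_end\<close> is its \<kappa>, hence 3 =
  1 + 2.\<close>

lemma regular_branch_end:
  assumes e: "e \<in> MM" "e' \<in> MM"
    and free: "\<And>k x. k < n \<Longrightarrow> x \<in> open_segment e e' \<Longrightarrow> (f ^^ k) x \<notin> C"
    and reg: "\<And>k. k < n \<Longrightarrow> (f ^^ k) e \<notin> C"
  shows "branch_end n e e' ((f ^^ n) e) (\<lambda>\<epsilon>. {x\<in>MM. \<bar>x - e\<bar> < 3 * \<epsilon> / \<bar>Dn f D n e\<bar>})"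
  unfolding branch_end_def
proof (intro conjI allI impI)
  have sub: "open_segment e e' \<subseteq> MM" using segment_subset_MM[OF e] segment_open_subset_closed by blast
  show "((f ^^ n) \<longlongrightarrow> (f ^^ n) e) (at e within open_segment e e')"
    using iterate_continuous_within[OF e(1) reg] sub
    by (auto simp: continuous_within intro: tendsto_within_subset)
  fix x x' \<epsilon>
  assume x': "x' \<in> open_segment e e'" and x: "x \<in> open_segment e x'"
    and near: "\<bar>(f ^^ n) x - (f ^^ n) e\<bar> \<le> 2 * \<bar>(f ^^ n) x' - (f ^^ n) x\<bar>"
    and less: "\<bar>(f ^^ n) x - (f ^^ n) e\<bar> < \<epsilon>"
  let ?S = "closed_segment e x'"
  have S: "y = e \<or> y \<in> open_segment e e'" if "y \<in> ?S" for y
    using that x' by (auto simp: closed_segment_eq_real_ivl open_segment_eq_real_ivl split: if_splits)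
  have "is_interval ?S" by (simp add: is_interval_convex_1)
  moreover have "?S \<subseteq> MM" using S sub e by blast
  moreover have "(f ^^ k) y \<notin> C" if "k < n" "y \<in> ?S" for k y
    using S[OF that(2)] free[OF that(1)] reg[OF that(1)] by blast
  ultimately have br: "strictly_monotonic_on ?S (f ^^ n)" "cross_ratio_expanding ?S (f ^^ n)"
    "((f ^^ n) has_real_derivative Dn f D n e) (at e within ?S)" "Dn f D n e \<noteq> 0"
    using iterate_branch[of ?S n] by auto
  have "\<bar>x - e\<bar> * \<bar>Dn f D n e\<bar> \<le> 3 * \<bar>(f ^^ n) x - (f ^^ n) e\<bar>"
    using distance_le_of_derivative[OF br(1-3) x near] by simp
  also have "\<dots> < 3 * \<epsilon>" using less by simp
  finally have "\<bar>x - e\<bar> < 3 * \<epsilon> / \<bar>Dn f D n e\<bar>" using br(4) by (simp add: field_simps)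
  moreover have "x \<in> MM" using S[of x] x sub e by (auto simp: open_segment_def)
  ultimately show "x \<in> {x\<in>MM. \<bar>x - e\<bar> < 3 * \<epsilon> / \<bar>Dn f D n e\<bar>}" by blast
qed

text \<open>\<open>k\<close> is the time at which the orbit arrives at \<open>c\<close>; after the
  critical value \<open>n - Suc k\<close> steps are left. The distortion estimate with \<kappa> = 2
  gives the distance 3 \<epsilon> / |Df^(n-k-1)| from the critical value; the power and
  \<open>K\<close> pull it back to \<open>c\<close>.\<close>

definition critical_point_nbhd :: "real \<Rightarrow> nat \<Rightarrow> nat \<Rightarrow> real \<Rightarrow> bool \<Rightarrow> real \<Rightarrow> real set" where
  "critical_point_nbhd K n k c s \<epsilon> =
     {z. \<bar>z - c\<bar> < K * (3 * \<epsilon> / \<bar>Dn f D (n - Suc k) (fval f c s)\<bar>) powr (1 / l c s)}"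

text \<open>Up to time \<open>k\<close> the branch is carried monotonically to one side of
  \<open>c\<close>; \<open>f\<close> takes this side to a segment at the critical value, on which
  the remaining iterate is regular. The distance is estimated there, and the order bound turns it
  into a distance from \<open>c\<close>.\<close>

lemma critical_branch_end:
  assumes e: "e \<in> MM" "e' \<in> MM" "e \<noteq> e'"
    and free: "\<And>k x. k < n \<Longrightarrow> x \<in> open_segment e e' \<Longrightarrow> (f ^^ k) x \<notin> C"
    and k: "k < n" "(f ^^ k) e = c" "c \<in> C" "\<And>i. i < k \<Longrightarrow> (f ^^ i) e \<notin> C"
    and K: "order_constant K"
  obtains s where "side_ok c s"
    "branch_end n e e' ((f ^^ (n - Suc k)) (fval f c s))
       (\<lambda>\<epsilon>. {x\<in>MM. (f ^^ k) x \<in> critical_point_nbhd K n k c s \<epsilon>})"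
proof -
  let ?J = "open_segment e e'"
  have sub: "?J \<subseteq> MM" using segment_subset_MM[OF e(1,2)] segment_open_subset_closed by blast
  define m where "m = n - Suc k"
  have n: "n = m + Suc k" using k(1) by (simp add: m_def)
  have fn: "(f ^^ n) x = (f ^^ m) (f ((f ^^ k) x))" for x
    unfolding n funpow_add by simp
  have H: "is_interval (insert e ?J)" "insert e ?J \<subseteq> MM"
    using e sub by (auto simp: is_interval_1 open_segment_eq_real_ivl split: if_splits)
  have Hbr: "continuous_on (insert e ?J) (f ^^ k)" "strictly_monotonic_on (insert e ?J) (f ^^ k)"
  proof -
    have "(f ^^ i) x \<notin> C" if "i < k" "x \<in> insert e ?J" for i x
      using that free[of i x] k(1) k(4)[OF that(1)] by auto
    from iterate_branch[OF H this]
    show "continuous_on (insert e ?J) (f ^^ k)" "strictly_monotonic_on (insert e ?J) (f ^^ k)" by auto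
  qed
  have dir: "(\<forall>x\<in>?J. e < x) \<or> (\<forall>x\<in>?J. x < e)"
    by (auto simp: open_segment_eq_real_ivl)
  have "(\<forall>x\<in>?J. c < (f ^^ k) x) \<or> (\<forall>x\<in>?J. (f ^^ k) x < c)"
    using Hbr(2) dir unfolding strictly_monotonic_on_def monotone_on_def k(2)[symmetric] by blast
  then obtain s where s: "\<And>x. x \<in> ?J \<Longrightarrow> (c < (f ^^ k) x) = s" "\<And>x. x \<in> ?J \<Longrightarrow> (f ^^ k) x \<noteq> c"
    by (metis less_irrefl less_asym)
  define w where "w = fval f c s"
  have cM: "c \<in> MM" using k(3) C_subset by blast
  obtain x0 where x0: "x0 \<in> ?J" using e(3) open_segment_eq_empty by blast
  have x0M: "(f ^^ k) x0 \<in> MM" using x0 sub iterate_MM by blast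
  have ok: "side_ok c s"
    using s[OF x0] x0M cM by (auto simp: side_ok_def MM_def)
  have wM: "w \<in> MM" unfolding w_def by (rule fval_MM[OF k(3) ok])
  have worb: "(f ^^ i) w \<notin> C" for i unfolding w_def by (rule critical_orbit_not_C[OF k(3) ok])
  let ?F = "at e within ?J"
  have inJ: "\<forall>\<^sub>F x in ?F. x \<in> ?J" by (simp add: eventually_at_filter)
  have "((f ^^ k) \<longlongrightarrow> c) ?F"
    using Hbr(1) k(2) by (auto simp: continuous_on intro: tendsto_within_subset)
  then have "filterlim (f ^^ k) (side_filter c s) ?F"
    unfolding side_filter_def using inJ s
    by (auto simp: filterlim_at intro!: filterlim_at_withinI elim!: eventually_mono split: if_splits)
       (metis linorder_neqE)+
  then have lim1: "((\<lambda>x. f ((f ^^ k) x)) \<longlongrightarrow> w) ?F"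
    unfolding w_def by (rule filterlim_compose[OF tendsto_fval[OF k(3) ok]])
  have "((\<lambda>x. (f ^^ m) (f ((f ^^ k) x))) \<longlongrightarrow> (f ^^ m) w) ?F"
  proof (rule continuous_within_tendsto_compose[OF iterate_continuous_within[OF wM worb] _ lim1])
    show "\<forall>\<^sub>F x in ?F. f ((f ^^ k) x) \<in> MM"
      using inJ by (rule eventually_mono) (use sub f_MM iterate_MM in blast)
  qed
  then have lim: "((f ^^ n) \<longlongrightarrow> (f ^^ m) w) ?F" by (simp add: fn[abs_def])
  have est: "(f ^^ k) x \<in> critical_point_nbhd K n k c s \<epsilon>" "x \<in> MM"
    if x': "x' \<in> ?J" and x: "x \<in> open_segment e x'"
      and near: "\<bar>(f ^^ n) x - (f ^^ m) w\<bar> \<le> 2 * \<bar>(f ^^ n) x' - (f ^^ n) x\<bar>"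
      and less: "\<bar>(f ^^ n) x - (f ^^ m) w\<bar> < \<epsilon>" for x x' \<epsilon>
  proof -
    define z z' where "z = (f ^^ k) x" and "z' = (f ^^ k) x'"
    have xJ: "x \<in> ?J" using x x' by (auto simp: open_segment_eq_real_ivl split: if_splits)
    then show "x \<in> MM" using sub by blast
    have seg: "closed_segment e x' \<subseteq> insert e ?J"
      using x' by (auto simp: closed_segment_eq_real_ivl open_segment_eq_real_ivl split: if_splits)
    have seg_image: "closed_segment (g u) (g v) \<subseteq> g ` closed_segment u v"
      if "continuous_on (closed_segment u v) g" for g :: "real \<Rightarrow> real" and u v
    proof -
      have "convex (g ` closed_segment u v)"
        using connected_continuous_image[OF that connected_segment] 
        by (metis is_interval_connected_1 is_interval_convex_1)
      then show ?thesis by (intro closed_segment_subset) auto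
    qed
    \<comment> \<open>By the intermediate value theorem each point of the segment other than
      \<open>c\<close> comes from the branch, so the segment meets \<open>C\<close> only in
      \<open>c\<close>. The same argument below keeps the segment \<open>?T\<close> at the critical
      value off \<open>C\<close> for the remaining steps.\<close>
    have zseg: "closed_segment c z' \<subseteq> (f ^^ k) ` closed_segment e x'"
      using seg_image[of e x' "f ^^ k"] continuous_on_subset[OF Hbr(1) seg] k(2) by (simp add: z'_def)
    have pre: "\<exists>u\<in>?J. v = (f ^^ k) u" if "v \<in> closed_segment c z'" "v \<noteq> c" for v
    proof -
      from subsetD[OF zseg that(1)]
      obtain u where u: "v = (f ^^ k) u" "u \<in> closed_segment e x'" by (rule imageE)
      then have "u \<noteq> e" using that(2) k(2) by auto
      then have "u \<in> ?J" using subsetD[OF seg u(2)] by simp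
      then show ?thesis using u(1) by (rule bexI[rotated])
    qed
    have Cseg: "closed_segment c z' \<inter> C = {c}"
    proof
      show "closed_segment c z' \<inter> C \<subseteq> {c}"
      proof
        fix v assume v: "v \<in> closed_segment c z' \<inter> C"
        then show "v \<in> {c}" using pre[of v] free[OF k(1)] by fastforce
      qed
      show "{c} \<subseteq> closed_segment c z' \<inter> C" using k(3) by simp
    qed
    have z'M: "z' \<in> MM" "z' \<noteq> c" "(c < z') = s"
      using x' sub iterate_MM s by (auto simp: z'_def)
    define g where "g = f(c := w)"
    have g: "continuous_on (closed_segment c z') g" "strictly_monotonic_on (closed_segment c z') g"
      using one_sided_extension[OF k(3) z'M(1,2) Cseg] z'M(3) by (simp_all add: g_def w_def)
    have z_in: "z \<in> open_segment c z'"
    proof -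
      have "strictly_monotonic_on (closed_segment e x') (f ^^ k)"
        using Hbr(2) seg by (rule strictly_monotonic_on_subset)
      from strictly_monotonic_between[OF this x, OF ends_in_segment(2)]
      have "\<bar>z - c\<bar> < \<bar>z' - c\<bar>" using k(2) by (simp add: z_def z'_def)
      moreover have "z \<noteq> c" "(c < z) = (c < z')" using s xJ x' by (auto simp: z_def z'_def)
      ultimately show ?thesis by (auto simp: open_segment_eq_real_ivl)
    qed
    have gz: "g z = f z" "g z' = f z'" "g c = w"
      using z_in z'M by (auto simp: g_def open_segment_def)
    have t_in: "f z \<in> open_segment w (f z')"
    proof -
      have b: "\<bar>f z - w\<bar> < \<bar>f z' - w\<bar>" "\<bar>f z' - w\<bar> = \<bar>f z - w\<bar> + \<bar>f z' - f z\<bar>"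
        using strictly_monotonic_between(1,2)[OF g(2) z_in ends_in_segment(2)] gz by simp_all
      moreover have "f z \<noteq> w"
        using inj_onD[OF strictly_monotonic_on_inj_on[OF g(2)], of z c] z_in gz by (auto simp: open_segment_def)
      ultimately show ?thesis by (auto simp: open_segment_eq_real_ivl)
    qed
    let ?T = "closed_segment w (f z')"
    have Tsub: "?T \<subseteq> g ` closed_segment c z'" using seg_image[OF g(1)] gz by simp
    have Tpre: "y = w \<or> (\<exists>u\<in>?J. y = f ((f ^^ k) u))" if "y \<in> ?T" for y
    proof -
      from subsetD[OF Tsub that]
      obtain v where v: "y = g v" "v \<in> closed_segment c z'" by (rule imageE)
      show ?thesis
      proof (cases "v = c")
        case True
        then show ?thesis using v(1) gz(3) by simp
      next
        case False
        then have "y = f v" using v(1) by (simp add: g_def)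
        then show ?thesis using pre[OF v(2) False] by metis
      qed
    qed
    have "is_interval ?T" by (simp add: is_interval_convex_1)
    moreover have "?T \<subseteq> MM" using wM z'M(1) f_MM by (intro segment_subset_MM) auto
    moreover have "(f ^^ i) y \<notin> C" if "i < m" "y \<in> ?T" for i y
      using Tpre[OF that(2)]
    proof
      assume "\<exists>u\<in>?J. y = f ((f ^^ k) u)"
      then obtain u where u: "u \<in> ?J" "y = f ((f ^^ k) u)" by blast
      have "(f ^^ (i + Suc k)) u = (f ^^ i) y" using u(2) by (simp only: funpow_add) simp
      then show ?thesis using free[of "i + Suc k" u] u(1) that(1) n by simp
    qed (use worb in simp)
    ultimately have br: "strictly_monotonic_on ?T (f ^^ m)" "cross_ratio_expanding ?T (f ^^ m)"
      "((f ^^ m) has_real_derivative Dn f D m w) (at w within ?T)" "Dn f D m w \<noteq> 0"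
      using iterate_branch[of ?T m] by auto
    have "\<bar>f z - w\<bar> * \<bar>Dn f D m w\<bar> \<le> (1 + 2) * \<bar>(f ^^ m) (f z) - (f ^^ m) w\<bar>"
      using near by (intro distance_le_of_derivative[OF br(1-3) t_in]) (simp add: fn z_def z'_def)
    also have "\<dots> < 3 * \<epsilon>" using less by (simp add: fn z_def)
    finally have fz: "\<bar>f z - w\<bar> < 3 * \<epsilon> / \<bar>Dn f D m w\<bar>" using br(4) by (simp add: field_simps)
    have L: "1 \<le> l c s" using l_ge_1[OF k(3) ok] .
    have "closed_segment c z \<subseteq> closed_segment c z'"
      using z_in by (intro closed_segment_subset) (auto simp: open_segment_def)
    then have "closed_segment c z \<inter> C = {c}" using Cseg k(3) by auto
    moreover have "z \<in> MM" "z \<noteq> c" "(c < z) = s"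
      using xJ s sub iterate_MM by (auto simp: z_def)
    ultimately have "\<bar>z - c\<bar> \<le> K * \<bar>f z - w\<bar> powr (1 / l c s)"
      using K k(3) unfolding order_constant_def w_def by blast
    also have "\<dots> < K * (3 * \<epsilon> / \<bar>Dn f D m w\<bar>) powr (1 / l c s)"
      using K fz L unfolding order_constant_def by (intro mult_strict_left_mono powr_less_mono2) auto
    finally show "(f ^^ k) x \<in> critical_point_nbhd K n k c s \<epsilon>"
      by (simp add: critical_point_nbhd_def z_def m_def w_def)
  qed
  have "branch_end n e e' ((f ^^ (n - Suc k)) (fval f c s))
       (\<lambda>\<epsilon>. {x\<in>MM. (f ^^ k) x \<in> critical_point_nbhd K n k c s \<epsilon>})"
    unfolding branch_end_def m_def[symmetric] w_def[symmetric] using lim est by blast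
  then show thesis using that ok by blast
qed

end

section \<open>Gaps between cut points and estimates on half branches\<close>

lemma borel_subset_MM_fmeasurable:
  assumes "X \<in> sets borel" "X \<subseteq> MM" shows "X \<in> fmeasurable lborel"
proof (rule fmeasurableI2)
  show "MM \<in> fmeasurable lborel" by (simp add: MM_def fmeasurable_def)
qed (use assms in auto)

lemma measure_mono_MM:
  "X \<subseteq> Z \<Longrightarrow> Z \<subseteq> MM \<Longrightarrow> X \<in> sets borel \<Longrightarrow> Z \<in> sets borel \<Longrightarrow> measure lborel X \<le> measure lborel Z"
  by (intro measure_mono_fmeasurable borel_subset_MM_fmeasurable) auto

lemma sum_measure_gaps:
  fixes P :: "real set"
  assumes P: "finite P" "y0 \<in> P" "y1 \<in> P" "P \<subseteq> {y0..y1}" and G: "G \<in> sets borel"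
  defines "B \<equiv> {(p, q). p \<in> P \<and> q \<in> P \<and> p < q \<and> {p<..<q} \<inter> P = {}}"
  shows "(\<Sum>(p, q)\<in>B. measure lborel ({p<..<q} \<inter> G)) = measure lborel ({y0<..<y1} \<inter> G)" "finite B"
proof -
  have "B \<subseteq> P \<times> P" by (auto simp: B_def)
  then show fin: "finite B" using P(1) by (meson finite_SigmaI finite_subset)
  have fm: "{p<..<q} \<inter> G \<in> fmeasurable lborel" for p q :: real
  proof (rule fmeasurable_Int_fmeasurable)
    show "{p<..<q} \<in> fmeasurable lborel" by (cases "p \<le> q") (auto simp: fmeasurable_def)
  qed (use G in simp)
  let ?I = "\<lambda>b. {fst b<..<snd b} \<inter> G"
  have disj: "disjoint_family_on ?I B"
    unfolding disjoint_family_on_def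
  proof (intro ballI impI)
    fix b b' assume b: "b \<in> B" "b' \<in> B" "b \<noteq> b'"
    show "?I b \<inter> ?I b' = {}"
    proof (rule ccontr)
      assume "?I b \<inter> ?I b' \<noteq> {}"
      then obtain x where x: "fst b < x" "x < snd b" "fst b' < x" "x < snd b'" by auto
      have h: "fst b \<in> P" "snd b \<in> P" "{fst b<..<snd b} \<inter> P = {}"
        "fst b' \<in> P" "snd b' \<in> P" "{fst b'<..<snd b'} \<inter> P = {}" using b by (auto simp: B_def)
      have "fst b = fst b'"
        using h x by (metis Int_iff empty_iff greaterThanLessThan_iff less_trans linorder_neqE)
      moreover have "snd b = snd b'"
        using h x by (metis Int_iff empty_iff greaterThanLessThan_iff less_trans linorder_neqE)
      ultimately show False using b(3) by (simp add: prod_eq_iff)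
    qed
  qed
  have cover: "{y0<..<y1} \<inter> G - P = (\<Union>b\<in>B. ?I b)"
  proof (intro equalityI subsetI)
    fix x assume x: "x \<in> {y0<..<y1} \<inter> G - P"
    let ?L = "{u\<in>P. u < x}" and ?R = "{u\<in>P. x < u}"
    have L: "finite ?L" "y0 \<in> ?L" and R: "finite ?R" "y1 \<in> ?R" using x P by auto
    define p q where "p = Max ?L" and "q = Min ?R"
    have p: "p \<in> ?L" and q: "q \<in> ?R"
      unfolding p_def q_def using L R by (metis (lifting) Max_in Min_in empty_iff)+
    have "{p<..<q} \<inter> P = {}"
    proof (rule ccontr)
      assume "{p<..<q} \<inter> P \<noteq> {}"
      then obtain u where u: "u \<in> P" "p < u" "u < q" by auto
      have "u \<noteq> x" using u x by auto
      then consider "u \<in> ?L" | "u \<in> ?R" using u by force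
      then show False
      proof cases
        case 1
        then have "u \<le> p" unfolding p_def by (rule Max_ge[OF L(1)])
        then show False using u by simp
      next
        case 2
        then have "q \<le> u" unfolding q_def by (rule Min_le[OF R(1)])
        then show False using u by simp
      qed
    qed
    then have "(p, q) \<in> B" "x \<in> ?I (p, q)" using p q x by (auto simp: B_def)
    then show "x \<in> (\<Union>b\<in>B. ?I b)" by blast
  next
    fix x assume "x \<in> (\<Union>b\<in>B. ?I b)"
    then obtain b where b: "b \<in> B" "fst b < x" "x < snd b" "x \<in> G" by auto
    then have "fst b \<in> {y0..y1}" "snd b \<in> {y0..y1}" "x \<notin> P" using P(4) by (auto simp: B_def)
    then show "x \<in> {y0<..<y1} \<inter> G - P" using b by auto
  qed
  have "measure lborel ({y0<..<y1} \<inter> G) = measure lborel ({y0<..<y1} \<inter> G - P)"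
    using fm[of y0 y1] P(1) finite_imp_null_set_lborel[OF P(1)]
    by (intro measure_Diff_null_set[symmetric]) auto
  also have "\<dots> = (\<Sum>b\<in>B. measure lborel (?I b))"
    unfolding cover using fin disj G fmeasurableD2[OF fm] by (intro measure_finite_Union) auto
  finally show "(\<Sum>(p, q)\<in>B. measure lborel ({p<..<q} \<inter> G)) = measure lborel ({y0<..<y1} \<inter> G)"
    by (simp add: case_prod_beta)
qed

text \<open>\<kappa> is the factor lost when the preimage of \<open>A\<close> in a half branch at
  \<open>a\<close> is bounded by that of the \<epsilon>-ball around \<open>a\<close>: 1 if
  \<open>A\<close> lies in the ball, the constant of the far part if it lies outside, the sum of
  both if its position is unknown.\<close>

definition admissible :: "real set \<Rightarrow> real \<Rightarrow> real \<Rightarrow> real \<Rightarrow> bool" where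
  "admissible A a \<epsilon> \<kappa> \<longleftrightarrow> 0 < \<epsilon> \<and> 0 \<le> \<kappa> \<and>
     ((\<forall>y\<in>A. \<bar>y - a\<bar> < \<epsilon>) \<and> 1 \<le> \<kappa> \<or>
      (\<forall>y\<in>A. \<epsilon> \<le> \<bar>y - a\<bar>) \<and> 4 * measure lborel A / \<epsilon> \<le> \<kappa> \<or>
      1 + 4 * measure lborel A / \<epsilon> \<le> \<kappa>)"

context class_A
begin

lemma iterate_vimage_segment_borel:
  assumes "e \<in> MM" "e' \<in> MM" "B \<in> sets borel"
  shows "{x\<in>open_segment e e'. (f ^^ n) x \<in> B} \<in> sets borel"
proof -
  have "open_segment e e' \<subseteq> MM" using segment_subset_MM[OF assms(1,2)] segment_open_subset_closed by blast
  then have "{x\<in>open_segment e e'. (f ^^ n) x \<in> B} = open_segment e e' \<inter> {x\<in>MM. (f ^^ n) x \<in> B}" by auto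
  moreover have "open_segment e e' \<in> sets borel" by (simp add: open_segment_eq_real_ivl)
  ultimately show ?thesis using iterate_vimage_borel[OF assms(3)] by simp
qed

text \<open>\<open>f ^^ n\<close> may jump at the ends of a branch; its limits from inside are
  inserted so that the results on closed segments apply.\<close>

lemma branch_extension:
  assumes e: "e \<in> MM" "e' \<in> MM" "e \<noteq> e'"
    and free: "\<And>k x. k < n \<Longrightarrow> x \<in> open_segment e e' \<Longrightarrow> (f ^^ k) x \<notin> C"
    and lim: "((f ^^ n) \<longlongrightarrow> a) (at e within open_segment e e')" "((f ^^ n) \<longlongrightarrow> b) (at e' within open_segment e e')"
  defines "h \<equiv> (f ^^ n)(e := a, e' := b)"
  shows "continuous_on (closed_segment e e') h" "strictly_monotonic_on (closed_segment e e') h"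
    "cross_ratio_expanding (closed_segment e e') h"
proof -
  let ?J = "open_segment e e'" and ?S = "closed_segment e e'"
  have sub: "?J \<subseteq> MM" using segment_subset_MM[OF e(1,2)] segment_open_subset_closed by blast
  have S: "?S = insert e (insert e' ?J)" by (auto simp: open_segment_def)
  have J: "e \<notin> ?J" "e' \<notin> ?J" by (auto simp: open_segment_def)
  have hJ: "h x = (f ^^ n) x" if "x \<in> ?J" for x using that J by (auto simp: h_def)
  have he: "h e = a" "h e' = b" using e(3) by (auto simp: h_def)
  have "is_interval ?J" by (simp add: is_interval_convex_1)
  from iterate_branch[OF this sub free]
  have br: "continuous_on ?J (f ^^ n)" "strictly_monotonic_on ?J (f ^^ n)" "cross_ratio_expanding ?J (f ^^ n)" by auto
  have ev: "\<forall>\<^sub>F y in at x within ?J. (f ^^ n) y = h y" for x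
    by (simp add: eventually_at_filter hJ)
  show cont: "continuous_on ?S h"
    unfolding continuous_on
  proof
    fix x assume "x \<in> ?S"
    then consider "x = e" | "x = e'" | "x \<in> ?J" using S by auto
    then show "(h \<longlongrightarrow> h x) (at x within ?S)"
    proof cases
      case 1
      have "at e within ?S = at e within ?J"
        using e(3) S by (intro at_within_nhd[of e "- {e'}"]) auto
      then show ?thesis using Lim_transform_eventually[OF lim(1) ev] 1 he by simp
    next
      case 2
      have "at e' within ?S = at e' within ?J"
        using e(3) S by (intro at_within_nhd[of e' "- {e}"]) auto
      then show ?thesis using Lim_transform_eventually[OF lim(2) ev] 2 he by simp
    next
      case 3
      have "at x within ?S = at x within ?J"
        using 3 S J by (intro at_within_nhd[of x "- {e, e'}"]) auto
      moreover have "((f ^^ n) \<longlongrightarrow> (f ^^ n) x) (at x within ?J)" using br(1) 3 by (simp add: continuous_on)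
      ultimately show ?thesis using Lim_transform_eventually[OF _ ev] hJ[OF 3] by simp
    qed
  qed
  have J_eq: "?J = {min e e'<..<max e e'}" "?S = {min e e'..max e e'}"
    by (auto simp: closed_segment_eq_real_ivl open_segment_eq_real_ivl)
  have "strictly_monotonic_on ?J h" using br(2) hJ by (simp add: strictly_monotonic_on_def monotone_on_def)
  then show "strictly_monotonic_on ?S h"
    using strictly_monotonic_on_closure cont unfolding J_eq by blast
  have "cross_ratio_expanding ?J h" using br(3) hJ by (simp add: cross_ratio_expanding_def)
  then show "cross_ratio_expanding ?S h"
    using cross_ratio_expanding_closure cont unfolding J_eq by blast
qed

text \<open>\<open>branch_end\<close> speaks of an interior point x', while the half branch is
  defined by the limit \<open>b\<close> at the far end. Choosing x' with image closer to
  \<open>b\<close> than half of |b - h x| costs the factor 2 in \<open>branch_end\<close>.\<close>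

lemma near_part_subset:
  assumes e: "e \<in> MM" "e' \<in> MM" "e \<noteq> e'"
    and free: "\<And>k x. k < n \<Longrightarrow> x \<in> open_segment e e' \<Longrightarrow> (f ^^ k) x \<notin> C"
    and be: "branch_end n e e' a E" and lim: "((f ^^ n) \<longlongrightarrow> b) (at e' within open_segment e e')"
  defines "h \<equiv> (f ^^ n)(e := a, e' := b)"
  shows "near_part h e e' \<epsilon> \<subseteq> open_segment e e' \<inter> E \<epsilon>"
proof
  let ?J = "open_segment e e'"
  have J: "e \<notin> ?J" "e' \<notin> ?J" by (auto simp: open_segment_def)
  have hJ: "h x = (f ^^ n) x" if "x \<in> ?J" for x using that J by (auto simp: h_def)
  have he: "h e = a" "h e' = b" using e(3) by (auto simp: h_def)
  have lim_a: "((f ^^ n) \<longlongrightarrow> a) (at e within ?J)" using be by (simp add: branch_end_def)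
  note ext = branch_extension[OF e free lim_a lim, folded h_def]
  fix x assume x: "x \<in> near_part h e e' \<epsilon>"
  then have xJ: "x \<in> ?J" and nr: "\<bar>h x - a\<bar> \<le> \<bar>b - h x\<bar>" "\<bar>h x - a\<bar> < \<epsilon>"
    by (auto simp: near_part_def he)
  have "x \<noteq> e'" using xJ J by auto
  have "h x \<noteq> b"
    using inj_onD[OF strictly_monotonic_on_inj_on[OF ext(2)], of x e'] xJ he \<open>x \<noteq> e'\<close>
    by (auto simp: open_segment_def)
  define \<eta> where "\<eta> = \<bar>b - h x\<bar> / 2"
  have \<eta>: "\<eta> > 0" using \<open>h x \<noteq> b\<close> by (simp add: \<eta>_def)
  let ?F = "at e' within open_segment x e'"
  have F: "?F \<noteq> bot"
  proof -
    have "open_segment x e' - {e'} = open_segment x e'" by (auto simp: open_segment_def)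
    then show ?thesis using \<open>x \<noteq> e'\<close>
      by (simp add: trivial_limit_within islimpt_in_closure closure_open_segment)
  qed
  have seg: "open_segment x e' \<subseteq> ?J"
    using xJ by (auto simp: open_segment_eq_real_ivl split: if_splits)
  have "((f ^^ n) \<longlongrightarrow> b) ?F" using lim seg by (rule tendsto_within_subset)
  then have "\<forall>\<^sub>F y in ?F. dist ((f ^^ n) y) b < \<eta>" using \<eta> by (rule tendstoD)
  moreover have "\<forall>\<^sub>F y in ?F. y \<in> open_segment x e'" by (simp add: eventually_at_filter)
  ultimately have "\<forall>\<^sub>F y in ?F. dist ((f ^^ n) y) b < \<eta> \<and> y \<in> open_segment x e'" by (rule eventually_conj)
  then obtain x' where x': "dist ((f ^^ n) x') b < \<eta>" "x' \<in> open_segment x e'"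
    using eventually_happens'[OF F] by blast
  have x'J: "x' \<in> ?J" using x'(2) seg by blast
  have "x \<in> open_segment e x'"
    using x'(2) xJ by (auto simp: open_segment_eq_real_ivl split: if_splits)
  moreover have "\<bar>(f ^^ n) x - a\<bar> \<le> 2 * \<bar>(f ^^ n) x' - (f ^^ n) x\<bar>"
    using x'(1) nr(1) hJ[OF xJ] unfolding dist_real_def \<eta>_def by (auto simp: abs_if split: if_splits)
  ultimately have "x \<in> E \<epsilon>"
    using be x'J nr(2) hJ[OF xJ] unfolding branch_end_def by auto
  then show "x \<in> ?J \<inter> E \<epsilon>" using xJ by simp
qed

text \<open>The near part lies in \<open>E \<epsilon>\<close>, and the measure of the far part is at
  most a multiple of that of the near part; \<open>admissible\<close> tells which of the two parts
  occur.\<close>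

lemma half_branch_measure_le:
  assumes e: "e \<in> MM" "e' \<in> MM" "e \<noteq> e'"
    and free: "\<And>k x. k < n \<Longrightarrow> x \<in> open_segment e e' \<Longrightarrow> (f ^^ k) x \<notin> C"
    and be: "branch_end n e e' a E" and lim: "((f ^^ n) \<longlongrightarrow> b) (at e' within open_segment e e')"
    and A: "A \<in> sets borel" "A \<subseteq> MM" and E: "E \<epsilon> \<in> sets borel" and adm: "admissible A a \<epsilon> \<kappa>"
  shows "measure lborel {x\<in>open_segment e e'. \<bar>(f ^^ n) x - a\<bar> \<le> \<bar>b - (f ^^ n) x\<bar> \<and> (f ^^ n) x \<in> A}
    \<le> \<kappa> * measure lborel (open_segment e e' \<inter> E \<epsilon>)"
proof -
  let ?J = "open_segment e e'"
  define h where "h = (f ^^ n)(e := a, e' := b)"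
  have J: "e \<notin> ?J" "e' \<notin> ?J" by (auto simp: open_segment_def)
  have hJ: "h x = (f ^^ n) x" if "x \<in> ?J" for x using that J by (auto simp: h_def)
  have he: "h e = a" "h e' = b" using e(3) by (auto simp: h_def)
  have lim_a: "((f ^^ n) \<longlongrightarrow> a) (at e within ?J)" using be by (simp add: branch_end_def)
  note ext = branch_extension[OF e free lim_a lim, folded h_def]
  have sub: "?J \<subseteq> MM" using segment_subset_MM[OF e(1,2)] segment_open_subset_closed by blast
  have \<epsilon>: "0 < \<epsilon>" "0 \<le> \<kappa>" using adm by (auto simp: admissible_def)
  have JE: "?J \<inter> E \<epsilon> \<in> sets borel" using E by (auto simp: open_segment_eq_real_ivl)
  let ?\<mu> = "measure lborel (?J \<inter> E \<epsilon>)"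
  define N where "N = {x\<in>?J. \<bar>(f ^^ n) x - a\<bar> \<le> \<bar>b - (f ^^ n) x\<bar> \<and> (f ^^ n) x \<in> A}"
  define N1 where "N1 = {x\<in>N. \<bar>(f ^^ n) x - a\<bar> < \<epsilon>}"
  define N2 where "N2 = {x\<in>N. \<epsilon> \<le> \<bar>(f ^^ n) x - a\<bar>}"
  have N_meas: "N1 \<in> sets borel" "N2 \<in> sets borel"
  proof -
    have "{x\<in>?J. (f ^^ n) x \<in> A \<inter> {y. \<bar>y - a\<bar> \<le> \<bar>b - y\<bar> \<and> \<bar>y - a\<bar> < \<epsilon>}} \<in> sets borel"
      using A by (intro iterate_vimage_segment_borel e) auto
    then show "N1 \<in> sets borel" by (simp add: N1_def N_def conj_ac)
    have "{x\<in>?J. (f ^^ n) x \<in> A \<inter> {y. \<bar>y - a\<bar> \<le> \<bar>b - y\<bar> \<and> \<epsilon> \<le> \<bar>y - a\<bar>}} \<in> sets borel"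
      using A by (intro iterate_vimage_segment_borel e) auto
    then show "N2 \<in> sets borel" by (simp add: N2_def N_def conj_ac)
  qed
  have np: "near_part h e e' \<epsilon> \<subseteq> ?J \<inter> E \<epsilon>"
    using near_part_subset[OF e free be lim] unfolding h_def .
  have "N1 \<subseteq> near_part h e e' \<epsilon>"
    by (auto simp: N1_def N_def near_part_def he hJ)
  then have m1: "measure lborel N1 \<le> ?\<mu>"
    using np sub N_meas JE by (intro measure_mono_MM) auto
  have "N2 = {x \<in> ?J. \<bar>h x - h e\<bar> \<le> \<bar>h e' - h x\<bar> \<and> \<epsilon> \<le> \<bar>h x - h e\<bar> \<and> h x \<in> A}"
    by (auto simp: N2_def N_def he hJ)
  then have "measure lborel N2 \<le> 4 * measure lborel A / \<epsilon> * measure lborel (near_part h e e' \<epsilon>)"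
    using measure_far_part_le[OF ext \<epsilon>(1) A(1)] A(2) by (simp add: MM_def)
  also have "\<dots> \<le> 4 * measure lborel A / \<epsilon> * ?\<mu>"
    using np sub JE near_part_borel[OF ext(1)] \<epsilon> by (intro mult_left_mono measure_mono_MM) auto
  finally have m2: "measure lborel N2 \<le> 4 * measure lborel A / \<epsilon> * ?\<mu>" .
  have "N = N1 \<union> N2" by (auto simp: N1_def N2_def)
  then have m: "measure lborel N \<le> measure lborel N1 + measure lborel N2"
    using N_meas by (simp add: measure_Un_le)
  have "measure lborel N \<le> \<kappa> * ?\<mu>"
    using adm unfolding admissible_def
  proof (elim conjE disjE)
    assume a: "\<forall>y\<in>A. \<bar>y - a\<bar> < \<epsilon>" "1 \<le> \<kappa>"
    then have "N2 = {}" by (fastforce simp: N2_def N_def)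
    moreover have "1 * ?\<mu> \<le> \<kappa> * ?\<mu>" using a(2) by (intro mult_right_mono) auto
    ultimately show ?thesis using m m1 by simp
  next
    assume a: "\<forall>y\<in>A. \<epsilon> \<le> \<bar>y - a\<bar>" "4 * measure lborel A / \<epsilon> \<le> \<kappa>"
    then have "N1 = {}" by (fastforce simp: N1_def N_def)
    moreover have "4 * measure lborel A / \<epsilon> * ?\<mu> \<le> \<kappa> * ?\<mu>" using a(2) by (intro mult_right_mono) auto
    ultimately show ?thesis using m m2 by simp
  next
    assume a: "1 + 4 * measure lborel A / \<epsilon> \<le> \<kappa>"
    have "measure lborel N \<le> (1 + 4 * measure lborel A / \<epsilon>) * ?\<mu>" using m m1 m2 by (simp add: distrib_right)
    also have "\<dots> \<le> \<kappa> * ?\<mu>" using a by (intro mult_right_mono) auto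
    finally show ?thesis .
  qed
  then show ?thesis by (simp add: N_def)
qed

end

section \<open>Push-forwards of Lebesgue measure\<close>

context class_A
begin

definition critical_sides :: "(real \<times> bool) set" where
  "critical_sides = {(c, s). c \<in> C \<and> side_ok c s}"

lemma finite_critical_sides: "finite critical_sides"
  by (rule finite_subset[of _ "C \<times> UNIV"]) (auto simp: critical_sides_def finite_C)

lemma critical_point_nbhd_borel: "critical_point_nbhd K n k c s \<epsilon> \<in> sets borel"
  unfolding critical_point_nbhd_def by measurable

end

text \<open>Lebesgue measure on an interval whose endpoints lie in \<open>C\<close> or on a critical orbit; the
  endpoints \<open>0, 1\<close> of \<open>M\<close> would be no good, since their orbits are not controlled.\<close>

locale class_A_start = class_A +
  fixes y0 y1 v :: real
  assumes y: "y0 < y1" "y0 \<in> MM" "y1 \<in> MM" "{y0, y1} \<subseteq> C \<union> {v}"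
    and v: "v \<in> MM" "\<And>k. (f ^^ k) v \<notin> C"
begin

definition pushforward :: "nat \<Rightarrow> real set \<Rightarrow> real" where
  "pushforward n A = measure lborel {x\<in>{y0<..<y1}. (f ^^ n) x \<in> A}"

lemma Ioo_MM: "{y0<..<y1} \<subseteq> MM" using y by (auto simp: MM_def)

lemma pushforward_set_eq: "{x\<in>{y0<..<y1}. (f ^^ n) x \<in> A} = {y0<..<y1} \<inter> {x\<in>MM. (f ^^ n) x \<in> A}"
  using Ioo_MM by auto

lemma pushforward_set_borel: "A \<in> sets borel \<Longrightarrow> {x\<in>{y0<..<y1}. (f ^^ n) x \<in> A} \<in> sets borel"
  unfolding pushforward_set_eq using iterate_vimage_borel by auto

lemma pushforward_nonneg: "0 \<le> pushforward n A" by (simp add: pushforward_def)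

lemma pushforward_le_1: "pushforward n A \<le> 1"
proof (cases "{x\<in>{y0<..<y1}. (f ^^ n) x \<in> A} \<in> sets lborel")
  case True
  then have "measure lborel {x\<in>{y0<..<y1}. (f ^^ n) x \<in> A} \<le> measure lborel MM"
    using Ioo_MM by (intro measure_mono_MM) (auto simp: MM_def)
  then show ?thesis by (simp add: pushforward_def MM_def)
next
  \<comment> \<open>\<open>measure\<close> takes the default value 0 here. A bound for arbitrary
    sets is what later places the averages in a compact cube.\<close>
  case False
  then show ?thesis by (simp add: pushforward_def measure_notin_sets)
qed

text \<open>Each gap between cut points is one branch, and each of its halves is bounded by a term
  belonging to its endpoint: time, point and side of the first visit to \<open>C\<close>, or the
  orbit of \<open>v\<close>. The bound \<open>T p q\<close> for one gap contains the terms of all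
  possible endpoints; summed over the gaps, each term becomes the mass of a single set, so the
  number of branches does not enter. The factor 2 counts the halves.\<close>

lemma pushforward_le:
  assumes n: "0 < n" and K: "order_constant K" and A: "A \<in> sets borel" "A \<subseteq> MM"
    and adm: "\<And>k c s. k < n \<Longrightarrow> (c, s) \<in> critical_sides \<Longrightarrow>
       admissible A ((f ^^ (n - Suc k)) (fval f c s)) (\<epsilon> k c s) (\<kappa> k c s)"
    and adm0: "admissible A ((f ^^ n) v) \<epsilon>0 \<kappa>0"
  shows "pushforward n A \<le>
    2 * ((\<Sum>k<n. \<Sum>(c, s)\<in>critical_sides. \<kappa> k c s * pushforward k (critical_point_nbhd K n k c s (\<epsilon> k c s)))
       + \<kappa>0 * (6 * \<epsilon>0 / \<bar>Dn f D n v\<bar>))"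
proof -
  define P where "P = {y0, y1} \<union> ({x\<in>MM. \<exists>k<n. (f ^^ k) x \<in> C} \<inter> {y0..y1})"
  have P: "finite P" "y0 \<in> P" "y1 \<in> P" "P \<subseteq> {y0..y1}" "P \<subseteq> MM"
    using finite_hits y by (auto simp: P_def)
  define B where "B = {(p, q). p \<in> P \<and> q \<in> P \<and> p < q \<and> {p<..<q} \<inter> P = {}}"
  note gaps = sum_measure_gaps[OF P(1-4), folded B_def]
  define W where "W k c s = {x\<in>MM. (f ^^ k) x \<in> critical_point_nbhd K n k c s (\<epsilon> k c s)}" for k c s
  define V where "V = {x\<in>MM. \<bar>x - v\<bar> < 3 * \<epsilon>0 / \<bar>Dn f D n v\<bar>}"
  have W: "W k c s \<in> sets borel" for k c s
    unfolding W_def by (intro iterate_vimage_borel critical_point_nbhd_borel)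
  have V: "V \<in> sets borel" unfolding V_def MM_def by measurable
  define T where "T p q = (\<Sum>k<n. \<Sum>(c, s)\<in>critical_sides. \<kappa> k c s * measure lborel ({p<..<q} \<inter> W k c s))
     + \<kappa>0 * measure lborel ({p<..<q} \<inter> V)" for p q
  have \<kappa>pos: "0 \<le> \<kappa> k c s" if "k < n" "(c, s) \<in> critical_sides" for k c s
    using adm[OF that] by (simp add: admissible_def)
  have \<kappa>0pos: "0 \<le> \<kappa>0" "0 < \<epsilon>0" using adm0 by (auto simp: admissible_def)
  have gap: "measure lborel {x\<in>{p<..<q}. (f ^^ n) x \<in> A} \<le> 2 * T p q" if b: "(p, q) \<in> B" for p q
  proof -
    have pq: "p \<in> P" "q \<in> P" "p < q" "{p<..<q} \<inter> P = {}" "p \<in> MM" "q \<in> MM"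
      using b P(5) by (auto simp: B_def)
    have sub: "{p<..<q} \<subseteq> {y0..y1}" using pq P(4) by force
    have free0: "(f ^^ k) x \<notin> C" if "k < n" "x \<in> {p<..<q}" for k x
    proof
      assume "(f ^^ k) x \<in> C"
      moreover have "x \<in> MM" "x \<in> {y0..y1}" using that sub pq(5,6) by (auto simp: MM_def)
      ultimately have "x \<in> P" using that(1) by (auto simp: P_def)
      then show False using that(2) pq(4) by auto
    qed
    have "\<exists>a E. branch_end n e e' a E \<and>
        (\<forall>b. ((f ^^ n) \<longlongrightarrow> b) (at e' within open_segment e e') \<longrightarrow>
          measure lborel {x\<in>open_segment e e'. \<bar>(f ^^ n) x - a\<bar> \<le> \<bar>b - (f ^^ n) x\<bar> \<and> (f ^^ n) x \<in> A} \<le> T p q)"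
      if ee: "e \<in> P" "e' \<in> P" "e \<noteq> e'" "open_segment e e' = {p<..<q}" for e e'
    proof -
      have eM: "e \<in> MM" "e' \<in> MM" using ee P(5) by auto
      have free: "(f ^^ k) x \<notin> C" if "k < n" "x \<in> open_segment e e'" for k x
        using free0 that ee(4) by simp
      show ?thesis
      proof (cases "\<exists>k<n. (f ^^ k) e \<in> C")
        case True
        define k where "k = (LEAST k. (f ^^ k) e \<in> C)"
        have kC: "(f ^^ k) e \<in> C" using True unfolding k_def by (auto intro: LeastI)
        have kn: "k < n" using True unfolding k_def by (meson Least_le le_less_trans)
        have kmin: "(f ^^ i) e \<notin> C" if "i < k" for i using not_less_Least that unfolding k_def by blast
        define c where "c = (f ^^ k) e"
        obtain s where s: "side_ok c s" "branch_end n e e' ((f ^^ (n - Suc k)) (fval f c s))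
           (\<lambda>\<epsilon>. {x\<in>MM. (f ^^ k) x \<in> critical_point_nbhd K n k c s \<epsilon>})"
          using critical_branch_end[OF eM ee(3) free kn _ _ kmin K, of c] kC by (auto simp: c_def)
        have cs: "(c, s) \<in> critical_sides" using s(1) kC by (simp add: critical_sides_def c_def)
        have "measure lborel {x\<in>open_segment e e'. \<bar>(f ^^ n) x - (f ^^ (n - Suc k)) (fval f c s)\<bar> \<le> \<bar>b - (f ^^ n) x\<bar> \<and> (f ^^ n) x \<in> A}
            \<le> T p q" if lim: "((f ^^ n) \<longlongrightarrow> b) (at e' within open_segment e e')" for b
        proof -
          have "measure lborel {x\<in>open_segment e e'. \<bar>(f ^^ n) x - (f ^^ (n - Suc k)) (fval f c s)\<bar> \<le> \<bar>b - (f ^^ n) x\<bar> \<and> (f ^^ n) x \<in> A}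
            \<le> \<kappa> k c s * measure lborel ({p<..<q} \<inter> W k c s)"
            using half_branch_measure_le[OF eM ee(3) free s(2) lim A _ adm[OF kn cs]] W[of k c s]
            by (simp add: W_def ee(4))
          also have "\<dots> \<le> (\<Sum>(c, s)\<in>critical_sides. \<kappa> k c s * measure lborel ({p<..<q} \<inter> W k c s))"
            using member_le_sum[OF cs, of "\<lambda>(c, s). \<kappa> k c s * measure lborel ({p<..<q} \<inter> W k c s)"]
              finite_critical_sides \<kappa>pos[OF kn] by auto
          also have "\<dots> \<le> (\<Sum>k<n. \<Sum>(c, s)\<in>critical_sides. \<kappa> k c s * measure lborel ({p<..<q} \<inter> W k c s))"
            using kn \<kappa>pos by (intro member_le_sum[of k]) (auto intro!: sum_nonneg mult_nonneg_nonneg)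
          also have "\<dots> \<le> T p q" unfolding T_def using \<kappa>0pos by simp
          finally show ?thesis .
        qed
        then show ?thesis using s(2) by blast
      next
        case False
        \<comment> \<open>An endpoint whose orbit avoids \<open>C\<close> before time
          \<open>n\<close> is no cut point, hence an end of the start interval; since n > 0 it is
          not in \<open>C\<close> itself, so it is \<open>v\<close>.\<close>
        have "e \<in> {y0, y1}" using ee(1) False by (auto simp: P_def)
        moreover have "e \<notin> C" using False n by (metis funpow_0)
        ultimately have ev: "e = v" using y(4) by auto
        have reg: "branch_end n e e' ((f ^^ n) e) (\<lambda>\<epsilon>. {x\<in>MM. \<bar>x - e\<bar> < 3 * \<epsilon> / \<bar>Dn f D n e\<bar>})"
          using regular_branch_end[OF eM free] False by blast
        have "measure lborel {x\<in>open_segment e e'. \<bar>(f ^^ n) x - (f ^^ n) e\<bar> \<le> \<bar>b - (f ^^ n) x\<bar> \<and> (f ^^ n) x \<in> A}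
            \<le> T p q" if lim: "((f ^^ n) \<longlongrightarrow> b) (at e' within open_segment e e')" for b
        proof -
          have "measure lborel {x\<in>open_segment e e'. \<bar>(f ^^ n) x - (f ^^ n) e\<bar> \<le> \<bar>b - (f ^^ n) x\<bar> \<and> (f ^^ n) x \<in> A}
            \<le> \<kappa>0 * measure lborel ({p<..<q} \<inter> V)"
            using half_branch_measure_le[OF eM ee(3) free reg lim A _ adm0[folded ev]] V ee(4)
            by (simp add: V_def ev)
          also have "\<dots> \<le> T p q"
            unfolding T_def using \<kappa>pos by (auto intro!: sum_nonneg mult_nonneg_nonneg)
          finally show ?thesis .
        qed
        then show ?thesis using reg by blast
      qed
    qed
    note ends = this
    have seg: "open_segment p q = {p<..<q}" "open_segment q p = {p<..<q}"
      using pq(3) by (auto simp: open_segment_eq_real_ivl)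
    obtain a E where a: "branch_end n p q a E"
      "\<And>b. ((f ^^ n) \<longlongrightarrow> b) (at q within {p<..<q}) \<Longrightarrow>
          measure lborel {x\<in>{p<..<q}. \<bar>(f ^^ n) x - a\<bar> \<le> \<bar>b - (f ^^ n) x\<bar> \<and> (f ^^ n) x \<in> A} \<le> T p q"
      using ends[OF pq(1,2) _ seg(1)] pq(3) unfolding seg by auto
    obtain b E' where b: "branch_end n q p b E'"
      "\<And>a. ((f ^^ n) \<longlongrightarrow> a) (at p within {p<..<q}) \<Longrightarrow>
          measure lborel {x\<in>{p<..<q}. \<bar>(f ^^ n) x - b\<bar> \<le> \<bar>a - (f ^^ n) x\<bar> \<and> (f ^^ n) x \<in> A} \<le> T p q"
      using ends[OF pq(2,1) _ seg(2)] pq(3) unfolding seg by auto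
    let ?Na = "{x\<in>{p<..<q}. \<bar>(f ^^ n) x - a\<bar> \<le> \<bar>b - (f ^^ n) x\<bar> \<and> (f ^^ n) x \<in> A}"
    let ?Nb = "{x\<in>{p<..<q}. \<bar>(f ^^ n) x - b\<bar> \<le> \<bar>a - (f ^^ n) x\<bar> \<and> (f ^^ n) x \<in> A}"
    have half: "{x\<in>{p<..<q}. \<bar>(f ^^ n) x - a'\<bar> \<le> \<bar>b' - (f ^^ n) x\<bar> \<and> (f ^^ n) x \<in> A} \<in> sets borel" for a' b'
    proof -
      have "{y. \<bar>y - a'\<bar> \<le> \<bar>b' - y\<bar>} \<inter> A \<in> sets borel" using A(1) by auto
      from iterate_vimage_segment_borel[OF pq(5,6) this, of n] show ?thesis by (simp add: seg)
    qed
    \<comment> \<open>Every image is at least as close to one of the limits \<open>a\<close>,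
      \<open>b\<close> as to the other; a tie counts twice, which is harmless.\<close>
    have "{x\<in>{p<..<q}. (f ^^ n) x \<in> A} = ?Na \<union> ?Nb" by (auto simp: abs_minus_commute)
    then have "measure lborel {x\<in>{p<..<q}. (f ^^ n) x \<in> A} \<le> measure lborel ?Na + measure lborel ?Nb"
      using half by (simp add: measure_Un_le)
    also have "\<dots> \<le> T p q + T p q"
      using a b by (intro add_mono a(2) b(2)) (auto simp: branch_end_def seg)
    finally show ?thesis by simp
  qed
  have SW: "(\<Sum>(p, q)\<in>B. measure lborel ({p<..<q} \<inter> W k c s)) = pushforward k (critical_point_nbhd K n k c s (\<epsilon> k c s))" for k c s
    unfolding gaps(1)[OF W] pushforward_def pushforward_set_eq by (simp add: W_def)
  have SV: "(\<Sum>(p, q)\<in>B. measure lborel ({p<..<q} \<inter> V)) \<le> 6 * \<epsilon>0 / \<bar>Dn f D n v\<bar>"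
  proof -
    let ?\<rho> = "3 * \<epsilon>0 / \<bar>Dn f D n v\<bar>"
    have \<rho>: "0 \<le> ?\<rho>" using \<kappa>0pos by simp
    have "measure lborel ({y0<..<y1} \<inter> V) \<le> measure lborel {v - ?\<rho>..v + ?\<rho>}"
    proof (rule measure_mono_fmeasurable)
      show "{y0<..<y1} \<inter> V \<subseteq> {v - ?\<rho>..v + ?\<rho>}"
      proof
        fix x assume "x \<in> {y0<..<y1} \<inter> V"
        then have "\<bar>x - v\<bar> < ?\<rho>" by (simp add: V_def)
        then have "v - ?\<rho> \<le> x" "x \<le> v + ?\<rho>" by linarith+
        then show "x \<in> {v - ?\<rho>..v + ?\<rho>}" by simp
      qed
      show "{v - ?\<rho>..v + ?\<rho>} \<in> fmeasurable lborel"
        using \<rho> by (simp add: fmeasurable_def del: times_divide_eq_left)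
    qed (use V in simp)
    also have "\<dots> = 6 * \<epsilon>0 / \<bar>Dn f D n v\<bar>" using \<rho> by simp
    finally show ?thesis unfolding gaps(1)[OF V] .
  qed
  have "pushforward n A = (\<Sum>(p, q)\<in>B. measure lborel ({p<..<q} \<inter> {x\<in>MM. (f ^^ n) x \<in> A}))"
    unfolding pushforward_def pushforward_set_eq using gaps(1)[OF iterate_vimage_borel[OF A(1)]] by simp
  also have "\<dots> \<le> (\<Sum>(p, q)\<in>B. 2 * T p q)"
  proof (rule sum_mono)
    fix b assume b: "b \<in> B"
    obtain p q where pq: "b = (p, q)" by fastforce
    have "{p<..<q} \<subseteq> MM" using b P(5) unfolding pq B_def by (force simp: MM_def)
    then have "{p<..<q} \<inter> {x\<in>MM. (f ^^ n) x \<in> A} = {x\<in>{p<..<q}. (f ^^ n) x \<in> A}" by auto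
    then show "(case b of (p, q) \<Rightarrow> measure lborel ({p<..<q} \<inter> {x\<in>MM. (f ^^ n) x \<in> A})) \<le> (case b of (p, q) \<Rightarrow> 2 * T p q)"
      using gap b pq by simp
  qed
  also have "\<dots> = 2 * (\<Sum>(p, q)\<in>B. T p q)" by (simp add: sum_distrib_left case_prod_beta)
  also have "(\<Sum>(p, q)\<in>B. T p q) = (\<Sum>k<n. \<Sum>(c, s)\<in>critical_sides. \<kappa> k c s * (\<Sum>(p, q)\<in>B. measure lborel ({p<..<q} \<inter> W k c s)))
      + \<kappa>0 * (\<Sum>(p, q)\<in>B. measure lborel ({p<..<q} \<inter> V))"
  proof -
    have "(\<Sum>b\<in>B. \<Sum>k<n. \<Sum>cs\<in>critical_sides. g b k cs) = (\<Sum>k<n. \<Sum>cs\<in>critical_sides. \<Sum>b\<in>B. g b k cs)"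
      for g :: "real \<times> real \<Rightarrow> nat \<Rightarrow> real \<times> bool \<Rightarrow> real"
      by (subst sum.swap, rule sum.cong[OF refl], rule sum.swap)
    then show ?thesis
      unfolding T_def by (simp add: case_prod_beta sum.distrib sum_distrib_left)
  qed
  also have "\<dots> \<le> (\<Sum>k<n. \<Sum>(c, s)\<in>critical_sides. \<kappa> k c s * pushforward k (critical_point_nbhd K n k c s (\<epsilon> k c s)))
       + \<kappa>0 * (6 * \<epsilon>0 / \<bar>Dn f D n v\<bar>)"
    unfolding SW using SV \<kappa>0pos by (intro add_left_mono mult_left_mono) auto
  finally show ?thesis by simp
qed

end

section \<open>Summability along critical orbits\<close>

context class_A
begin

lemma critical_sides_nonempty: "critical_sides \<noteq> {}"
proof -
  obtain c where c: "c \<in> C" using C_nonempty by blast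
  have "side_ok c True \<or> side_ok c False" by (auto simp: side_ok_def)
  then show ?thesis using c by (auto simp: critical_sides_def)
qed

lemma critical_sidesD:
  assumes "(c, s) \<in> critical_sides"
  shows "c \<in> C" "side_ok c s" "1 \<le> l c s" "fval f c s \<in> MM" "(f ^^ k) (fval f c s) \<notin> C"
  using assms l_ge_1 fval_MM critical_orbit_not_C by (auto simp: critical_sides_def)

lemma l_le_lmax: "(c, s) \<in> critical_sides \<Longrightarrow> l c s \<le> lmax C l"
proof -
  assume a: "(c, s) \<in> critical_sides"
  have eq: "{l c s | c s. c \<in> C \<and> side_ok c s} = (\<lambda>(c, s). l c s) ` critical_sides"
    by (auto simp: critical_sides_def)
  show ?thesis
    unfolding lmax_def eq using a finite_critical_sides by (intro Max_ge) (auto intro!: image_eqI[of _ _ "(c, s)"])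
qed

lemma lmax_ge_1: "1 \<le> lmax C l"
proof -
  obtain c s where "(c, s) \<in> critical_sides" using critical_sides_nonempty by auto
  then show ?thesis using l_le_lmax critical_sidesD(3) by force
qed

lemma closest:
  shows "closest C y \<in> C" "c \<in> C \<Longrightarrow> \<bar>y - closest C y\<bar> \<le> \<bar>y - c\<bar>"
proof -
  let ?S = "{c \<in> C. \<forall>c'\<in>C. \<bar>y - c\<bar> \<le> \<bar>y - c'\<bar>}"
  obtain c0 where "is_arg_min (\<lambda>c. \<bar>y - c\<bar>) (\<lambda>c. c \<in> C) c0"
    using ex_is_arg_min_if_finite[OF finite_C C_nonempty] by blast
  then have "c0 \<in> ?S" by (auto simp: is_arg_min_linorder)
  then have "closest C y \<in> ?S"
    unfolding closest_def using finite_C by (intro Min_in) auto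
  then show "closest C y \<in> C" "c \<in> C \<Longrightarrow> \<bar>y - closest C y\<bar> \<le> \<bar>y - c\<bar>" by auto
qed

lemma closest_side:
  assumes "y \<in> MM - C"
  shows "(closest C y, closest C y < y) \<in> critical_sides" "closest C y \<noteq> y"
proof -
  have "closest C y \<in> MM" using closest(1) C_subset by blast
  moreover show "closest C y \<noteq> y" using closest(1)[of y] assms by auto
  ultimately show "(closest C y, closest C y < y) \<in> critical_sides"
    using closest(1)[of y] assms by (auto simp: critical_sides_def side_ok_def MM_def)
qed

text \<open>Near \<open>C\<close> this is the upper order bound. At distance at least
  \<open>d0\<close> from \<open>C\<close> the derivative is bounded by compactness, and the power of
  the distance is bounded below.\<close>

lemma derivative_bound:
  "\<exists>K>0. \<forall>y\<in>MM - C. \<bar>D y\<bar> \<le> K * \<bar>y - closest C y\<bar> powr (l (closest C y) (closest C y < y) - 1)"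
proof -
  have "\<exists>d K. \<forall>(c, s)\<in>critical_sides. d (c, s) > (0::real) \<and> K (c, s) > (0::real) \<and>
     (\<forall>x\<in>side_nbhd c s (d (c, s)). \<bar>D x\<bar> / \<bar>x - c\<bar> powr (l c s - 1) \<le> K (c, s))"
  proof -
    have "\<forall>cs\<in>critical_sides. \<exists>d>0. \<exists>K>0. \<forall>x\<in>side_nbhd (fst cs) (snd cs) d. \<bar>D x\<bar> / \<bar>x - fst cs\<bar> powr (l (fst cs) (snd cs) - 1) \<le> K"
    proof
      fix cs assume "cs \<in> critical_sides"
      then have "fst cs \<in> C" "side_ok (fst cs) (snd cs)" by (auto simp: critical_sides_def)
      from local_order[OF this]
      show "\<exists>d>0. \<exists>K>0. \<forall>x\<in>side_nbhd (fst cs) (snd cs) d. \<bar>D x\<bar> / \<bar>x - fst cs\<bar> powr (l (fst cs) (snd cs) - 1) \<le> K"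
        by metis
    qed
    then obtain d where "\<forall>cs\<in>critical_sides. d cs > 0 \<and> (\<exists>K>0. \<forall>x\<in>side_nbhd (fst cs) (snd cs) (d cs). \<bar>D x\<bar> / \<bar>x - fst cs\<bar> powr (l (fst cs) (snd cs) - 1) \<le> K)"
      by (auto dest!: bchoice)
    then obtain K where "\<forall>cs\<in>critical_sides. d cs > 0 \<and> K cs > 0 \<and> (\<forall>x\<in>side_nbhd (fst cs) (snd cs) (d cs). \<bar>D x\<bar> / \<bar>x - fst cs\<bar> powr (l (fst cs) (snd cs) - 1) \<le> K cs)"
      by (metis (no_types, lifting))
    then show ?thesis by (intro exI[of _ d] exI[of _ K]) auto
  qed
  then obtain d K where dK: "\<And>c s. (c, s) \<in> critical_sides \<Longrightarrow> d (c, s) > (0::real)"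
    "\<And>c s. (c, s) \<in> critical_sides \<Longrightarrow> K (c, s) > (0::real)"
    "\<And>c s x. (c, s) \<in> critical_sides \<Longrightarrow> x \<in> side_nbhd c s (d (c, s)) \<Longrightarrow> \<bar>D x\<bar> / \<bar>x - c\<bar> powr (l c s - 1) \<le> K (c, s)"
    by blast
  define d0 where "d0 = min 1 (Min (d ` critical_sides))"
  have d0: "0 < d0" "d0 \<le> 1" "\<And>cs. cs \<in> critical_sides \<Longrightarrow> d0 \<le> d cs"
    using dK(1) finite_critical_sides critical_sides_nonempty
    by (auto simp: d0_def Min_gr_iff intro: min.coboundedI2)
  define K0 where "K0 = Max (K ` critical_sides)"
  have K0: "K cs \<le> K0" if "cs \<in> critical_sides" for cs
    using that finite_critical_sides by (simp add: K0_def)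
  have K0pos: "K0 > 0"
  proof -
    obtain c s where "(c, s) \<in> critical_sides" using critical_sides_nonempty by auto
    then show ?thesis using K0 dK(2) less_le_trans by blast
  qed
  define Z where "Z = {y\<in>MM. \<forall>c\<in>C. d0 \<le> \<bar>y - c\<bar>}"
  have "closed Z"
  proof -
    have "Z = MM \<inter> (\<Inter>c\<in>C. {y. d0 \<le> \<bar>y - c\<bar>})" by (auto simp: Z_def)
    moreover have "closed (\<Inter>c\<in>C. {y. d0 \<le> \<bar>y - c\<bar>})"
      by (intro closed_INT ballI closed_Collect_le continuous_intros)
    ultimately show ?thesis by (simp add: MM_def closed_Int)
  qed
  moreover have "bounded Z" by (rule bounded_subset[of MM]) (auto simp: Z_def MM_def)
  ultimately have "compact Z" by (simp add: compact_eq_bounded_closed)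
  moreover have "Z \<subseteq> MM - C" using d0 by (force simp: Z_def)
  ultimately have "bounded (D ` Z)"
    using compact_imp_bounded[OF compact_continuous_image[OF continuous_on_subset[OF continuous_on_MM_minus_C(2)]]]
    by simp
  then obtain R where R: "R > 0" "\<And>y. y \<in> Z \<Longrightarrow> \<bar>D y\<bar> \<le> R"
    unfolding bounded_pos by auto
  \<comment> \<open>A lower bound for all these powers at once: \<open>d0\<close> is at most 1 and
    every exponent l - 1 is below \<open>lmax C l\<close>.\<close>
  define q where "q = d0 powr lmax C l"
  have q: "q > 0" using d0 by (simp add: q_def)
  show ?thesis
  proof (intro exI[of _ "K0 + R / q"] conjI ballI)
    show "0 < K0 + R / q" using K0pos R q by (intro add_pos_pos) auto
    fix y assume y: "y \<in> MM - C"
    let ?c = "closest C y"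
    let ?s = "?c < y"
    note cs = closest_side[OF y]
    let ?p = "\<bar>y - ?c\<bar> powr (l ?c ?s - 1)"
    have ppos: "0 < ?p" using cs(2) by simp
    show "\<bar>D y\<bar> \<le> (K0 + R / q) * ?p"
    proof (cases "\<bar>y - ?c\<bar> < d (?c, ?s)")
      case True
      then have "y \<in> side_nbhd ?c ?s (d (?c, ?s))" using cs(2) by (auto simp: side_nbhd_def)
      from dK(3)[OF cs(1) this] have "\<bar>D y\<bar> \<le> K (?c, ?s) * ?p" using ppos by (simp add: divide_le_eq)
      also have "\<dots> \<le> (K0 + R / q) * ?p" using K0[OF cs(1)] R q by (intro mult_right_mono) (auto intro: add_increasing2)
      finally show ?thesis .
    next
      case False
      then have far: "d0 \<le> \<bar>y - ?c\<bar>" using d0(3)[OF cs(1)] by simp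
      have "y \<in> Z"
        unfolding Z_def using far closest(2)[of _ y] y order_trans by blast
      then have "\<bar>D y\<bar> \<le> R" by (rule R)
      also have "R = R / q * q" using q by simp
      also have "\<dots> \<le> R / q * ?p"
      proof (rule mult_left_mono)
        have "q \<le> d0 powr (l ?c ?s - 1)"
          unfolding q_def using d0 l_le_lmax[OF cs(1)] by (intro powr_mono') auto
        also have "\<dots> \<le> ?p" using far d0 critical_sidesD(3)[OF cs(1)] by (intro powr_mono2) auto
        finally show "q \<le> ?p" .
      qed (use R q in auto)
      also have "\<dots> \<le> (K0 + R / q) * ?p" using K0pos by (intro mult_right_mono) auto
      finally show ?thesis .
    qed
  qed
qed

text \<open>Up to constants, a bound for \<kappa> times the radius of the ball at \<open>c\<close>
  divided by \<delta> in the induction on balls, with \<open>m\<close> steps left after the critical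
  value.\<close>

definition critical_weight :: "real \<Rightarrow> bool \<Rightarrow> nat \<Rightarrow> real" where
  "critical_weight c s m = (let y = (f ^^ m) (fval f c s) in
     \<bar>y - closest C y\<bar> powr (1 / l c s - 1) * \<bar>Dn f D m (fval f c s)\<bar> powr (- 1 / l c s))"

lemma critical_weight_nonneg: "0 \<le> critical_weight c s m"
  by (simp add: critical_weight_def Let_def)

lemma Dn_critical_nonzero:
  assumes "(c, s) \<in> critical_sides" shows "Dn f D n (fval f c s) \<noteq> 0"
  using iterate_branch[of "{fval f c s}" n] critical_sidesD[OF assms] by (auto simp: is_interval_convex_1)

text \<open>In the first summability condition Df^(m+1) contains the additional factor D y, which is
  at most a constant times |y - ct|^(lt - 1), where lt is the order at the closest point ct.
  Substituting this leaves |y - ct|^(1 - l) / |Df^m| to the power 1 / l, which is the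
  weight.\<close>

lemma summable_critical_weight:
  assumes cs: "(c, s) \<in> critical_sides"
  shows "summable (critical_weight c s)"
proof -
  obtain K where K: "K > 0" "\<And>y. y \<in> MM - C \<Longrightarrow> \<bar>D y\<bar> \<le> K * \<bar>y - closest C y\<bar> powr (l (closest C y) (closest C y < y) - 1)"
    using derivative_bound by blast
  define L where "L = l c s"
  have L: "1 \<le> L" using critical_sidesD(3)[OF cs] by (simp add: L_def)
  let ?w = "fval f c s"
  define t where "t k = (let y = (f ^^ k) ?w; ct = closest C y in
          (\<bar>y - ct\<bar> powr (l ct (ct < y)) /
            (\<bar>y - ct\<bar> powr (l c s) * \<bar>Dn f D (Suc k) ?w\<bar>)) powr (1 / l c s))" for k
  have "summable t"
    using classA critical_sidesD(1,2)[OF cs] unfolding classA_def t_def by blast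
  then have "summable (\<lambda>k. K powr (1 / L) * t k)" by (rule summable_mult)
  then show ?thesis
  proof (rule summable_comparison_test')
    fix k :: nat assume "0 \<le> k"
    define y where "y = (f ^^ k) ?w"
    have y: "y \<in> MM - C" using critical_sidesD(4,5)[OF cs] iterate_MM by (simp add: y_def)
    define ct lt r \<Lambda> where "ct = closest C y" and "lt = l ct (ct < y)" and "r = \<bar>y - ct\<bar>" and "\<Lambda> = \<bar>Dn f D k ?w\<bar>"
    have r: "r > 0" using closest_side(2)[OF y] by (simp add: r_def ct_def)
    have \<Lambda>: "\<Lambda> > 0" using Dn_critical_nonzero[OF cs] by (simp add: \<Lambda>_def)
    have Dy: "\<bar>D y\<bar> \<le> K * r powr (lt - 1)" using K(2)[OF y] by (simp add: r_def ct_def lt_def)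
    have DS: "\<bar>Dn f D (Suc k) ?w\<bar> = \<Lambda> * \<bar>D y\<bar>" by (simp add: Dn_def \<Lambda>_def y_def abs_mult)
    have Dpos: "0 < \<bar>D y\<bar>" using Dn_critical_nonzero[OF cs, of "Suc k"] DS \<Lambda> by auto
    have w: "critical_weight c s k = r powr (1 / L - 1) * \<Lambda> powr (- 1 / L)"
      by (simp add: critical_weight_def Let_def y_def[symmetric] r_def ct_def L_def \<Lambda>_def)
    have "r powr (1 - L) / \<Lambda> = K * (r powr lt / (r powr L * (\<Lambda> * (K * r powr (lt - 1)))))"
      using K(1) r \<Lambda> by (simp add: powr_diff field_simps)
    also have "\<dots> \<le> K * (r powr lt / (r powr L * (\<Lambda> * \<bar>D y\<bar>)))"
      using Dy Dpos K(1) r \<Lambda> by (intro mult_left_mono divide_left_mono mult_pos_pos) auto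
    finally have "(r powr (1 - L) / \<Lambda>) powr (1 / L) \<le> (K * (r powr lt / (r powr L * (\<Lambda> * \<bar>D y\<bar>)))) powr (1 / L)"
      using L \<Lambda> by (intro powr_mono2) auto
    also have "\<dots> = K powr (1 / L) * (r powr lt / (r powr L * (\<Lambda> * \<bar>D y\<bar>))) powr (1 / L)"
      by (rule powr_mult)
    also have "\<dots> = K powr (1 / L) * t k"
      using DS by (simp add: t_def Let_def y_def[symmetric] ct_def[symmetric] r_def lt_def L_def)
    also have "(r powr (1 - L) / \<Lambda>) powr (1 / L) = (r powr (1 - L)) powr (1 / L) / \<Lambda> powr (1 / L)"
      by (rule powr_divide)
    also have "\<dots> = r powr (1 / L - 1) * \<Lambda> powr (- 1 / L)"
      using L by (simp add: powr_powr diff_divide_distrib powr_minus_divide)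
    finally show "norm (critical_weight c s k) \<le> K powr (1 / L) * t k"
      using w critical_weight_nonneg[of c s k] by simp
  qed
qed

lemma summable_Dn:
  assumes cs: "(c, s) \<in> critical_sides"
  shows "summable (\<lambda>m. \<bar>Dn f D m (fval f c s)\<bar> powr (- 1 / l c s))"
proof -
  have "summable (\<lambda>k. \<bar>Dn f D (Suc k) (fval f c s)\<bar> powr (- 1 / l c s))"
    using classA critical_sidesD(1,2)[OF cs] unfolding classA_def by blast
  then show ?thesis by (subst (asm) summable_Suc_iff)
qed

text \<open>The terms of the second summability series tend to 0, so they are bounded, and this
  bounds the derivatives from below. It controls the boundary term coming from
  \<open>v\<close>.\<close>

lemma Dn_bounded_below:
  assumes cs: "(c, s) \<in> critical_sides"
  obtains b where "b > 0" "\<And>n. b \<le> \<bar>Dn f D n (fval f c s)\<bar>"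
proof -
  define L where "L = l c s"
  have L: "1 \<le> L" using critical_sidesD(3)[OF cs] by (simp add: L_def)
  let ?a = "\<lambda>m. \<bar>Dn f D m (fval f c s)\<bar>"
  have "Bseq (\<lambda>m. ?a m powr (- 1 / L))"
    using convergentI[OF summable_LIMSEQ_zero[OF summable_Dn[OF cs]]] unfolding L_def
    by (rule convergent_imp_Bseq)
  then obtain M where M: "M > 0" "\<And>m. ?a m powr (- 1 / L) \<le> M"
    unfolding Bseq_def by auto
  have "M powr (- L) \<le> ?a n" for n
  proof -
    have a: "?a n > 0" using Dn_critical_nonzero[OF cs] by simp
    have "M powr (- L) \<le> (?a n powr (- 1 / L)) powr (- L)"
      using M(2)[of n] a L by (intro powr_mono2') auto
    also have "\<dots> = ?a n" using a L by (simp add: powr_powr)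
    finally show ?thesis .
  qed
  moreover have "M powr (- L) > 0" using M by simp
  ultimately show thesis using that by blast
qed

end

section \<open>Uniform bounds\<close>

text \<open>The case r \<le> 2 \<delta> of the induction, with scale 3 \<delta> and weight 1. As 1 /
  L - 1 is nonpositive, \<delta>^(1/L - 1) may be replaced by r^(1/L - 1) at the cost of a factor at
  most 2; 9 times 2 is rounded up to the constant of the far case.\<close>

lemma powr_bound_near:
  fixes L :: real
  assumes L: "1 \<le> L" and r: "0 < r" "r \<le> 2 * \<delta>" and \<Lambda>: "0 < \<Lambda>"
  shows "(3 * (3 * \<delta>) / \<Lambda>) powr (1 / L) \<le> 24 * \<delta> * (r powr (1 / L - 1) * \<Lambda> powr (- 1 / L))"
proof -
  have \<delta>: "0 < \<delta>" using r by simp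
  have "(3 * (3 * \<delta>) / \<Lambda>) powr (1 / L) = 9 powr (1 / L) * \<delta> powr (1 / L) * \<Lambda> powr (- 1 / L)"
    using \<delta> \<Lambda> by (simp add: powr_divide powr_mult powr_minus_divide)
  also have "\<dots> \<le> 9 * (2 * \<delta> * r powr (1 / L - 1)) * \<Lambda> powr (- 1 / L)"
  proof (intro mult_right_mono mult_mono)
    show "9 powr (1 / L) \<le> (9::real)" using L powr_mono[of "1 / L" 1 9] by simp
    have "\<delta> powr (1 / L) = \<delta> * \<delta> powr (1 / L - 1)" using \<delta> by (simp add: powr_diff)
    also have "\<dots> \<le> \<delta> * (r / 2) powr (1 / L - 1)"
      using L r \<delta> by (intro mult_left_mono powr_mono2') auto
    also have "(r / 2) powr (1 / L - 1) = r powr (1 / L - 1) * 2 powr (1 - 1 / L)"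
      using r by (simp add: powr_divide powr_diff)
    also have "\<dots> \<le> r powr (1 / L - 1) * 2"
      using L powr_mono[of "1 - 1 / L" 1 2] by (intro mult_left_mono) auto
    finally show "\<delta> powr (1 / L) \<le> 2 * \<delta> * r powr (1 / L - 1)"
      using \<delta> by (simp add: mult_ac)
  qed (use \<delta> in auto)
  also have "\<dots> = 18 * (\<delta> * (r powr (1 / L - 1) * \<Lambda> powr (- 1 / L)))" by simp
  also have "\<dots> \<le> 24 * (\<delta> * (r powr (1 / L - 1) * \<Lambda> powr (- 1 / L)))"
    using \<delta> by (intro mult_right_mono) auto
  finally show ?thesis by simp
qed

text \<open>The far case of the induction, with scale r / 2 and weight 16 \<delta> / r; the constant
  is 24 = 16 times 3 / 2.\<close>

lemma powr_bound_far:
  fixes L :: real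
  assumes L: "1 \<le> L" and r: "0 < r" "0 < \<delta>" and \<Lambda>: "0 < \<Lambda>"
  shows "16 * \<delta> / r * (3 * (r / 2) / \<Lambda>) powr (1 / L) \<le> 24 * \<delta> * (r powr (1 / L - 1) * \<Lambda> powr (- 1 / L))"
proof -
  have "(3 * (r / 2) / \<Lambda>) powr (1 / L) = ((3 / 2) * r / \<Lambda>) powr (1 / L)" by simp
  also have "\<dots> = (3 / 2) powr (1 / L) * r powr (1 / L) * \<Lambda> powr (- 1 / L)"
    by (simp only: powr_divide powr_mult) (simp add: powr_minus_divide)
  finally have "16 * \<delta> / r * (3 * (r / 2) / \<Lambda>) powr (1 / L)
      = (3 / 2) powr (1 / L) * (16 * \<delta> * (r powr (1 / L - 1) * \<Lambda> powr (- 1 / L)))"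
    using r by (simp add: powr_diff)
  also have "\<dots> \<le> (3 / 2) * (16 * \<delta> * (r powr (1 / L - 1) * \<Lambda> powr (- 1 / L)))"
    using L r powr_mono[of "1 / L" 1 "3 / 2"] by (intro mult_right_mono) auto
  finally show ?thesis by (simp add: mult_ac)
qed

text \<open>In the near case every point of the ball is closer to \<open>a\<close> than 3 \<delta>.
  In the far case r > 2 \<delta> keeps the ball at distance r / 2 from \<open>a\<close>; its measure
  is at most 2 \<delta>, and 4 times 2 \<delta> over r / 2 is 16 \<delta> / r.\<close>

lemma admissible_ball:
  assumes \<delta>: "0 < \<delta>" and r: "a \<noteq> c"
  defines "r \<equiv> \<bar>a - c\<bar>" and "A \<equiv> {y\<in>MM. \<bar>y - c\<bar> < \<delta>}"
  shows "admissible A a (if r \<le> 2 * \<delta> then 3 * \<delta> else r / 2) (if r \<le> 2 * \<delta> then 1 else 16 * \<delta> / r)"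
proof (cases "r \<le> 2 * \<delta>")
  case True
  then have "\<forall>y\<in>A. \<bar>y - a\<bar> < 3 * \<delta>" by (auto simp: A_def r_def)
  then show ?thesis using True \<delta> by (auto simp: admissible_def)
next
  case False
  have rpos: "0 < r" using r by (simp add: r_def)
  have "A \<subseteq> {c - \<delta>..c + \<delta>}" by (auto simp: A_def)
  then have "measure lborel A \<le> measure lborel {c - \<delta>..c + \<delta>}"
    using \<delta> by (intro measure_mono_fmeasurable) (auto simp: A_def MM_def fmeasurable_def)
  then have "measure lborel A \<le> 2 * \<delta>" using \<delta> by simp
  then have "4 * measure lborel A / (r / 2) \<le> 16 * \<delta> / r" using rpos by (simp add: field_simps)
  moreover have "\<forall>y\<in>A. r / 2 \<le> \<bar>y - a\<bar>" using False unfolding A_def r_def by (auto simp: abs_if split: if_splits)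
  ultimately show ?thesis using False rpos \<delta> by (auto simp: admissible_def)
qed

context class_A_start
begin

lemma pushforward_Int_MM: "pushforward n (A \<inter> MM) = pushforward n A"
proof -
  have "{x\<in>{y0<..<y1}. (f ^^ n) x \<in> A \<inter> MM} = {x\<in>{y0<..<y1}. (f ^^ n) x \<in> A}"
    using Ioo_MM iterate_MM by auto
  then show ?thesis by (simp add: pushforward_def)
qed

lemma pushforward_0_le:
  assumes "A \<in> sets borel" "A \<subseteq> MM" shows "pushforward 0 A \<le> measure lborel A"
  unfolding pushforward_def using assms Ioo_MM
  by (intro measure_mono_MM) (auto intro: pushforward_set_borel[of A 0, simplified])

text \<open>The induction closes because the tail of the first summability condition is small, while the
  finitely many remaining critical values stay away from \<open>C\<close>.\<close>

lemma pushforward_ball_le: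
  assumes b: "0 < b" "\<And>n. b \<le> \<bar>Dn f D n v\<bar>"
  shows "\<exists>K>0. \<forall>n. \<forall>c\<in>C. \<forall>\<delta>>0. pushforward n {y. \<bar>y - c\<bar> < \<delta>} \<le> K * \<delta>"
proof -
  obtain K1 where K1: "order_constant K1" using order_bound by blast
  have K1pos: "K1 > 0" using K1 by (simp add: order_constant_def)
  let ?S = critical_sides
  define \<tau> where "\<tau> m = (\<Sum>(c, s)\<in>?S. critical_weight c s m)" for m
  have \<tau>sum: "summable \<tau>"
    unfolding \<tau>_def by (intro summable_sum) (auto intro: summable_critical_weight)
  have \<tau>pos: "0 \<le> \<tau> m" for m unfolding \<tau>_def by (auto intro!: sum_nonneg critical_weight_nonneg)
  \<comment> \<open>With this choice the tail contributes 24 K K1 \<delta> \<eta> = K \<delta> / 4;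
    the factor 2 of \<open>pushforward_le\<close> makes it K \<delta> / 2 and leaves the other half
    for the remaining terms.\<close>
  define \<eta> where "\<eta> = 1 / (96 * K1)"
  have "\<eta> > 0" using K1pos by (simp add: \<eta>_def)
  then obtain m0 where m0: "\<And>n. n \<ge> m0 \<Longrightarrow> norm (\<Sum>i. \<tau> (i + n)) < \<eta>"
    using suminf_exist_split[OF _ \<tau>sum] by blast
  have tail: "(\<Sum>m\<in>{m0..<n}. \<tau> m) \<le> \<eta>" for n
  proof -
    have "(\<Sum>m\<in>{m0..<n}. \<tau> m) = (\<Sum>i<n - m0. \<tau> (i + m0))"
      by (simp add: sum.atLeastLessThan_shift_0 atLeast0LessThan add.commute)
    also have "\<dots> \<le> (\<Sum>i. \<tau> (i + m0))"
      using \<tau>sum \<tau>pos by (intro sum_le_suminf) (auto simp: summable_iff_shift)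
    also have "\<dots> \<le> \<eta>" using m0[of m0] by simp
    finally show ?thesis .
  qed
  define X where "X = (\<lambda>(m, (c, s), c'). \<bar>(f ^^ m) (fval f c s) - c'\<bar>) ` ({..<m0} \<times> ?S \<times> C)"
  define r0 where "r0 = Min (insert 1 X)"
  have Xfin: "finite X" using finite_critical_sides finite_C by (simp add: X_def)
  have "x > 0" if "x \<in> X" for x
    using that critical_sidesD(5) by (fastforce simp: X_def)
  then have r0: "r0 > 0" using Xfin by (simp add: r0_def)
  have r0_le: "r0 \<le> \<bar>(f ^^ m) (fval f c s) - c'\<bar>" if "m < m0" "(c, s) \<in> ?S" "c' \<in> C" for m c s c'
  proof -
    have "\<bar>(f ^^ m) (fval f c s) - c'\<bar> \<in> X"
      unfolding X_def using that by (intro image_eqI[of _ _ "(m, (c, s), c')"]) auto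
    then show ?thesis using Xfin by (simp add: r0_def)
  qed
  define N where "N = real m0 * real (card ?S) * (16 / r0)"
  have N: "0 \<le> N" using r0 by (simp add: N_def)
  \<comment> \<open>4 N and 192 / b absorb the early critical values and the endpoint
    \<open>v\<close>, 4 / r0 handles \<delta> > r0 / 4 by total mass at most 1, and 2 handles n =
    0.\<close>
  define K where "K = 4 * N + 192 / b + 4 / r0 + 2"
  have Kpos: "K > 0" unfolding K_def using N b(1) r0 by (intro add_nonneg_pos) auto
  have "\<forall>c\<in>C. \<forall>\<delta>>0. pushforward n {y. \<bar>y - c\<bar> < \<delta>} \<le> K * \<delta>" for n
  proof (induction n rule: less_induct)
    case (less n)
    show ?case
    proof (intro ballI allI impI)
      fix c' \<delta> assume c': "c' \<in> C" and \<delta>: "0 < (\<delta>::real)"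
      define A where "A = {y\<in>MM. \<bar>y - c'\<bar> < \<delta>}"
      have A: "A \<in> sets borel" "A \<subseteq> MM" by (auto simp: A_def MM_def)
      have "A = {y. \<bar>y - c'\<bar> < \<delta>} \<inter> MM" by (auto simp: A_def)
      then have pA: "pushforward n {y. \<bar>y - c'\<bar> < \<delta>} = pushforward n A" by (simp add: pushforward_Int_MM)
      consider "n = 0" | "\<delta> > r0 / 4" | "0 < n" "\<delta> \<le> r0 / 4" by force
      then have "pushforward n A \<le> K * \<delta>"
      proof cases
        case 1
        have "A \<subseteq> {c' - \<delta>..c' + \<delta>}" by (auto simp: A_def)
        then have "measure lborel A \<le> measure lborel {c' - \<delta>..c' + \<delta>}"
          using \<delta> A by (intro measure_mono_fmeasurable) (auto simp: fmeasurable_def)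
        then have "pushforward n A \<le> 2 * \<delta>" using pushforward_0_le[OF A] 1 \<delta> by simp
        also have "\<dots> \<le> K * \<delta>" unfolding K_def using N b(1) r0 \<delta> by (intro mult_right_mono) auto
        finally show ?thesis .
      next
        case 2
        have "pushforward n A \<le> 1" using pushforward_le_1 .
        also have "1 \<le> 4 / r0 * \<delta>" using 2 r0 by (simp add: field_simps)
        also have "\<dots> \<le> K * \<delta>" unfolding K_def using N b(1) r0 \<delta> by (intro mult_right_mono) auto
        finally show ?thesis .
      next
        case 3
        define a where "a k c s = (f ^^ (n - Suc k)) (fval f c s)" for k c s
        define \<epsilon> where "\<epsilon> z = (if \<bar>z - c'\<bar> \<le> 2 * \<delta> then 3 * \<delta> else \<bar>z - c'\<bar> / 2)" for z
        define \<kappa> where "\<kappa> z = (if \<bar>z - c'\<bar> \<le> 2 * \<delta> then 1 else 16 * \<delta> / \<bar>z - c'\<bar>)" for z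
        have adm: "admissible A z (\<epsilon> z) (\<kappa> z)" if "z \<notin> C" for z
        proof -
          have "z \<noteq> c'" using that c' by auto
          then show ?thesis using admissible_ball[OF \<delta>, of z c'] by (simp add: \<epsilon>_def \<kappa>_def A_def)
        qed
        have le: "pushforward n A \<le>
          2 * ((\<Sum>k<n. \<Sum>(c, s)\<in>?S. \<kappa> (a k c s) * pushforward k (critical_point_nbhd K1 n k c s (\<epsilon> (a k c s))))
             + \<kappa> ((f ^^ n) v) * (6 * \<epsilon> ((f ^^ n) v) / \<bar>Dn f D n v\<bar>))"
          using critical_sidesD(5) v(2)
          by (intro pushforward_le[OF 3(1) K1 A]) (auto intro!: adm simp: a_def)
        have bdry: "\<kappa> ((f ^^ n) v) * (6 * \<epsilon> ((f ^^ n) v) / \<bar>Dn f D n v\<bar>) \<le> 48 * \<delta> / b"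
        proof -
          let ?z = "(f ^^ n) v"
          have z: "0 < \<bar>?z - c'\<bar>" using v(2)[of n] c' by auto
          \<comment> \<open>18 \<delta> in the near case; 16 \<delta> / r times 3 r = 48 \<delta> in
            the far case.\<close>
          have "\<kappa> ?z * (6 * \<epsilon> ?z) \<le> 48 * \<delta>"
            using z \<delta> by (auto simp: \<kappa>_def \<epsilon>_def)
          moreover have "0 \<le> \<kappa> ?z * (6 * \<epsilon> ?z)" using \<delta> by (auto simp: \<kappa>_def \<epsilon>_def)
          ultimately have "\<kappa> ?z * (6 * \<epsilon> ?z) / \<bar>Dn f D n v\<bar> \<le> 48 * \<delta> / b"
            using b by (intro frac_le) auto
          then show ?thesis by simp
        qed
        \<comment> \<open>For m < m0 the weight is already of order \<delta>, and mass at most 1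
          suffices; for later m the induction hypothesis at time \<open>k\<close> enters, with the
          factor \<open>K\<close>.\<close>
        define \<theta> where "\<theta> m = (if m < m0 then 16 * \<delta> / r0 * real (card ?S) else 24 * K * K1 * \<delta> * \<tau> m)" for m
        have inner: "(\<Sum>(c, s)\<in>?S. \<kappa> (a k c s) * pushforward k (critical_point_nbhd K1 n k c s (\<epsilon> (a k c s))))
            \<le> \<theta> (n - Suc k)" if k: "k < n" for k
        proof (cases "n - Suc k < m0")
          case True
          have "(\<Sum>(c, s)\<in>?S. \<kappa> (a k c s) * pushforward k (critical_point_nbhd K1 n k c s (\<epsilon> (a k c s))))
              \<le> (\<Sum>(c, s)\<in>?S. 16 * \<delta> / r0)"
          proof (intro sum_mono, clarify)
            fix c s assume cs: "(c, s) \<in> ?S"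
            have r: "r0 \<le> \<bar>a k c s - c'\<bar>" using r0_le[OF True cs c'] by (simp add: a_def)
            \<comment> \<open>\<delta> \<le> r0 / 4 forces the far case.\<close>
            then have "\<kappa> (a k c s) = 16 * \<delta> / \<bar>a k c s - c'\<bar>" using 3 \<delta> r0 by (simp add: \<kappa>_def)
            also have "\<dots> \<le> 16 * \<delta> / r0" using r r0 \<delta> by (intro divide_left_mono) auto
            finally have "\<kappa> (a k c s) \<le> 16 * \<delta> / r0" .
            moreover have "0 \<le> 16 * \<delta> / r0" using r0 \<delta> by simp
            ultimately show "\<kappa> (a k c s) * pushforward k (critical_point_nbhd K1 n k c s (\<epsilon> (a k c s))) \<le> 16 * \<delta> / r0"
              using mult_mono[of "\<kappa> (a k c s)" "16 * \<delta> / r0" "pushforward k (critical_point_nbhd K1 n k c s (\<epsilon> (a k c s)))" 1]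
                pushforward_le_1 pushforward_nonneg by simp
          qed
          also have "\<dots> = \<theta> (n - Suc k)" using True by (simp add: \<theta>_def mult_ac case_prod_beta)
          finally show ?thesis .
        next
          case False
          have "(\<Sum>(c, s)\<in>?S. \<kappa> (a k c s) * pushforward k (critical_point_nbhd K1 n k c s (\<epsilon> (a k c s))))
              \<le> (\<Sum>(c, s)\<in>?S. 24 * K * K1 * \<delta> * critical_weight c s (n - Suc k))"
          proof (intro sum_mono, clarify)
            fix c s assume cs: "(c, s) \<in> ?S"
            define m where "m = n - Suc k"
            define \<Lambda> where "\<Lambda> = \<bar>Dn f D m (fval f c s)\<bar>"
            define L where "L = l c s"
            define z where "z = a k c s"
            define r where "r = \<bar>z - c'\<bar>"
            have \<Lambda>: "0 < \<Lambda>" using Dn_critical_nonzero[OF cs] by (simp add: \<Lambda>_def)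
            have L: "1 \<le> L" using critical_sidesD(3)[OF cs] by (simp add: L_def)
            have zC: "z \<in> MM - C" using critical_sidesD(4,5)[OF cs] iterate_MM by (simp add: z_def a_def)
            have r: "0 < r" using zC c' by (auto simp: r_def)
            define \<rho> where "\<rho> = K1 * (3 * \<epsilon> z / \<Lambda>) powr (1 / L)"
            have \<epsilon>z: "0 < \<epsilon> z" using \<delta> r by (simp add: \<epsilon>_def r_def)
            have \<kappa>z: "0 \<le> \<kappa> z" using \<delta> by (simp add: \<kappa>_def)
            have \<rho>: "0 < \<rho>" using K1pos \<epsilon>z \<Lambda> by (simp add: \<rho>_def)
            have "critical_point_nbhd K1 n k c s (\<epsilon> z) = {y. \<bar>y - c\<bar> < \<rho>}"
              by (simp add: critical_point_nbhd_def \<rho>_def \<Lambda>_def m_def L_def)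
            then have "pushforward k (critical_point_nbhd K1 n k c s (\<epsilon> z)) \<le> K * \<rho>"
              using less[OF k] critical_sidesD(1)[OF cs] \<rho> by simp
            then have "\<kappa> z * pushforward k (critical_point_nbhd K1 n k c s (\<epsilon> z)) \<le> \<kappa> z * (K * \<rho>)"
              using \<kappa>z by (rule mult_left_mono)
            also have "\<dots> = K * K1 * (\<kappa> z * (3 * \<epsilon> z / \<Lambda>) powr (1 / L))" by (simp add: \<rho>_def)
            also have "\<dots> \<le> K * K1 * (24 * \<delta> * (r powr (1 / L - 1) * \<Lambda> powr (- 1 / L)))"
            proof (rule mult_left_mono)
              show "\<kappa> z * (3 * \<epsilon> z / \<Lambda>) powr (1 / L) \<le> 24 * \<delta> * (r powr (1 / L - 1) * \<Lambda> powr (- 1 / L))"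
                using powr_bound_near[OF L r _ \<Lambda>, of \<delta>] powr_bound_far[OF L r \<delta> \<Lambda>]
                by (cases "r \<le> 2 * \<delta>") (simp_all add: \<kappa>_def \<epsilon>_def flip: r_def)
            qed (use Kpos K1pos in auto)
            also have "\<dots> \<le> K * K1 * (24 * \<delta> * critical_weight c s m)"
            proof (intro mult_left_mono)
              \<comment> \<open>The weight refers to the point of \<open>C\<close> closest to
                \<open>z\<close>, whereas the ball is centred at c'; since the exponent is
                nonpositive, the closest point is the worst.\<close>
              have "\<bar>z - closest C z\<bar> \<le> r" unfolding r_def by (rule closest(2)[OF c'])
              moreover have "0 < \<bar>z - closest C z\<bar>" using closest_side(2)[OF zC] by auto
              ultimately have "r powr (1 / L - 1) \<le> \<bar>z - closest C z\<bar> powr (1 / L - 1)"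
                using L by (intro powr_mono2') auto
              then show "r powr (1 / L - 1) * \<Lambda> powr (- 1 / L) \<le> critical_weight c s m"
                unfolding critical_weight_def Let_def z_def a_def m_def \<Lambda>_def L_def
                by (intro mult_right_mono) auto
            qed (use Kpos K1pos \<delta> in auto)
            finally show "\<kappa> (a k c s) * pushforward k (critical_point_nbhd K1 n k c s (\<epsilon> (a k c s)))
              \<le> 24 * K * K1 * \<delta> * critical_weight c s (n - Suc k)"
              by (simp add: z_def m_def mult_ac)
          qed
          also have "\<dots> = \<theta> (n - Suc k)" using False by (simp add: \<theta>_def \<tau>_def sum_distrib_left case_prod_beta)
          finally show ?thesis .
        qed
        have "(\<Sum>k<n. \<Sum>(c, s)\<in>?S. \<kappa> (a k c s) * pushforward k (critical_point_nbhd K1 n k c s (\<epsilon> (a k c s))))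
            \<le> (\<Sum>k<n. \<theta> (n - Suc k))"
          using inner by (intro sum_mono) auto
        also have "\<dots> = (\<Sum>m<n. \<theta> m)" by (rule sum.nat_diff_reindex)
        also have "\<dots> \<le> (\<Sum>m\<in>{..<m0} \<union> {m0..<n}. \<theta> m)"
        proof (rule sum_mono2)
          show "0 \<le> \<theta> m" for m using r0 \<delta> Kpos K1pos \<tau>pos by (simp add: \<theta>_def)
        qed auto
        also have "\<dots> = (\<Sum>m<m0. \<theta> m) + (\<Sum>m\<in>{m0..<n}. \<theta> m)"
          by (intro sum.union_disjoint) auto
        also have "(\<Sum>m<m0. \<theta> m) = N * \<delta>" by (simp add: \<theta>_def N_def)
        also have "(\<Sum>m\<in>{m0..<n}. \<theta> m) = 24 * K * K1 * \<delta> * (\<Sum>m\<in>{m0..<n}. \<tau> m)"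
          unfolding sum_distrib_left by (intro sum.cong) (auto simp: \<theta>_def)
        also have "\<dots> \<le> 24 * K * K1 * \<delta> * \<eta>"
          using tail Kpos K1pos \<delta> by (intro mult_left_mono) auto
        also have "\<dots> = K * \<delta> / 4" using K1pos by (simp add: \<eta>_def)
        finally have main: "(\<Sum>k<n. \<Sum>(c, s)\<in>?S. \<kappa> (a k c s) * pushforward k (critical_point_nbhd K1 n k c s (\<epsilon> (a k c s))))
          \<le> N * \<delta> + K * \<delta> / 4" by simp
        have "pushforward n A \<le> 2 * ((N * \<delta> + K * \<delta> / 4) + 48 * \<delta> / b)"
          using order_trans[OF le mult_left_mono[OF add_mono[OF main bdry]]] by simp
        also have "\<dots> = K * \<delta> / 2 + (4 * N + 192 / b) * \<delta> / 2" by (simp add: field_simps)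
        also have "\<dots> \<le> K * \<delta> / 2 + K * \<delta> / 2"
        proof -
          have "(4 * N + 192 / b) * \<delta> \<le> K * \<delta>" unfolding K_def using r0 \<delta> by (intro mult_right_mono) auto
          then show ?thesis by (intro add_left_mono divide_right_mono) auto
        qed
        finally show ?thesis by simp
      qed
      then show "pushforward n {y. \<bar>y - c'\<bar> < \<delta>} \<le> K * \<delta>" using pA by simp
    qed
  qed
  then show ?thesis using Kpos by blast
qed

text \<open>The position of \<open>A\<close> is arbitrary, so its size is taken as the scale: |A|
  \<le> \<epsilon> makes \<kappa> = 1 + 4 admissible at every critical value. The mass of a ball
  around \<open>C\<close> is linear in its radius, here about (\<epsilon> / |Df^m|)^(1/l), and the
  second summability condition sums these radii.\<close>

lemma pushforward_le_powr:
  assumes b: "0 < b" "\<And>n. b \<le> \<bar>Dn f D n v\<bar>"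
  shows "\<exists>K>0. \<forall>n. \<forall>A\<in>sets borel. A \<subseteq> MM \<longrightarrow> pushforward n A \<le> K * measure lborel A powr (1 / lmax C l)"
proof -
  obtain K1 where K1: "order_constant K1" using order_bound by blast
  have K1pos: "K1 > 0" using K1 by (simp add: order_constant_def)
  obtain K where K: "K > 0" "\<And>n c \<delta>. c \<in> C \<Longrightarrow> \<delta> > 0 \<Longrightarrow> pushforward n {y. \<bar>y - c\<bar> < \<delta>} \<le> K * \<delta>"
    using pushforward_ball_le[OF b] by blast
  let ?S = critical_sides and ?L = "lmax C l"
  note L = lmax_ge_1
  define \<tau> where "\<tau> m = (\<Sum>(c, s)\<in>?S. \<bar>Dn f D m (fval f c s)\<bar> powr (- 1 / l c s))" for m
  have \<tau>sum: "summable \<tau>"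
    unfolding \<tau>_def by (intro summable_sum) (use summable_Dn in auto)
  have \<tau>pos: "0 \<le> \<tau> m" for m unfolding \<tau>_def by (auto intro!: sum_nonneg)
  define Q where "Q = suminf \<tau>"
  have Q: "0 \<le> Q" "\<And>n. (\<Sum>m<n. \<tau> m) \<le> Q"
    unfolding Q_def using \<tau>sum \<tau>pos by (auto intro: suminf_nonneg sum_le_suminf)
  \<comment> \<open>15 = 5 times 3 and 30 = 5 times 6 with \<kappa> = 5; the summand 1 takes care of
    n = 0.\<close>
  define K' where "K' = 2 * (15 * K * K1 * Q + 30 / b) + 1"
  have K': "1 \<le> K'" using K K1pos Q b by (simp add: K'_def)
  \<comment> \<open>\<epsilon> may exceed |A|, so null sets are reached by letting \<epsilon> tend
    to 0; \<epsilon> \<le> 1 allows the exponent 1 / l to be lowered to 1 /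
    \<open>lmax C l\<close>.\<close>
  have main: "pushforward n A \<le> K' * \<epsilon> powr (1 / ?L)"
    if A: "A \<in> sets borel" "A \<subseteq> MM" and \<epsilon>: "0 < \<epsilon>" "\<epsilon> \<le> 1" "measure lborel A \<le> \<epsilon>" for n A \<epsilon>
  proof -
    have \<epsilon>le: "\<epsilon> \<le> \<epsilon> powr (1 / ?L)" using \<epsilon> L powr_mono'[of "1 / ?L" 1 \<epsilon>] by simp
    show ?thesis
    proof (cases "n = 0")
      case True
      have "pushforward n A \<le> 1 * \<epsilon> powr (1 / ?L)"
        using pushforward_0_le[OF A] True \<epsilon>(3) \<epsilon>le by simp
      also have "\<dots> \<le> K' * \<epsilon> powr (1 / ?L)" using K' by (intro mult_right_mono) auto
      finally show ?thesis .
    next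
      case False
      have adm: "admissible A z \<epsilon> 5" for z
        using \<epsilon> by (simp add: admissible_def field_simps)
      have le: "pushforward n A \<le>
          2 * ((\<Sum>k<n. \<Sum>(c, s)\<in>?S. 5 * pushforward k (critical_point_nbhd K1 n k c s \<epsilon>))
             + 5 * (6 * \<epsilon> / \<bar>Dn f D n v\<bar>))"
        using False by (intro pushforward_le[OF _ K1 A]) (auto intro!: adm)
      have "(\<Sum>k<n. \<Sum>(c, s)\<in>?S. 5 * pushforward k (critical_point_nbhd K1 n k c s \<epsilon>))
          \<le> (\<Sum>k<n. 15 * K * K1 * \<epsilon> powr (1 / ?L) * \<tau> (n - Suc k))"
      proof (rule sum_mono)
        fix k
        have "(\<Sum>(c, s)\<in>?S. 5 * pushforward k (critical_point_nbhd K1 n k c s \<epsilon>))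
          \<le> (\<Sum>(c, s)\<in>?S. 15 * K * K1 * \<epsilon> powr (1 / ?L) * \<bar>Dn f D (n - Suc k) (fval f c s)\<bar> powr (- 1 / l c s))"
        proof (intro sum_mono, clarify)
          fix c s assume cs: "(c, s) \<in> ?S"
          define \<Lambda> where "\<Lambda> = \<bar>Dn f D (n - Suc k) (fval f c s)\<bar>"
          have \<Lambda>: "0 < \<Lambda>" using Dn_critical_nonzero[OF cs] by (simp add: \<Lambda>_def)
          have l: "1 \<le> l c s" "l c s \<le> ?L" using critical_sidesD(3)[OF cs] l_le_lmax[OF cs] by auto
          define \<rho> where "\<rho> = K1 * (3 * \<epsilon> / \<Lambda>) powr (1 / l c s)"
          have "pushforward k (critical_point_nbhd K1 n k c s \<epsilon>) \<le> K * \<rho>"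
            using K(2)[OF critical_sidesD(1)[OF cs], of \<rho> k] K1pos \<epsilon> \<Lambda>
            by (simp add: critical_point_nbhd_def \<rho>_def \<Lambda>_def)
          also have "\<rho> = K1 * (3 powr (1 / l c s) * \<epsilon> powr (1 / l c s) * \<Lambda> powr (- 1 / l c s))"
            unfolding \<rho>_def by (simp only: powr_divide powr_mult) (simp add: powr_minus_divide)
          also have "\<dots> \<le> K1 * (3 * \<epsilon> powr (1 / ?L) * \<Lambda> powr (- 1 / l c s))"
          proof (intro mult_left_mono mult_right_mono mult_mono)
            show "3 powr (1 / l c s) \<le> (3::real)" using l powr_mono[of "1 / l c s" 1 3] by simp
            show "\<epsilon> powr (1 / l c s) \<le> \<epsilon> powr (1 / ?L)"
              using l L \<epsilon> by (intro powr_mono' divide_left_mono) auto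
          qed (use K1pos in auto)
          finally have "5 * pushforward k (critical_point_nbhd K1 n k c s \<epsilon>)
             \<le> 5 * (K * (K1 * (3 * \<epsilon> powr (1 / ?L) * \<Lambda> powr (- 1 / l c s))))"
            using K(1) by (simp add: mult_ac)
          then show "5 * pushforward k (critical_point_nbhd K1 n k c s \<epsilon>)
             \<le> 15 * K * K1 * \<epsilon> powr (1 / ?L) * \<bar>Dn f D (n - Suc k) (fval f c s)\<bar> powr (- 1 / l c s)"
            by (simp add: \<Lambda>_def mult_ac)
        qed
        also have "\<dots> = 15 * K * K1 * \<epsilon> powr (1 / ?L) * \<tau> (n - Suc k)"
          by (simp add: \<tau>_def sum_distrib_left case_prod_beta)
        finally show "(\<Sum>(c, s)\<in>?S. 5 * pushforward k (critical_point_nbhd K1 n k c s \<epsilon>))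
          \<le> 15 * K * K1 * \<epsilon> powr (1 / ?L) * \<tau> (n - Suc k)" .
      qed
      also have "\<dots> = 15 * K * K1 * \<epsilon> powr (1 / ?L) * (\<Sum>m<n. \<tau> m)"
        by (simp add: sum_distrib_left[symmetric] sum.nat_diff_reindex)
      also have "\<dots> \<le> 15 * K * K1 * \<epsilon> powr (1 / ?L) * Q"
        using Q K(1) K1pos by (intro mult_left_mono) auto
      finally have s: "(\<Sum>k<n. \<Sum>(c, s)\<in>?S. 5 * pushforward k (critical_point_nbhd K1 n k c s \<epsilon>))
          \<le> 15 * K * K1 * \<epsilon> powr (1 / ?L) * Q" .
      have "5 * (6 * \<epsilon> / \<bar>Dn f D n v\<bar>) \<le> 5 * (6 * \<epsilon> / b)"
        using b \<epsilon> by (intro mult_left_mono frac_le) auto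
      also have "\<dots> \<le> 5 * (6 * \<epsilon> powr (1 / ?L) / b)"
        using b \<epsilon>le by (intro mult_left_mono divide_right_mono) auto
      finally have t: "5 * (6 * \<epsilon> / \<bar>Dn f D n v\<bar>) \<le> 5 * (6 * \<epsilon> powr (1 / ?L) / b)" .
      have "pushforward n A \<le> 2 * (15 * K * K1 * \<epsilon> powr (1 / ?L) * Q + 5 * (6 * \<epsilon> powr (1 / ?L) / b))"
        using order_trans[OF le mult_left_mono[OF add_mono[OF s t]]] by simp
      also have "\<dots> = 2 * (15 * K * K1 * Q + 30 / b) * \<epsilon> powr (1 / ?L)" by (simp add: algebra_simps)
      also have "\<dots> \<le> K' * \<epsilon> powr (1 / ?L)" unfolding K'_def by (intro mult_right_mono) auto
      finally show ?thesis .
    qed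
  qed
  show ?thesis
  proof (intro exI[of _ K'] conjI allI ballI impI)
    show "0 < K'" using K' by simp
    fix n A assume A: "A \<in> sets borel" "A \<subseteq> MM"
    have "measure lborel A \<le> measure lborel MM" using A by (intro measure_mono_MM) (auto simp: MM_def)
    then have le1: "measure lborel A \<le> 1" by (simp add: MM_def)
    show "pushforward n A \<le> K' * measure lborel A powr (1 / ?L)"
    proof (cases "measure lborel A = 0")
      case True
      have "((\<lambda>\<epsilon>. K' * \<epsilon> powr (1 / ?L)) \<longlongrightarrow> K' * 0 powr (1 / ?L)) (at_right 0)"
        using L by (intro tendsto_intros tendsto_powr') (auto simp: eventually_at_filter)
      moreover have "\<forall>\<^sub>F \<epsilon> in at_right 0. pushforward n A \<le> K' * \<epsilon> powr (1 / ?L)"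
        using eventually_at_right_real[of 0 "1::real"]
      proof (rule eventually_mono)
        fix \<epsilon> :: real assume "\<epsilon> \<in> {0<..<1}"
        then show "pushforward n A \<le> K' * \<epsilon> powr (1 / ?L)" using main[OF A, of \<epsilon>] True by simp
      qed simp
      ultimately have "pushforward n A \<le> K' * 0 powr (1 / ?L)"
        by (intro tendsto_lowerbound[of _ _ "at_right 0"]) auto
      then show ?thesis using True by simp
    next
      case False
      then have "0 < measure lborel A" by (simp add: zero_less_measure_iff)
      then show ?thesis using main[OF A _ le1 order_refl] by blast
    qed
  qed
qed

end

section \<open>The invariant density\<close>

lemma space_LebM: "space LebM = MM" by (simp add: LebM_def space_restrict_space)

lemma sets_LebM_iff: "A \<in> sets LebM \<longleftrightarrow> A \<in> sets borel \<and> A \<subseteq> MM"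
  unfolding LebM_def by (subst sets_restrict_space_iff) (auto simp: MM_def)

lemma sets_LebM: "sets LebM = sets (restrict_space borel MM)"
  by (auto simp: LebM_def intro!: sets_restrict_space_cong)

lemma emeasure_LebM: "A \<in> sets LebM \<Longrightarrow> emeasure LebM A = emeasure lborel A"
  using sets_LebM_iff[of A] unfolding LebM_def by (intro emeasure_restrict_space) (auto simp: MM_def)

lemma measure_LebM: "A \<in> sets LebM \<Longrightarrow> measure LebM A = measure lborel A"
  by (simp add: measure_def emeasure_LebM)

lemma finite_measure_LebM: "finite_measure LebM"
proof
  show "emeasure LebM (space LebM) \<noteq> \<infinity>"
    using emeasure_LebM[OF sets.top] by (simp add: space_LebM MM_def)
qed

context class_A_start
begin

definition average :: "nat \<Rightarrow> real set \<Rightarrow> real" where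
  "average N A = (\<Sum>n\<le>N. pushforward n A) / real (Suc N)"

lemma average_bounds: "0 \<le> average N A" "average N A \<le> 1"
proof -
  show "0 \<le> average N A" unfolding average_def by (intro divide_nonneg_pos sum_nonneg pushforward_nonneg) auto
  have "(\<Sum>n\<le>N. pushforward n A) \<le> (\<Sum>n\<le>N. 1)" by (intro sum_mono pushforward_le_1)
  then show "average N A \<le> 1" unfolding average_def by simp
qed

lemma pushforward_Un:
  assumes "A \<in> sets borel" "B \<in> sets borel" "A \<inter> B = {}"
  shows "pushforward n (A \<union> B) = pushforward n A + pushforward n B"
proof -
  have "{x\<in>{y0<..<y1}. (f ^^ n) x \<in> A \<union> B} = {x\<in>{y0<..<y1}. (f ^^ n) x \<in> A} \<union> {x\<in>{y0<..<y1}. (f ^^ n) x \<in> B}"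
    by auto
  moreover have "{x\<in>{y0<..<y1}. (f ^^ n) x \<in> A} \<inter> {x\<in>{y0<..<y1}. (f ^^ n) x \<in> B} = {}" using assms(3) by auto
  moreover have "{x\<in>{y0<..<y1}. (f ^^ n) x \<in> X} \<in> fmeasurable lborel" if "X \<in> sets borel" for X
    using Ioo_MM by (intro borel_subset_MM_fmeasurable pushforward_set_borel that) auto
  ultimately show ?thesis
    unfolding pushforward_def using assms
    by (simp add: measure_Un3 del: greaterThanLessThan_iff Int_iff)
qed

lemma pushforward_vimage: "pushforward n {x\<in>MM. f x \<in> A} = pushforward (Suc n) A"
proof -
  have "{x\<in>{y0<..<y1}. (f ^^ n) x \<in> {x\<in>MM. f x \<in> A}} = {x\<in>{y0<..<y1}. (f ^^ Suc n) x \<in> A}"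
    using Ioo_MM iterate_MM by auto
  then show ?thesis by (simp only: pushforward_def)
qed

lemma pushforward_MM: "pushforward n MM = y1 - y0"
proof -
  have "{x\<in>{y0<..<y1}. (f ^^ n) x \<in> MM} = {y0<..<y1}" using Ioo_MM iterate_MM by auto
  then show ?thesis using y(1) by (simp add: pushforward_def)
qed

text \<open>A cluster point of the averages in the product topology is only finitely additive a priori;
  the uniform power bound will make it a measure.\<close>

lemma invariant_content:
  assumes bd: "\<And>n A. A \<in> sets borel \<Longrightarrow> A \<subseteq> MM \<Longrightarrow> pushforward n A \<le> B A"
  obtains \<nu> :: "real set \<Rightarrow> real" where "\<And>A. 0 \<le> \<nu> A" "\<nu> MM = y1 - y0"
    "\<And>A A'. A \<in> sets borel \<Longrightarrow> A' \<in> sets borel \<Longrightarrow> A \<inter> A' = {} \<Longrightarrow> \<nu> (A \<union> A') = \<nu> A + \<nu> A'"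
    "\<And>A. A \<in> sets borel \<Longrightarrow> A \<subseteq> MM \<Longrightarrow> \<nu> A \<le> B A"
    "\<And>A. \<nu> {x\<in>MM. f x \<in> A} = \<nu> A"
proof -
  \<comment> \<open>By Tychonoff the cube indexed by all sets of reals is compact. The index set is
    uncountable, so the filter \<open>G\<close>, refining both the averages and the neighbourhoods
    of \<nu>, takes the place of a convergent subsequence.\<close>
  let ?U = "PiE UNIV (\<lambda>_::real set. {0..1::real})"
  have "compactin (product_topology (\<lambda>_. euclidean) UNIV) ?U"
    by (subst compactin_PiE) (auto simp: compactin_euclidean_iff)
  then have "compact ?U" by (simp add: euclidean_product_topology compactin_euclidean_iff)
  moreover define F where "F = filtermap average sequentially"
  have "F \<noteq> bot" by (simp add: F_def filtermap_bot_iff)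
  moreover have "eventually (\<lambda>g. g \<in> ?U) F"
    unfolding F_def eventually_filtermap by (intro always_eventually) (auto simp: average_bounds)
  ultimately obtain \<nu> where \<nu>: "inf (nhds \<nu>) F \<noteq> bot"
    unfolding compact_filter by blast
  define G where "G = inf (nhds \<nu>) F"
  have G: "G \<noteq> bot" "G \<le> nhds \<nu>" "G \<le> F" using \<nu> by (auto simp: G_def)
  have lim: "((\<lambda>g. g A) \<longlongrightarrow> \<nu> A) G" for A
  proof -
    have "((\<lambda>g. g A) \<longlongrightarrow> \<nu> A) (nhds \<nu>)"
    proof (rule topological_tendstoI)
      fix S :: "real set" assume S: "open S" "\<nu> A \<in> S"
      have "open ((\<lambda>g. g A) -` S)" using S(1) by (rule open_vimage) simp
      then show "\<forall>\<^sub>F g in nhds \<nu>. g A \<in> S" using S(2) unfolding eventually_nhds by fastforce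
    qed
    then show ?thesis using G(2) by (rule tendsto_mono[rotated])
  qed
  have ev: "eventually P G" if "\<And>N. P (average N)" for P
    by (rule filter_leD[OF G(3)]) (simp add: F_def eventually_filtermap that)
  have limG: "(\<phi> \<longlongrightarrow> a) G" if "(\<lambda>N. \<phi> (average N)) \<longlonglongrightarrow> a" for \<phi> :: "(real set \<Rightarrow> real) \<Rightarrow> real" and a
    using that by (intro tendsto_mono[OF G(3)]) (simp add: F_def filterlim_filtermap)
  show thesis
  proof
    show "0 \<le> \<nu> A" for A
      by (rule tendsto_lowerbound[OF lim ev G(1)]) (rule average_bounds)
    show "\<nu> MM = y1 - y0"
    proof (rule tendsto_unique[OF G(1) lim])
      have "average N MM = y1 - y0" for N by (simp add: average_def pushforward_MM)
      then show "((\<lambda>g. g MM) \<longlongrightarrow> y1 - y0) G" by (intro limG) simp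
    qed
    show "\<nu> (A \<union> A') = \<nu> A + \<nu> A'" if "A \<in> sets borel" "A' \<in> sets borel" "A \<inter> A' = {}" for A A'
    proof -
      have "average N (A \<union> A') - (average N A + average N A') = 0" for N
        using pushforward_Un[OF that] by (simp add: average_def sum.distrib add_divide_distrib)
      then have "((\<lambda>g. g (A \<union> A') - (g A + g A')) \<longlongrightarrow> 0) G" by (intro limG) simp
      moreover have "((\<lambda>g. g (A \<union> A') - (g A + g A')) \<longlongrightarrow> \<nu> (A \<union> A') - (\<nu> A + \<nu> A')) G"
        by (intro tendsto_intros lim)
      ultimately show ?thesis using tendsto_unique[OF G(1)] by fastforce
    qed
    show "\<nu> A \<le> B A" if "A \<in> sets borel" "A \<subseteq> MM" for A
    proof (rule tendsto_upperbound[OF lim ev G(1)])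
      fix N
      have "(\<Sum>n\<le>N. pushforward n A) \<le> (\<Sum>n\<le>N. B A)" by (intro sum_mono bd that)
      then show "average N A \<le> B A" by (simp add: average_def field_simps)
    qed
    show "\<nu> {x\<in>MM. f x \<in> A} = \<nu> A" for A
    proof -
      let ?A = "{x\<in>MM. f x \<in> A}"
      \<comment> \<open>Taking the preimage shifts time by one, so the difference of the averages
        telescopes to two masses in [0, 1].\<close>
      have "\<bar>average N ?A - average N A\<bar> \<le> 1 / real (Suc N)" for N
      proof -
        have "average N ?A - average N A = (\<Sum>n\<le>N. pushforward (Suc n) A - pushforward n A) / real (Suc N)"
          by (simp add: average_def pushforward_vimage sum_subtractf diff_divide_distrib)
        also have "(\<Sum>n\<le>N. pushforward (Suc n) A - pushforward n A) = pushforward (Suc N) A - pushforward 0 A"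
          using sum_lessThan_telescope[of "\<lambda>n. pushforward n A" "Suc N"] by (simp add: lessThan_Suc_atMost)
        finally show ?thesis
          using pushforward_nonneg[of "Suc N" A] pushforward_nonneg[of 0 A] pushforward_le_1[of "Suc N" A] pushforward_le_1[of 0 A]
          by (simp add: abs_divide divide_right_mono)
      qed
      then have "\<forall>\<^sub>F N in sequentially. norm (average N ?A - average N A) \<le> inverse (real (Suc N))"
        by (intro always_eventually allI) (simp only: real_norm_def inverse_eq_divide)
      then have "(\<lambda>N. average N ?A - average N A) \<longlonglongrightarrow> 0"
        by (rule Lim_null_comparison[OF _ LIMSEQ_inverse_real_of_nat])
      then have "((\<lambda>g. g ?A - g A) \<longlongrightarrow> 0) G" by (rule limG)
      moreover have "((\<lambda>g. g ?A - g A) \<longlongrightarrow> \<nu> ?A - \<nu> A) G" by (intro tendsto_intros lim)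
      ultimately show ?thesis using tendsto_unique[OF G(1)] by fastforce
    qed
  qed
qed

end

text \<open>For sets decreasing to the empty set Lebesgue measure tends to 0, hence so does \<nu>;
  finite additivity and continuity at the empty set give countable additivity.\<close>

lemma countably_additive_of_continuous_bound:
  fixes \<nu> :: "real set \<Rightarrow> real"
  assumes nonneg: "\<And>A. 0 \<le> \<nu> A"
    and add: "\<And>A A'. A \<in> sets borel \<Longrightarrow> A' \<in> sets borel \<Longrightarrow> A \<inter> A' = {} \<Longrightarrow> \<nu> (A \<union> A') = \<nu> A + \<nu> A'"
    and bd: "\<And>A. A \<in> sets borel \<Longrightarrow> A \<subseteq> MM \<Longrightarrow> \<nu> A \<le> K * measure lborel A powr a"
    and a: "0 < a"
  shows "countably_additive (sets LebM) (\<lambda>A. ennreal (\<nu> A))" "positive (sets LebM) (\<lambda>A. ennreal (\<nu> A))"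
proof -
  interpret L: finite_measure LebM by (rule finite_measure_LebM)
  have "\<nu> {} = 0" using add[of "{}" "{}"] by simp
  then show pos: "positive (sets LebM) (\<lambda>A. ennreal (\<nu> A))" by (simp add: positive_def)
  show "countably_additive (sets LebM) (\<lambda>A. ennreal (\<nu> A))"
  proof (rule sets.empty_continuous_imp_countably_additive[OF pos])
    show "additive (sets LebM) (\<lambda>A. ennreal (\<nu> A))"
      using add nonneg by (auto simp: Measure_Space.additive_def sets_LebM_iff ennreal_plus)
    show "\<forall>A\<in>sets LebM. ennreal (\<nu> A) \<noteq> \<infinity>" by simp
    fix A :: "nat \<Rightarrow> real set" assume A: "range A \<subseteq> sets LebM" "decseq A" "(\<Inter>i. A i) = {}"
    have "(\<lambda>i. measure LebM (A i)) \<longlonglongrightarrow> measure LebM (\<Inter>i. A i)"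
      using A(1,2) by (rule L.finite_Lim_measure_decseq)
    then have "(\<lambda>i. measure LebM (A i)) \<longlonglongrightarrow> 0" using A(3) by simp
    moreover have "measure LebM (A i) = measure lborel (A i)" for i
      using A(1) by (intro measure_LebM) auto
    ultimately have "(\<lambda>i. measure lborel (A i)) \<longlonglongrightarrow> 0" by simp
    then have "(\<lambda>i. K * measure lborel (A i) powr a) \<longlonglongrightarrow> K * 0 powr a"
      using a by (intro tendsto_intros tendsto_powr') auto
    then have "(\<lambda>i. K * measure lborel (A i) powr a) \<longlonglongrightarrow> 0" by simp
    then have "(\<lambda>i. \<nu> (A i)) \<longlonglongrightarrow> 0"
    proof (rule Lim_null_comparison[rotated])
      have "\<nu> (A i) \<le> K * measure lborel (A i) powr a" for i
        using A(1) sets_LebM_iff by (intro bd) auto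
      then show "\<forall>\<^sub>F i in sequentially. norm (\<nu> (A i)) \<le> K * measure lborel (A i) powr a"
        using nonneg by simp
    qed
    then show "(\<lambda>i. ennreal (\<nu> (A i))) \<longlonglongrightarrow> 0" using tendsto_ennrealI by fastforce
  qed
qed

context class_A
begin

lemma f_measurable_LebM: "f \<in> measurable LebM LebM"
  using f_measurable by (simp add: measurable_cong_sets[OF sets_LebM sets_LebM])

text \<open>The power bound makes \<nu> vanish on Lebesgue null sets, which yields the density
  \<open>h\<close>. On the level set of \<open>h\<close> at t, \<nu> is at least t times Lebesgue
  measure, so there the same bound becomes the weak estimate for \<open>h\<close>.\<close>

lemma invariant_density_of_content:
  fixes \<nu> :: "real set \<Rightarrow> real"
  assumes nonneg: "\<And>A. 0 \<le> \<nu> A" and one: "\<nu> MM = 1"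
    and add: "\<And>A A'. A \<in> sets borel \<Longrightarrow> A' \<in> sets borel \<Longrightarrow> A \<inter> A' = {} \<Longrightarrow> \<nu> (A \<union> A') = \<nu> A + \<nu> A'"
    and K: "0 < K" and bd: "\<And>A. A \<in> sets borel \<Longrightarrow> A \<subseteq> MM \<Longrightarrow> \<nu> A \<le> K * measure lborel A powr (1 / lmax C l)"
    and inv: "\<And>A. \<nu> {x\<in>MM. f x \<in> A} = \<nu> A"
  shows "\<exists>h :: real \<Rightarrow> real.
           h \<in> borel_measurable LebM \<and> (\<forall>x. 0 \<le> h x) \<and>
           (let \<mu> = density LebM (\<lambda>x. ennreal (h x)) in
              prob_space \<mu> \<and> f \<in> measurable \<mu> \<mu> \<and> distr \<mu> \<mu> f = \<mu>) \<and>
           (lmax C l > 1 \<longrightarrow>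
              (\<forall>p::real. 1 \<le> p \<and> p < lmax C l / (lmax C l - 1) \<longrightarrow>
                 integrable LebM (\<lambda>x. \<bar>h x\<bar> powr p)))"
proof -
  interpret L: finite_measure LebM by (rule finite_measure_LebM)
  have a: "0 < 1 / lmax C l" using lmax_ge_1 by simp
  note ca = countably_additive_of_continuous_bound[OF nonneg add bd a]
  define \<mu> where "\<mu> = measure_of MM (sets LebM) (\<lambda>A. ennreal (\<nu> A))"
  have sa: "sigma_algebra MM (sets LebM)" using sets.sigma_algebra_axioms[of LebM] by (simp add: space_LebM)
  have \<mu>: "sets \<mu> = sets LebM" "space \<mu> = MM"
    unfolding \<mu>_def using sa by (simp_all add: sigma_algebra.sets_measure_of_eq sigma_algebra.space_measure_of_eq)
  have e\<mu>: "emeasure \<mu> A = ennreal (\<nu> A)" if "A \<in> sets LebM" for A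
    unfolding \<mu>_def by (rule emeasure_measure_of_sigma[OF sa ca(2,1) that])
  have MM_sets: "MM \<in> sets LebM" using sets.top[of LebM] by (simp add: space_LebM)
  have prob: "prob_space \<mu>" by (rule prob_spaceI) (simp add: \<mu> e\<mu>[OF MM_sets] one)
  interpret P: prob_space \<mu> by fact
  have ac: "absolutely_continuous LebM \<mu>"
    unfolding absolutely_continuous_def
  proof
    fix A assume A: "A \<in> null_sets LebM"
    then have "A \<in> sets LebM" "measure LebM A = 0" by (auto simp: null_sets_def measure_def)
    then have "\<nu> A \<le> 0" using bd[of A] by (simp add: sets_LebM_iff measure_LebM)
    then show "A \<in> null_sets \<mu>"
      using \<open>A \<in> sets LebM\<close> nonneg[of A] by (auto simp: null_sets_def \<mu> e\<mu>)
  qed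
  obtain h where h: "h \<in> borel_measurable LebM" "AE x in LebM. RN_deriv LebM \<mu> x = ennreal (h x)" "\<And>x. 0 \<le> h x"
    using L.real_RN_deriv[OF P.finite_measure_axioms ac \<mu>(1)] by metis
  have dens: "density LebM (\<lambda>x. ennreal (h x)) = \<mu>"
  proof -
    have "density LebM (\<lambda>x. ennreal (h x)) = density LebM (RN_deriv LebM \<mu>)"
      using h(1,2) by (intro density_cong) (auto elim: eventually_mono)
    then show ?thesis using L.density_RN_deriv[OF ac \<mu>(1)] by simp
  qed
  have fm: "f \<in> measurable \<mu> \<mu>"
    using f_measurable_LebM by (simp add: measurable_cong_sets[OF \<mu>(1) \<mu>(1)])
  have dist: "distr \<mu> \<mu> f = \<mu>"
  proof (rule measure_eqI)
    fix A assume "A \<in> sets (distr \<mu> \<mu> f)"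
    then have A: "A \<in> sets \<mu>" by simp
    have eq: "f -` A \<inter> space \<mu> = {x\<in>MM. f x \<in> A}" by (auto simp: \<mu>)
    have "{x\<in>MM. f x \<in> A} \<in> sets LebM" using measurable_sets[OF fm A] \<mu>(1) eq by simp
    then show "emeasure (distr \<mu> \<mu> f) A = emeasure \<mu> A"
      using A fm by (simp add: emeasure_distr eq e\<mu> inv \<mu>(1))
  qed simp
  have "integrable LebM (\<lambda>x. \<bar>h x\<bar> powr p)" if lm: "lmax C l > 1" and p: "1 \<le> p" "p < lmax C l / (lmax C l - 1)" for p
  proof (rule integrable_powr_of_weak_bound[OF finite_measure_LebM h(1,3) lm K _ p])
    fix t :: real assume t: "0 < t"
    let ?A = "{x\<in>space LebM. t \<le> h x}"
    have A: "?A \<in> sets LebM" using h(1) by measurable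
    have "ennreal (t * measure LebM ?A) = (\<integral>\<^sup>+ x. ennreal t * indicator ?A x \<partial>LebM)"
      using A t by (simp add: nn_integral_cmult_indicator L.emeasure_eq_measure ennreal_mult)
    also have "\<dots> \<le> (\<integral>\<^sup>+ x. ennreal (h x) * indicator ?A x \<partial>LebM)"
      by (intro nn_integral_mono) (auto simp: indicator_def ennreal_leI)
    also have "\<dots> = emeasure \<mu> ?A"
      unfolding dens[symmetric] using A h(1) by (intro emeasure_density[symmetric]) auto
    also have "\<dots> = ennreal (\<nu> ?A)" by (rule e\<mu>[OF A])
    finally have "t * measure LebM ?A \<le> \<nu> ?A" using nonneg by simp
    also have "\<dots> \<le> K * measure LebM ?A powr (1 / lmax C l)"
      using bd[of ?A] A by (simp add: sets_LebM_iff measure_LebM[OF A])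
    finally show "t * measure LebM ?A \<le> K * measure LebM ?A powr (1 / lmax C l)" .
  qed
  then show ?thesis
    using h(1,3) prob fm dist by (intro exI[of _ h]) (simp add: Let_def dens)
qed

end

theorem theoremB:
  fixes f :: "real \<Rightarrow> real" and C :: "real set" and l :: "real \<Rightarrow> bool \<Rightarrow> real"
    and D :: "real \<Rightarrow> real"
  assumes "classA f C l D"
  shows "\<exists>h :: real \<Rightarrow> real.
           h \<in> borel_measurable LebM \<and> (\<forall>x. 0 \<le> h x) \<and>
           (let \<mu> = density LebM (\<lambda>x. ennreal (h x)) in
              prob_space \<mu> \<and> f \<in> measurable \<mu> \<mu> \<and> distr \<mu> \<mu> f = \<mu>) \<and>
           (lmax C l > 1 \<longrightarrow>
              (\<forall>p::real. 1 \<le> p \<and> p < lmax C l / (lmax C l - 1) \<longrightarrow>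
                 integrable LebM (\<lambda>x. \<bar>h x\<bar> powr p)))"
proof -
  interpret class_A f C l D by unfold_locales fact
  obtain c s where cs: "(c, s) \<in> critical_sides" using critical_sides_nonempty by auto
  define v where "v = fval f c s"
  have c: "c \<in> C" "c \<in> MM" using critical_sidesD(1)[OF cs] C_subset by auto
  have v: "v \<in> MM" "\<And>k. (f ^^ k) v \<notin> C" using critical_sidesD(4,5)[OF cs] by (auto simp: v_def)
  \<comment> \<open>The critical orbit avoids \<open>C\<close> already at the critical value
    itself.\<close>
  have "v \<noteq> c" using v(2)[of 0] c by auto
  then interpret S: class_A_start f C l D "min c v" "max c v" v
    using c v by unfold_locales (auto simp: min_def max_def)
  obtain b where b: "b > 0" "\<And>n. b \<le> \<bar>Dn f D n v\<bar>" using Dn_bounded_below[OF cs] unfolding v_def by blast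
  obtain K where K: "K > 0" "\<And>n A. A \<in> sets borel \<Longrightarrow> A \<subseteq> MM \<Longrightarrow> S.pushforward n A \<le> K * measure lborel A powr (1 / lmax C l)"
    using S.pushforward_le_powr[OF b] by blast
  obtain \<nu> :: "real set \<Rightarrow> real" where \<nu>: "\<And>A. 0 \<le> \<nu> A" "\<nu> MM = max c v - min c v"
    "\<And>A A'. A \<in> sets borel \<Longrightarrow> A' \<in> sets borel \<Longrightarrow> A \<inter> A' = {} \<Longrightarrow> \<nu> (A \<union> A') = \<nu> A + \<nu> A'"
    "\<And>A. A \<in> sets borel \<Longrightarrow> A \<subseteq> MM \<Longrightarrow> \<nu> A \<le> K * measure lborel A powr (1 / lmax C l)"
    "\<And>A. \<nu> {x\<in>MM. f x \<in> A} = \<nu> A"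
    using S.invariant_content[OF K(2)] by blast
  \<comment> \<open>The total mass of the push-forwards is the length of the start interval; the
    content is normalised only here.\<close>
  define m where "m = max c v - min c v"
  have m: "m > 0" using \<open>v \<noteq> c\<close> by (auto simp: m_def)
  show ?thesis
  proof (rule invariant_density_of_content[of "\<lambda>A. \<nu> A / m" "K / m"])
    show "\<nu> A / m \<le> K / m * measure lborel A powr (1 / lmax C l)" if "A \<in> sets borel" "A \<subseteq> MM" for A
      using divide_right_mono[OF \<nu>(4)[OF that], of m] m by simp
  qed (use \<nu> m K(1) in \<open>auto simp: m_def[symmetric] add_divide_distrib\<close>)
qed

end
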